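(* Let $\sigma=\sigma_{i_1}\circ\cdots\circ\sigma_{i_n}$ (with $n \geq 1$ and $i_1,\ldots,i_n\in\{1,2,3\}$) be a finite product of the three-letter Arnoux-Rauzy substitutions $\sigma_1,\sigma_2,\sigma_3$, and suppose that $\sigma$ is Pisot irreducible. Then there exists a partition $(\mathcal P_1,\mathcal P_2,\mathcal P_3)$ of the $3$-dimensional torus $\mathbb T^3=\mathbb R^3/\mathbb Z^3$ which is a Markov partition for the toral automorphism $(\mathbb T^3,\mathbf M_\sigma)$ given by the incidence matrix $\mathbf M_\sigma$ of $\sigma$, and such that the elements $\mathcal P_1,\mathcal P_2,\mathcal P_3$ of the partition are connected.
   Context: Substitutions. Let $\mathcal A=\{1,2,3\}$ and let $\mathcal A^\star$ be the set of finite words over $\mathcal A$. A substitution is a map $\sigma:\mathcal A^\star\to\mathcal A^\star$ with $\sigma(uv)=\sigma(u)\sigma(v)$ for all words $u,v$ and such that the image of each letter is not the empty word. Its incidence matrix is $\mathbf M_\sigma=(m_{ij})_{1\le i,j\le 3}$, where $m_{ij}$ is the number of occurrences of the letter $i$ in $\sigma(j)$. The substitution is unimodular if $\det \mathbf M_\sigma=\pm1$. The Arnoux-Rauzy substitutions are $\sigma_1: 1\mapsto 1,\ 2\mapsto 21,\ 3\mapsto 31$; $\sigma_2: 1\mapsto 12,\ 2\mapsto 2,\ 3\mapsto 32$; $\sigma_3: 1\mapsto 13,\ 2\mapsto 23,\ 3\mapsto 3$. They are unimodular, and so is every finite product of them. A Pisot number is a real algebraic integer greater than $1$ all of whose other conjugates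 have absolute value less than $1$. A unimodular substitution $\sigma$ is Pisot irreducible if the maximal eigenvalue of $\mathbf M_\sigma$ is a Pisot number and the characteristic polynomial of $\mathbf M_\sigma$ is irreducible (over $\mathbb Q$). Toral automorphism. $(\mathbb T^3,\mathbf M_\sigma)$ is the automorphism $T:\mathbb T^3\to\mathbb T^3$, $T(\mathbf x \bmod \mathbb Z^3)=\mathbf M_\sigma\mathbf x \bmod \mathbb Z^3$. When $\sigma$ is Pisot irreducible, $\mathbb R^3=E^s\oplus E^u$, where $E^u$ is the (one-dimensional) eigenspace of $\mathbf M_\sigma$ for its maximal eigenvalue and $E^s$ is the two-dimensional $\mathbf M_\sigma$-invariant contracting plane. Let $q:\mathbb R^3\to\mathbb T^3$ be the quotient map. Markov partition (geometric sense; partitions are understood up to boundaries, and no generating or small-diameter condition is imposed). A finite family $(\mathcal P_1,\dots,\mathcal P_r)$ of nonempty closed subsets of $\mathbb T^3$ is a Markov partition for $T$ if: (1) $\bigcup_i\mathcal P_i=\mathbb T^3$, each $\mathcal P_i$ is the closure of its interior, and the interiors of the $\mathcal P_i$ are pairwise disjoint; (2) (product structure) for each $i$ there are compact sets $A_i\subset E^s$ and $B_i\subset E^u$, each the closure of its interior (relative to $E^s$, $E^u$ respectively), and a vector $\mathbf t_i\in\mathbb R^3$, such that $\mathcal P_i=q(\mathbf t_i+A_i+B_i)$ and $q$ is injective on $\mathbf t_i+\operatorname{int}A_i+\operatorname{int}B_i$. For $x=q(\mathbf t_i+a+b)$ with $a\in\operatorname{int}A_i$, $b\in\operatorname{int}B_i$,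 put $W^s(x,\mathcal P_i)=q(\mathbf t_i+A_i+b)$ and $W^u(x,\mathcal P_i)=q(\mathbf t_i+a+B_i)$; (3) (Markov property) whenever $x\in q(\mathbf t_i+\operatorname{int}A_i+\operatorname{int}B_i)$ and $T(x)\in q(\mathbf t_j+\operatorname{int}A_j+\operatorname{int}B_j)$, one has $T(W^s(x,\mathcal P_i))\subseteq W^s(T(x),\mathcal P_j)$ and $T(W^u(x,\mathcal P_i))\supseteq W^u(T(x),\mathcal P_j)$. *)

theory Defs
  imports
    "HOL-Analysis.Analysis"
begin

section \<open>Substitutions\<close>

text \<open>
  The alphabet \<open>{1,2,3}\<close> is the numeral type \<open>3\<close> (its three elements are \<open>1\<close>, \<open>2\<close> and \<open>3\<close>, with
  \<open>3 = 0\<close>), so that letters are at the same time indices of \<open>real^3\<close>; words are lists.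
\<close>

definition substitution :: "(3 list \<Rightarrow> 3 list) \<Rightarrow> bool" where
  "substitution \<sigma> \<longleftrightarrow> (\<forall>u v. \<sigma> (u @ v) = \<sigma> u @ \<sigma> v) \<and> (\<forall>a. \<sigma> [a] \<noteq> [])"

text \<open>Polymorphic in the entries, because it is used over the integers, the rationals and the reals.\<close>

definition incidence_matrix :: "(3 list \<Rightarrow> 3 list) \<Rightarrow> 'a::semiring_1^3^3" where
  "incidence_matrix \<sigma> = (\<chi> i j. of_nat (count_list (\<sigma> [j]) i))"

definition unimodular :: "(3 list \<Rightarrow> 3 list) \<Rightarrow> bool" where
  "unimodular \<sigma> \<longleftrightarrow> det (incidence_matrix \<sigma> :: int^3^3) \<in> {1, -1}"

definition arnoux_rauzy :: "3 \<Rightarrow> 3 list \<Rightarrow> 3 list" where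
  "arnoux_rauzy i w = concat (map (\<lambda>j. if j = i then [i] else [j, i]) w)"

definition arnoux_rauzy_product :: "3 list \<Rightarrow> 3 list \<Rightarrow> 3 list" where
  "arnoux_rauzy_product js = foldr (\<circ>) (map arnoux_rauzy js) id"

lemma arnoux_rauzy_letters:
  "arnoux_rauzy 1 [1] = [1]" "arnoux_rauzy 1 [2] = [2, 1]" "arnoux_rauzy 1 [3] = [3, 1]"
  "arnoux_rauzy 2 [1] = [1, 2]" "arnoux_rauzy 2 [2] = [2]" "arnoux_rauzy 2 [3] = [3, 2]"
  "arnoux_rauzy 3 [1] = [1, 3]" "arnoux_rauzy 3 [2] = [2, 3]" "arnoux_rauzy 3 [3] = [3]"
  by (simp_all add: arnoux_rauzy_def)

lemma arnoux_rauzy_product_simps: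
  "arnoux_rauzy_product [] = id"
  "arnoux_rauzy_product (j # js) = arnoux_rauzy j \<circ> arnoux_rauzy_product js"
  by (simp_all add: arnoux_rauzy_product_def)

lemma substitution_Nil: "substitution \<sigma> \<Longrightarrow> \<sigma> [] = []"
  unfolding substitution_def by (metis append_self_conv append_Nil2)

lemma substitution_comp:
  assumes "substitution \<sigma>" "substitution \<tau>"
  shows "substitution (\<sigma> \<circ> \<tau>)"
proof -
  have "\<sigma> w \<noteq> []" if "w \<noteq> []" for w
    using that assms(1) unfolding substitution_def
    by (metis append_Cons append_Nil append_is_Nil_conv neq_Nil_conv)
  then show ?thesis
    using assms by (simp add: substitution_def)
qed

lemma count_list_substitution:
  assumes "substitution \<sigma>"
  shows "count_list (\<sigma> w) i = (\<Sum>k\<in>UNIV. count_list (\<sigma> [k]) i * count_list w k)"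
proof (induction w)
  case Nil
  show ?case using substitution_Nil[OF assms] by simp
next
  case (Cons a w)
  have "\<sigma> (a # w) = \<sigma> [a] @ \<sigma> w"
    using assms unfolding substitution_def by (metis append_Cons append_Nil)
  then show ?case
    using Cons exhaust_3[of a] by (auto simp: sum_3 algebra_simps)
qed

lemma incidence_matrix_comp:
  assumes "substitution \<sigma>"
  shows "(incidence_matrix (\<sigma> \<circ> \<tau>) :: 'a::semiring_1^3^3) = incidence_matrix \<sigma> ** incidence_matrix \<tau>"
  by (simp add: incidence_matrix_def matrix_matrix_mult_def vec_eq_iff
      count_list_substitution[OF assms, of "\<tau> [_]"])

lemma arnoux_rauzy_product_unimodular_substitution:
  "substitution (arnoux_rauzy_product js) \<and> unimodular (arnoux_rauzy_product js)"
proof (induction js)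
  case Nil
  show ?case
    by (simp add: arnoux_rauzy_product_simps substitution_def unimodular_def incidence_matrix_def
        det_3)
next
  case (Cons j js)
  have s: "substitution (arnoux_rauzy j)"
    by (simp add: substitution_def arnoux_rauzy_def)
  have "det (incidence_matrix (arnoux_rauzy j) :: int^3^3) = 1"
    using exhaust_3[of j] by (auto simp: incidence_matrix_def det_3 arnoux_rauzy_def)
  then have "unimodular (arnoux_rauzy j \<circ> arnoux_rauzy_product js)"
    using Cons unfolding unimodular_def incidence_matrix_comp[OF s] det_mul by simp
  then show ?case
    using Cons substitution_comp[OF s] unfolding arnoux_rauzy_product_simps by blast
qed


section \<open>Pisot irreducibility\<close>

definition conjugate_of :: "real \<Rightarrow> complex \<Rightarrow> bool" where
  "conjugate_of x z \<longleftrightarrow>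
     (\<exists>p :: rat poly. irreducible p \<and> poly (map_poly of_rat p) x = 0 \<and> poly (map_poly of_rat p) z = 0)"

definition pisot_number :: "real \<Rightarrow> bool" where
  "pisot_number x \<longleftrightarrow>
     algebraic_int x \<and> 1 < x \<and> (\<forall>z. conjugate_of x z \<and> z \<noteq> complex_of_real x \<longrightarrow> cmod z < 1)"

text \<open>
  A real 3 by 3 matrix has at least one and at most three real eigenvalues, so the maximum below
  is always attained. For a nonnegative matrix it is the Perron--Frobenius eigenvalue.
\<close>

definition eigenvalue :: "real^3^3 \<Rightarrow> real \<Rightarrow> bool" where
  "eigenvalue M l \<longleftrightarrow> (\<exists>v. v \<noteq> 0 \<and> M *v v = l *\<^sub>R v)"

definition max_eigenvalue :: "real^3^3 \<Rightarrow> real" where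
  "max_eigenvalue M = Max {l. eigenvalue M l}"

definition charpoly :: "'a::comm_ring_1^3^3 \<Rightarrow> 'a poly" where
  "charpoly M = det (mat [:0, 1:] - map_matrix (\<lambda>c. [:c:]) M)"

definition pisot_irreducible :: "(3 list \<Rightarrow> 3 list) \<Rightarrow> bool" where
  "pisot_irreducible \<sigma> \<longleftrightarrow>
     substitution \<sigma> \<and> unimodular \<sigma> \<and>
     pisot_number (max_eigenvalue (incidence_matrix \<sigma>)) \<and>
     irreducible (charpoly (incidence_matrix \<sigma> :: rat^3^3))"


section \<open>Invariant subspaces\<close>

definition unstable_line :: "real^3^3 \<Rightarrow> (real^3) set" where
  "unstable_line M = {v. M *v v = max_eigenvalue M *\<^sub>R v}"

definition contracting_plane :: "real^3^3 \<Rightarrow> (real^3) set \<Rightarrow> bool" where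
  "contracting_plane M E \<longleftrightarrow>
     subspace E \<and> dim E = 2 \<and> (*v) M ` E \<subseteq> E \<and>
     (\<forall>v\<in>E. (\<lambda>n. (((*v) M) ^^ n) v) \<longlonglongrightarrow> 0)"

definition stable_plane :: "real^3^3 \<Rightarrow> (real^3) set" where
  "stable_plane M = (THE E. contracting_plane M E)"

text \<open>Any eigenvalue of modulus at least 1 forces the contracting plane to be unique.\<close>

lemma stable_plane_eqI:
  assumes E: "contracting_plane M E" and l: "eigenvalue M l" "1 \<le> \<bar>l\<bar>"
  shows "stable_plane M = E"
proof -
  define S where "S = {v. (\<lambda>n. (((*v) M) ^^ n) v) \<longlonglongrightarrow> 0}"
  have add: "(((*v) M) ^^ n) (x + y) = (((*v) M) ^^ n) x + (((*v) M) ^^ n) y" for n x y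
    by (induction n) (simp_all add: matrix_vector_right_distrib)
  have scale: "(((*v) M) ^^ n) (c *\<^sub>R x) = c *\<^sub>R (((*v) M) ^^ n) x" for n c x
    by (induction n) (simp_all add: matrix_vector_mult_scaleR)
  have zero: "(((*v) M) ^^ n) 0 = 0" for n
    by (induction n) simp_all
  have S: "subspace S"
    unfolding subspace_def S_def
    by (auto simp: add scale zero intro: tendsto_add_zero tendsto_scaleR[OF tendsto_const, of _ 0, simplified])
  obtain w where w: "w \<noteq> 0" "M *v w = l *\<^sub>R w"
    using l(1) by (auto simp: eigenvalue_def)
  have pw: "(((*v) M) ^^ n) w = l ^ n *\<^sub>R w" for n
    by (induction n) (simp_all add: w matrix_vector_mult_scaleR mult.commute)
  have "w \<notin> S"
  proof
    assume "w \<in> S"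
    then have "(\<lambda>n. l ^ n *\<^sub>R w) \<longlonglongrightarrow> 0"
      by (simp add: S_def pw)
    then have "(\<lambda>n. norm (l ^ n *\<^sub>R w)) \<longlonglongrightarrow> 0"
      by (rule tendsto_norm_zero)
    moreover have "norm w \<le> norm (l ^ n *\<^sub>R w)" for n
      using l(2) by (simp add: power_abs mult_le_cancel_right1 one_le_power)
    ultimately have "norm w \<le> 0"
      by (intro LIMSEQ_le_const) auto
    with w show False by simp
  qed
  then have "S \<noteq> UNIV" by auto
  then have "dim S < 3"
    using dim_eq_full[of S] S dim_subset_UNIV_cart[of S] span_eq_iff[of S] by fastforce
  moreover have "F = S" if "contracting_plane M F" "dim S < 3" for F
    using that S subspace_dim_equal[of F S] by (auto simp: contracting_plane_def S_def)
  ultimately show ?thesis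
    unfolding stable_plane_def using E by (intro the_equality) auto
qed


section \<open>The torus\<close>

definition torus_rel :: "real^3 \<Rightarrow> real^3 \<Rightarrow> bool" where
  "torus_rel x y \<longleftrightarrow> (\<forall>i. (x - y) $ i \<in> \<int>)"

quotient_type torus = "real^3" / torus_rel
  morphisms rep_torus to_torus
proof (rule equivpI)
  show "reflp torus_rel"
    by (auto intro: reflpI simp: torus_rel_def)
  show "symp torus_rel"
    unfolding torus_rel_def
    by (rule sympI) (metis Ints_minus minus_diff_eq vector_uminus_component)
  show "transp torus_rel"
  proof (rule transpI)
    fix x y z :: "real^3"
    assume "torus_rel x y" "torus_rel y z"
    then have "(x - y) $ i + (y - z) $ i \<in> \<int>" for i
      by (intro Ints_add) (auto simp: torus_rel_def)
    then show "torus_rel x z" by (simp add: torus_rel_def)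
  qed
qed

instantiation torus :: topological_space
begin

text \<open>The quotient topology.\<close>

definition open_torus :: "torus set \<Rightarrow> bool" where
  "open_torus U \<longleftrightarrow> open (to_torus -` U)"

instance
proof
  fix K :: "torus set set"
  assume "\<forall>U\<in>K. open U"
  then show "open (\<Union>K)"
    by (auto simp: open_torus_def vimage_Union)
qed (auto simp: open_torus_def)

end

lift_definition toral_automorphism :: "(3 list \<Rightarrow> 3 list) \<Rightarrow> torus \<Rightarrow> torus"
  is "\<lambda>\<sigma> x. incidence_matrix \<sigma> *v x"
proof -
  fix \<sigma> and x y :: "real^3"
  assume "torus_rel x y"
  then have "(incidence_matrix \<sigma> *v (x - y)) $ i \<in> \<int>" for i
    by (auto simp: torus_rel_def matrix_vector_mult_def incidence_matrix_def
        simp del: vector_minus_component intro!: Ints_sum Ints_mult)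
  then show "torus_rel (incidence_matrix \<sigma> *v x) (incidence_matrix \<sigma> *v y)"
    by (simp only: torus_rel_def matrix_vector_mult_diff_distrib[symmetric] simp_thms)
qed


section \<open>Markov partitions\<close>

text \<open>Interior and closure in the subspace topology of \<open>E\<close>; the interior is not \<^const>\<open>rel_interior\<close>,
  which is relative to the affine hull of the set itself.\<close>

abbreviation int_in :: "(real^3) set \<Rightarrow> (real^3) set \<Rightarrow> (real^3) set" where
  "int_in E A \<equiv> top_of_set E interior_of A"

abbreviation cl_in :: "(real^3) set \<Rightarrow> (real^3) set \<Rightarrow> (real^3) set" where
  "cl_in E A \<equiv> top_of_set E closure_of A"

definition box_sum :: "real^3 \<Rightarrow> (real^3) set \<Rightarrow> (real^3) set \<Rightarrow> (real^3) set" where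
  "box_sum t A B = {t + a + b | a b. a \<in> A \<and> b \<in> B}"

definition product_structure ::
  "(real^3) set \<Rightarrow> (real^3) set \<Rightarrow> torus set \<Rightarrow> real^3 \<Rightarrow> (real^3) set \<Rightarrow> (real^3) set \<Rightarrow> bool" where
  "product_structure Es Eu P t A B \<longleftrightarrow>
     A \<subseteq> Es \<and> compact A \<and> cl_in Es (int_in Es A) = A \<and>
     B \<subseteq> Eu \<and> compact B \<and> cl_in Eu (int_in Eu B) = B \<and>
     P = to_torus ` box_sum t A B \<and>
     inj_on to_torus (box_sum t (int_in Es A) (int_in Eu B))"

text \<open>
  In the Markov property a point \<open>x\<close> of \<open>P i\<close> is given by its coordinates: \<open>x = to_torus (t i + a + b)\<close>
  with \<open>a\<close> and \<open>b\<close> in the relative interiors of \<open>A i\<close> and \<open>B i\<close>. Its stable set \<open>W\<^sup>s(x, P i)\<close> is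
  \<open>to_torus ` box_sum (t i) (A i) {b}\<close> and its unstable set \<open>W\<^sup>u(x, P i)\<close> is
  \<open>to_torus ` box_sum (t i) {a} (B i)\<close>.
\<close>

definition stable_set :: "real^3 \<Rightarrow> (real^3) set \<Rightarrow> real^3 \<Rightarrow> torus set" where
  "stable_set t A b = to_torus ` box_sum t A {b}"

definition unstable_set :: "real^3 \<Rightarrow> real^3 \<Rightarrow> (real^3) set \<Rightarrow> torus set" where
  "unstable_set t a B = to_torus ` box_sum t {a} B"

definition markov_property ::
  "(torus \<Rightarrow> torus) \<Rightarrow> (real^3) set \<Rightarrow> (real^3) set \<Rightarrow>
   ('i \<Rightarrow> real^3) \<Rightarrow> ('i \<Rightarrow> (real^3) set) \<Rightarrow> ('i \<Rightarrow> (real^3) set) \<Rightarrow> bool" where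
  "markov_property T Es Eu t A B \<longleftrightarrow>
     (\<forall>i j a b a' b'.
        a \<in> int_in Es (A i) \<and> b \<in> int_in Eu (B i) \<and>
        a' \<in> int_in Es (A j) \<and> b' \<in> int_in Eu (B j) \<and>
        T (to_torus (t i + a + b)) = to_torus (t j + a' + b') \<longrightarrow>
          T ` stable_set (t i) (A i) b \<subseteq> stable_set (t j) (A j) b' \<and>
          unstable_set (t j) a' (B j) \<subseteq> T ` unstable_set (t i) a (B i))"

text \<open>The finite family is indexed by a finite type.\<close>

definition markov_partition ::
  "(torus \<Rightarrow> torus) \<Rightarrow> (real^3) set \<Rightarrow> (real^3) set \<Rightarrow> ('i::finite \<Rightarrow> torus set) \<Rightarrow> bool" where
  "markov_partition T Es Eu P \<longleftrightarrow>
     (\<forall>i. P i \<noteq> {} \<and> closed (P i) \<and> closure (interior (P i)) = P i) \<and>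
     (\<Union>i. P i) = UNIV \<and>
     (\<forall>i j. i \<noteq> j \<longrightarrow> interior (P i) \<inter> interior (P j) = {}) \<and>
     (\<exists>t A B. (\<forall>i. product_structure Es Eu (P i) (t i) (A i) (B i)) \<and>
              markov_property T Es Eu t A B)"

end

theory Submission
  imports Defs
begin

text \<open>
  The elements of the partition are boxes over the Rauzy fractals: \<open>P j\<close> is the image of
  \<open>R j + [0, l\<^sub>j] v\<close>, where \<open>v\<close> and \<open>l\<close> are the right and left Perron eigenvectors and \<open>R j\<close> is
  the closure, in the contracting plane, of the projected points \<open>- x\<close> such that some \<open>\<sigma>\<^sup>n\<close> of a letter
  has an occurrence of \<open>j\<close> after a prefix with abelianization \<open>x\<close>.

  The boxes and their integer translates form a tiling. Translates correspond to edges of the integer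
  grid, \<open>\<sigma>\<close> subdivides edges, and two boxes overlap in a null set once their edges have a common
  descendant (by the equality case of the Perron estimate for the volumes). To find a common
  descendant, join the two edges to common end points by broken lines. These differ by flips
  \<open>ab \<leftrightarrow> ba\<close>. One Arnoux-Rauzy step replaces a flip by at most three flips, with incidence matrix
  conjugate to the one of the step, but two of them start at the same vertex, so that their
  non-coincident heights overlap. The resulting gain makes the proportion of non-coincident heights
  tend to 0.

  For connectedness, the three pieces can be exchanged by translations within their union. After the
  step for the letter \<open>x\<close>, the piece of \<open>x\<close> is therefore a translate of the union of the three
  previous pieces, which all contain 0, while the other two pieces are unchanged. Hence, steps
  preserve connectedness up to any scale, and far enough in the past all pieces are tiny.
\<close>


section \<open>Edge paths and flips\<close>

text \<open>Counting flips does not suffice. Three flips for one, with an incidence matrix conjugate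
  to that of the step, bound the non-coincident heights by a multiple of lam^n, but the heights of
  the image paths grow at the same rate. Coincidences need a strict saving. Irreducibility forces
  all three letters to occur in the product, so two adjacent steps differ, and they give a saving in
  every period. Each saving is a fixed multiple of a proportion of non-coincident heights, and the
  savings have a finite sum, so that proportion tends to 0. Heights decide everything: the overlap
  of two height intervals is stretched by the same factor as the intervals, whereas the plane
  coordinates fit every descendant of an edge, at whatever height. One common descendant therefore
  settles the overlap of the whole cylinders over two tiles. The sign in \<open>- x\<close> makes
  the matrix carry a tile into the union of the tiles of its children. The set equation is then the
  stable half of the Markov property, and the subdivision of height intervals is the unstable
  half.\<close>

abbreviation (input) "arp \<equiv> arnoux_rauzy_product"

section \<open>Abelianization and incidence matrices of the products\<close>

definition abel :: "3 list \<Rightarrow> real^3" where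
  "abel w = (\<chi> i. real (count_list w i))"

lemma abel_simps [simp]:
  "abel [] = 0" "abel (a # w) = axis a 1 + abel w" "abel (u @ w) = abel u + abel w"
  by (auto simp: abel_def vec_eq_iff axis_def)

abbreviation ar_matrix :: "3 list \<Rightarrow> real^3^3" where
  "ar_matrix js \<equiv> incidence_matrix (arp js)"

lemma substitution_arp: "substitution (arp js)"
  using arnoux_rauzy_product_unimodular_substitution by blast

lemma arp_append [simp]: "arp js (u @ w) = arp js u @ arp js w"
  using substitution_arp[of js] by (simp add: substitution_def)

lemma arp_Nil [simp]: "arp js [] = []"
  by (rule substitution_Nil[OF substitution_arp])

lemma arp_Cons: "arp js (a # w) = arp js [a] @ arp js w"
  using arp_append[of js "[a]" w] by simp

lemma arp_append_list: "arp (js @ ks) w = arp js (arp ks w)"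
  by (induction js) (simp_all add: arnoux_rauzy_product_simps)

lemma arp_single: "arp [x] w = arnoux_rauzy x w"
  by (simp add: arnoux_rauzy_product_simps)

lemma abel_arp: "abel (arp js w) = ar_matrix js *v abel w"
  by (simp add: vec_eq_iff abel_def incidence_matrix_def matrix_vector_mult_def
      count_list_substitution[OF substitution_arp, of js w])

lemma ar_matrix_append: "ar_matrix (js @ ks) = ar_matrix js ** ar_matrix ks"
proof -
  have "arp (js @ ks) = arp js \<circ> arp ks" by (simp add: fun_eq_iff arp_append_list)
  then show ?thesis by (simp add: incidence_matrix_comp[OF substitution_arp])
qed

lemma ar_matrix_Nil: "ar_matrix [] = mat 1"
  by (auto simp: incidence_matrix_def arnoux_rauzy_product_simps vec_eq_iff mat_def)

lemma ar_matrix_single: "(ar_matrix [x] *v u) $ i = (if i = x then u $ 1 + u $ 2 + u $ 3 else u $ i)"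
  using exhaust_3[of x] exhaust_3[of i]
  by (auto simp: incidence_matrix_def arnoux_rauzy_product_simps arnoux_rauzy_def
      matrix_vector_mult_def sum_3)

lemma ar_matrix_Cons: "ar_matrix (x # js) *v u = ar_matrix [x] *v (ar_matrix js *v u)"
  using ar_matrix_append[of "[x]" js] by (simp add: matrix_vector_mul_assoc)

lemma ar_matrix_snoc: "ar_matrix (js @ [x]) *v u = ar_matrix js *v (ar_matrix [x] *v u)"
  using ar_matrix_append[of js "[x]"] by (simp add: matrix_vector_mul_assoc)

lemma det_ar_matrix: "det (ar_matrix js) = 1"
proof (induction js)
  case Nil
  then show ?case by (simp add: ar_matrix_Nil)
next
  case (Cons x js)
  have "det (ar_matrix [x]) = 1"
    using exhaust_3[of x]
    by (auto simp: incidence_matrix_def det_3 arnoux_rauzy_def arnoux_rauzy_product_simps)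
  then show ?case using Cons ar_matrix_append[of "[x]" js] by (simp add: det_mul)
qed

section \<open>Broken lines in the integer grid and their edges\<close>

fun edges :: "real^3 \<Rightarrow> 3 list \<Rightarrow> ((real^3) \<times> 3) set" where
  "edges z [] = {}"
| "edges z (a # w) = insert (z, a) (edges (z + axis a 1) w)"

lemma edges_append: "edges z (u @ w) = edges z u \<union> edges (z + abel u) w"
  by (induction u arbitrary: z) (auto simp: add.assoc)

lemma finite_edges [simp]: "finite (edges z w)"
  by (induction w arbitrary: z) auto

lemma edges_shift: "(x, i) \<in> edges (z + d) w \<longleftrightarrow> (x - d, i) \<in> edges z w"
proof (induction w arbitrary: z)
  case Nil
  then show ?case by simp
next
  case (Cons a w)
  have "z + d + axis a 1 = (z + axis a 1) + d" by (simp add: algebra_simps)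
  then have "(x, i) \<in> edges (z + d + axis a 1) w \<longleftrightarrow> (x - d, i) \<in> edges (z + axis a 1) w"
    using Cons[of "z + axis a 1"] by (simp only:)
  moreover have "x = z + d \<longleftrightarrow> x - d = z" by auto
  ultimately show ?case by simp
qed

text \<open>A pair \<open>(x, i)\<close> stands for the unit edge from \<open>x\<close> to
  \<open>x + axis i 1\<close>. The substitution maps it to a path starting at the image of
  \<open>x\<close>, and these paths join because abelianization turns the substitution into its
  matrix. This is the parent-child relation of edges.\<close>

lemma edges_refine:
  "edges (ar_matrix js *v z) (arp js w) = (\<Union>(x, i)\<in>edges z w. edges (ar_matrix js *v x) (arp js [i]))"
proof (induction w arbitrary: z)
  case Nil
  then show ?case by simp
next
  case (Cons a w)
  have "ar_matrix js *v z + abel (arp js [a]) = ar_matrix js *v (z + axis a 1)"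
    by (simp add: abel_arp matrix_vector_right_distrib)
  then show ?case
    by (subst arp_Cons) (simp add: edges_append Cons)
qed

lemma edges_Ints:
  assumes "(x, i) \<in> edges z w" "\<And>k. z $ k \<in> \<int>"
  shows "x $ k \<in> \<int>"
  using assms by (induction w arbitrary: z) (auto simp: axis_def split: if_splits)

text \<open>A step sends a letter to itself, or to itself followed by the letter of the step, so
  first letters persist. Hence every letter has the empty prefix available, and the words obtained
  from one letter by repeating the period extend each other.\<close>

lemma arp_hd: "\<exists>w. arp js [a] = a # w"
proof (induction js)
  case Nil
  then show ?case by (simp add: arnoux_rauzy_product_simps)
next
  case (Cons x js)
  then obtain w where "arp js [a] = a # w" by blast
  then have "arp (x # js) [a] = arp [x] (a # w)" by (simp add: arnoux_rauzy_product_simps)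
  then show ?case by (auto simp: arp_single arnoux_rauzy_def)
qed

text \<open>Half-open intervals, so that consecutive edges share no height: for nonnegative
  \<open>l\<close> a path has at most one edge at each height, and two paths can be compared height
  by height.\<close>

definition at_height :: "real^3 \<Rightarrow> real^3 \<Rightarrow> 3 list \<Rightarrow> real \<Rightarrow> ((real^3) \<times> 3) set" where
  "at_height l z w t = {(x, i) \<in> edges z w. l \<bullet> x \<le> t \<and> t < l \<bullet> x + l $ i}"

lemma at_height_append:
  "at_height l z (u @ w) t = at_height l z u t \<union> at_height l (z + abel u) w t"
  by (auto simp: at_height_def edges_append)

lemma at_height_Nil [simp]: "at_height l z [] t = {}"
  by (simp add: at_height_def)

lemma inner_axis_one [simp]: "l \<bullet> axis i (1::real) = l $ i"
  by (simp add: inner_axis)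

lemma edges_height_ge:
  assumes "(x, i) \<in> edges z w" "\<And>k. 0 \<le> l $ k"
  shows "l \<bullet> z \<le> l \<bullet> x"
  using assms(1)
proof (induction w arbitrary: z)
  case (Cons a w)
  show ?case
  proof (cases "(x, i) = (z, a)")
    case False
    then have "l \<bullet> (z + axis a 1) \<le> l \<bullet> x"
      using Cons.prems by (intro Cons.IH) auto
    then show ?thesis using assms(2)[of a] by (simp add: inner_add_right)
  qed simp
qed simp

lemma edges_height_le:
  assumes "(x, i) \<in> edges z w" "\<And>k. 0 \<le> l $ k"
  shows "l \<bullet> x + l $ i \<le> l \<bullet> z + l \<bullet> abel w"
proof -
  have ge0: "0 \<le> l \<bullet> abel u" for u
    by (induction u) (simp_all add: inner_add_right assms(2))
  show ?thesis using assms(1)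
  proof (induction w arbitrary: z)
    case (Cons a w)
    from Cons.prems show ?case
    proof (cases "(x, i) = (z, a)")
      case True then show ?thesis using ge0[of w] by (simp add: inner_add_right)
    next
      case False
      then have "(x, i) \<in> edges (z + axis a 1) w" using Cons.prems by auto
      from Cons.IH[OF this] show ?thesis by (simp add: inner_add_right)
    qed
  qed simp
qed

lemma at_height_unique:
  assumes "e \<in> at_height l z w t" "e' \<in> at_height l z w t" "\<And>k. 0 \<le> l $ k"
  shows "e = e'"
  using assms(1,2)
proof (induction w arbitrary: z)
  case Nil
  then show ?case by simp
next
  case (Cons a w)
  have split: "at_height l z (a # w) t = (if l \<bullet> z \<le> t \<and> t < l \<bullet> z + l $ a then {(z, a)} else {}) \<union>
      at_height l (z + axis a 1) w t"
    by (auto simp: at_height_def)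
  have "at_height l (z + axis a 1) w t = {}" if "t < l \<bullet> z + l $ a"
    using that edges_height_ge[of _ _ "z + axis a 1" w, OF _ assms(3)]
    by (force simp: at_height_def inner_add_right)
  then show ?case using Cons split by (auto split: if_splits)
qed

lemma at_height_exists:
  assumes "l \<bullet> z \<le> t" "t < l \<bullet> z + l \<bullet> abel w"
  shows "\<exists>e. e \<in> at_height l z w t"
  using assms
proof (induction w arbitrary: z)
  case Nil
  then show ?case by simp
next
  case (Cons a w)
  show ?case
  proof (cases "t < l \<bullet> z + l $ a")
    case True
    then show ?thesis using Cons by (auto simp: at_height_def)
  next
    case False
    then obtain e where "e \<in> at_height l (z + axis a 1) w t"
      using Cons.IH[of "z + axis a 1"] Cons.prems by (auto simp: inner_add_right)
    then show ?thesis by (auto simp: at_height_def)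
  qed
qed

text \<open>The list \<open>rs\<close> is reversed, so that its head is the step applied first to a word. For three
  distinct letters \<open>a\<close>, \<open>b\<close>, \<open>c\<close>, the set \<open>noncoin l rs c\<close> contains the heights, measured from the
  starting vertex, at which the images of \<open>ab\<close> and \<open>ba\<close> can have different edges. The step \<open>c\<close> turns
  this flip into \<open>acbc \<rightarrow> cabc \<rightarrow> cbac \<rightarrow> bcac\<close>; the other steps preserve it up to a common last letter.\<close>

primrec noncoin :: "real^3 \<Rightarrow> 3 list \<Rightarrow> 3 \<Rightarrow> real set" where
  "noncoin l [] c = {0..l $ 1 + l $ 2 + l $ 3}"
| "noncoin l (x # rs) c =
     (if c = x then (\<Union>a\<in>-{x}. noncoin l rs a) \<union> (+) (l \<bullet> abel (arp (rev rs) [x])) ` noncoin l rs x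
      else noncoin l rs c)"

lemma letters_cases:
  fixes a b c :: 3
  assumes "a \<noteq> b" "a \<noteq> c" "b \<noteq> c"
  shows "UNIV = {a, b, c}"
proof -
  have "{a, b, c} = UNIV"
    by (rule card_subset_eq) (use assms in auto)
  then show ?thesis by simp
qed

lemma third_letter:
  fixes a b :: 3
  assumes "a \<noteq> b"
  obtains c where "a \<noteq> c" "b \<noteq> c"
proof (cases "a \<noteq> 1 \<and> b \<noteq> 1")
  case True then show ?thesis using that[of 1] by blast
next
  case F: False
  show ?thesis
  proof (cases "a \<noteq> 2 \<and> b \<noteq> 2")
    case True then show ?thesis using that[of 2] by blast
  next
    case False
    with F assms have "a \<noteq> 3 \<and> b \<noteq> 3" by auto
    then show ?thesis using that[of 3] by blast
  qed
qed

text \<open>Induction with the letters and the start vertex free, since a step permutes the role of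
  the third letter and the middle one of the three new flips starts at a later vertex.\<close>

lemma at_height_flip:
  assumes "a \<noteq> b" "a \<noteq> c" "b \<noteq> c" and l: "\<And>k. 0 \<le> l $ k"
    and "t - l \<bullet> z \<notin> noncoin l rs c"
  shows "at_height l z (arp (rev rs) [a, b]) t = at_height l z (arp (rev rs) [b, a]) t"
  using assms(1-3,5)
proof (induction rs arbitrary: a b c z)
  case Nil
  have "l \<bullet> z \<le> l \<bullet> x \<and> l \<bullet> x + l $ i \<le> l \<bullet> z + l $ a + l $ b"
    if "(x, i) \<in> edges z [a, b] \<or> (x, i) \<in> edges z [b, a]" for x i
    using that l[of a] l[of b] by (auto simp: inner_add_right)
  moreover have "l $ a + l $ b \<le> l $ 1 + l $ 2 + l $ 3"
    using Nil(1) l[of 1] l[of 2] l[of 3] exhaust_3[of a] exhaust_3[of b] by auto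
  ultimately have "at_height l z [a, b] t = {}" "at_height l z [b, a] t = {}"
    using Nil(4) unfolding at_height_def by (force simp del: edges.simps)+
  then show ?case by (simp add: arnoux_rauzy_product_simps)
next
  case (Cons x rs)
  note IH = Cons.IH
  let ?s = "arp (rev rs)"
  have s: "?s (a # u) = ?s [a] @ ?s u" for a u by (rule arp_Cons)
  have rw: "arp (rev rs @ [x]) w = ?s (arnoux_rauzy x w)" for x w
    by (simp add: arp_append_list arp_single)
  have ab: "abel (?s [p, q]) = abel (?s [q, p])" for p q
    by (simp add: abel_arp add.commute)
  have ax: "abel (?s [p, q]) = abel (?s [p]) + abel (?s [q])" for p q
    using s[of p "[q]"] by simp
  consider "x = c" | "x = a" | "x = b"
    using letters_cases[OF Cons.prems(1-3)] by auto
  then show ?case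
  proof cases
    case 1
    have nb: "t - l \<bullet> z \<notin> noncoin l rs b" and na: "t - l \<bullet> z \<notin> noncoin l rs a"
      and nc: "t - l \<bullet> (z + abel (?s [c])) \<notin> noncoin l rs c"
      using Cons.prems 1 by (auto simp: inner_add_right algebra_simps image_iff)
    \<comment> \<open>The new flips exchange \<open>ac\<close>, \<open>bc\<close> and
      \<open>ab\<close>, with third letters \<open>b\<close>, \<open>a\<close> and \<open>c\<close>.
      Only the last is shifted, by the image of \<open>c\<close>.\<close>
    have f1: "at_height l z (?s [a, c]) t = at_height l z (?s [c, a]) t"
      using IH[OF Cons.prems(2,1) Cons.prems(3)[symmetric] nb] .
    have f2: "at_height l z (?s [b, c]) t = at_height l z (?s [c, b]) t"
      using IH[OF Cons.prems(3) Cons.prems(1)[symmetric] Cons.prems(2)[symmetric] na] .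
    have f3: "at_height l (z + abel (?s [c])) (?s [a, b]) t = at_height l (z + abel (?s [c])) (?s [b, a]) t"
      using IH[OF Cons.prems(1-3) nc] .
    have "at_height l z (?s [a, c, b, c]) t = at_height l z (?s [c, a, b, c]) t"
      using f1 arp_append[of "rev rs" "[a, c]" "[b, c]"] arp_append[of "rev rs" "[c, a]" "[b, c]"]
      by (simp add: at_height_append ab[of a c])
    also have "\<dots> = at_height l z (?s [c, b, a, c]) t"
      using f3 arp_append[of "rev rs" "[c]" "[a, b, c]"] arp_append[of "rev rs" "[c]" "[b, a, c]"]
        arp_append[of "rev rs" "[a, b]" "[c]"] arp_append[of "rev rs" "[b, a]" "[c]"]
      by (simp add: at_height_append ab[of a b])
    also have "\<dots> = at_height l z (?s [b, c, a, c]) t"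
      using f2 arp_append[of "rev rs" "[b, c]" "[a, c]"] arp_append[of "rev rs" "[c, b]" "[a, c]"]
      by (simp add: at_height_append ab[of b c])
    finally show ?thesis
      using 1 Cons.prems(1-3) by (simp add: rw arnoux_rauzy_def)
  next
    case 2
    have "at_height l z (?s [a, b]) t = at_height l z (?s [b, a]) t"
      using IH[OF Cons.prems(1-3)] Cons.prems(2,4) 2 by simp
    then have "at_height l z (?s [a, b, a]) t = at_height l z (?s [b, a, a]) t"
      using arp_append[of "rev rs" "[a, b]" "[a]"] arp_append[of "rev rs" "[b, a]" "[a]"]
      by (simp add: at_height_append ab[of a b])
    then show ?thesis
      using 2 Cons.prems(1-3) by (simp add: rw arnoux_rauzy_def)
  next
    case 3
    have "at_height l z (?s [a, b]) t = at_height l z (?s [b, a]) t"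
      using IH[OF Cons.prems(1-3)] Cons.prems(3,4) 3 by simp
    then have "at_height l z (?s [a, b, b]) t = at_height l z (?s [b, a, b]) t"
      using arp_append[of "rev rs" "[a, b]" "[b]"] arp_append[of "rev rs" "[b, a]" "[b]"]
      by (simp add: at_height_append ab[of a b])
    then show ?thesis
      using 3 Cons.prems(1-3) by (simp add: rw arnoux_rauzy_def)
  qed
qed


section \<open>Decay of the non-coincidence sets\<close>

lemma noncoin_lmeasurable [simp]: "noncoin l rs c \<in> lmeasurable"
proof (induction rs arbitrary: c)
  case (Cons x rs)
  show ?case
    by (auto intro!: fmeasurable.Un fmeasurable.finite_UN measurable_translation Cons simp del: Compl_iff)
qed (simp add: lmeasurable_interval)

definition nc_measure :: "real^3 \<Rightarrow> 3 list \<Rightarrow> 3 \<Rightarrow> real" where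
  "nc_measure l rs c = measure lebesgue (noncoin l rs c)"

lemma nc_measure_nonneg [simp]: "0 \<le> nc_measure l rs c"
  by (simp add: nc_measure_def)

lemma nc_measure_other: "c \<noteq> x \<Longrightarrow> nc_measure l (x # rs) c = nc_measure l rs c"
  by (simp add: nc_measure_def)

lemma measure_Un_le_lebesgue:
  "A \<in> lmeasurable \<Longrightarrow> B \<in> lmeasurable \<Longrightarrow> measure lebesgue (A \<union> B) \<le> measure lebesgue A + measure lebesgue B"
  by (rule measure_Un_le) (auto simp: fmeasurableD)

lemma noncoin_Cons_same:
  assumes "a \<noteq> b" "a \<noteq> x" "b \<noteq> x"
  shows "noncoin l (x # rs) x = noncoin l rs a \<union> noncoin l rs b \<union>
    (+) (l \<bullet> abel (arp (rev rs) [x])) ` noncoin l rs x"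
proof -
  have "- {x} = {a, b}" using letters_cases[OF assms] assms by auto
  then show ?thesis by simp
qed

lemma nc_measure_same:
  assumes "a \<noteq> b" "a \<noteq> x" "b \<noteq> x"
  shows "nc_measure l (x # rs) x \<le> nc_measure l rs a + nc_measure l rs b + nc_measure l rs x"
proof -
  let ?T = "(+) (l \<bullet> abel (arp (rev rs) [x])) ` noncoin l rs x"
  have T: "?T \<in> lmeasurable" by (intro measurable_translation) simp
  have "measure lebesgue (noncoin l rs a \<union> noncoin l rs b \<union> ?T)
      \<le> measure lebesgue (noncoin l rs a \<union> noncoin l rs b) + measure lebesgue ?T"
    by (intro measure_Un_le_lebesgue fmeasurable.Un T) auto
  also have "\<dots> \<le> measure lebesgue (noncoin l rs a) + measure lebesgue (noncoin l rs b) + measure lebesgue ?T"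
    using measure_Un_le_lebesgue[of "noncoin l rs a" "noncoin l rs b"] by simp
  finally show ?thesis
    unfolding nc_measure_def noncoin_Cons_same[OF assms] by (simp add: measure_translation)
qed

lemma nc_measure_same_ge:
  "nc_measure l rs a \<le> nc_measure l (x # rs) x"
proof (cases "a = x")
  case True
  let ?T = "(+) (l \<bullet> abel (arp (rev rs) [x])) ` noncoin l rs x"
  have "measure lebesgue ?T \<le> measure lebesgue (noncoin l (x # rs) x)"
    by (intro measure_mono_fmeasurable) (auto simp del: noncoin.simps intro!: fmeasurableD measurable_translation, simp)
  then show ?thesis using True by (simp add: nc_measure_def measure_translation)
next
  case False
  then show ?thesis unfolding nc_measure_def
    by (intro measure_mono_fmeasurable) (auto simp del: noncoin.simps intro!: fmeasurableD, auto)
qed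

lemma nc_measure_mono: "nc_measure l rs a \<le> nc_measure l (x # rs) a"
  using nc_measure_same_ge[of l rs a x] nc_measure_other[of a x l rs] by (cases "a = x") auto

lemma nc_measure_mono_append: "nc_measure l rs a \<le> nc_measure l (xs @ rs) a"
  by (induction xs) (auto intro: order_trans nc_measure_mono)

text \<open>The two unshifted pieces of \<^term>\<open>noncoin l (b # c # rs) b\<close> both contain
  \<^term>\<open>noncoin l rs a\<close>, which is therefore counted only once.\<close>

lemma nc_measure_adjacent:
  assumes "a \<noteq> b" "a \<noteq> c" "c \<noteq> b"
  shows "nc_measure l (b # c # rs) b \<le> nc_measure l (c # rs) c + nc_measure l (c # rs) b"
proof -
  let ?T = "(+) (l \<bullet> abel (arp (rev (c # rs)) [b])) ` noncoin l (c # rs) b"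
  have T: "?T \<in> lmeasurable" by (intro measurable_translation noncoin_lmeasurable)
  have "noncoin l (c # rs) a \<subseteq> noncoin l (c # rs) c" using assms by auto
  then have "noncoin l (b # c # rs) b = noncoin l (c # rs) c \<union> ?T"
    unfolding noncoin_Cons_same[OF assms(2) assms(1,3)] by blast
  then show ?thesis unfolding nc_measure_def
    using measure_Un_le_lebesgue[OF noncoin_lmeasurable T, of l "c # rs" c]
    by (simp only: measure_translation)
qed

text \<open>The coefficients are the entries of \<open>H u\<close>, where \<open>H\<close> has zeros on the diagonal and ones elsewhere.
  It satisfies \<open>M\<^sup>T H = H M\<close> for the matrix \<open>M\<close> of every step, so that the weight along a right
  eigenvector decreases after rescaling.\<close>

definition nc_weight :: "real^3 \<Rightarrow> real^3 \<Rightarrow> 3 list \<Rightarrow> real" where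
  "nc_weight l u rs = (\<Sum>c\<in>UNIV. (u $ 1 + u $ 2 + u $ 3 - u $ c) * nc_measure l rs c)"

lemma nc_weight_three:
  assumes "a \<noteq> b" "a \<noteq> c" "b \<noteq> c"
  shows "nc_weight l u rs = (u $ b + u $ c) * nc_measure l rs a + (u $ a + u $ c) * nc_measure l rs b
    + (u $ a + u $ b) * nc_measure l rs c"
proof -
  have U: "(UNIV :: 3 set) = {a, b, c}" by (rule letters_cases[OF assms])
  have "u $ 1 + u $ 2 + u $ 3 = (\<Sum>i\<in>UNIV. u $ i)" by (simp add: sum_3)
  also have "\<dots> = u $ a + u $ b + u $ c" unfolding U using assms by simp
  finally show ?thesis unfolding nc_weight_def U using assms by simp
qed

lemma nc_weight_nonneg:
  assumes "\<And>k. 0 \<le> u $ k"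
  shows "0 \<le> nc_weight l u rs"
proof -
  have "0 \<le> u $ 1 + u $ 2 + u $ 3 - u $ c" for c
    using assms[of 1] assms[of 2] assms[of 3] exhaust_3[of c] by auto
  then show ?thesis unfolding nc_weight_def by (intro sum_nonneg mult_nonneg_nonneg) auto
qed

lemma ar_matrix_nonneg: "(\<And>k. 0 \<le> u $ k) \<Longrightarrow> 0 \<le> (ar_matrix js *v u) $ k"
  by (simp add: matrix_vector_mult_def incidence_matrix_def sum_nonneg)

lemma ar_matrix_single_pos: "(\<And>k. 0 < u $ k) \<Longrightarrow> 0 < (ar_matrix [x] *v u) $ k"
  by (simp add: ar_matrix_single add_pos_pos)

lemma ar_matrix_pos: "(\<And>k. 0 < u $ k) \<Longrightarrow> 0 < (ar_matrix js *v u) $ k"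
proof (induction js arbitrary: u k)
  case (Cons x js)
  show ?case unfolding ar_matrix_Cons[of x js]
    by (intro ar_matrix_single_pos Cons)
qed (simp add: ar_matrix_Nil)

lemma ar_matrix_single_three:
  assumes "a \<noteq> b" "a \<noteq> x" "b \<noteq> x"
  shows "(ar_matrix [x] *v u) $ x = u $ a + u $ b + u $ x"
    "(ar_matrix [x] *v u) $ a = u $ a" "(ar_matrix [x] *v u) $ b = u $ b"
proof -
  have U: "(UNIV :: 3 set) = {a, b, x}" by (rule letters_cases[OF assms])
  have "u $ 1 + u $ 2 + u $ 3 = (\<Sum>i\<in>UNIV. u $ i)" by (simp add: sum_3)
  also have "\<dots> = u $ a + u $ b + u $ x" unfolding U using assms by simp
  finally show "(ar_matrix [x] *v u) $ x = u $ a + u $ b + u $ x"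
    by (simp add: ar_matrix_single)
qed (use assms in \<open>simp_all add: ar_matrix_single\<close>)

text \<open>\<open>nc_measure_same\<close> distributes the coefficient \<open>u $ a + u $ b\<close>
  of the letter \<open>x\<close> over all three letters, which produces exactly the coefficients
  belonging to \<open>ar_matrix [x] *v u\<close>. The step thus moves from the list to the
  vector.\<close>

lemma nc_weight_step:
  assumes "\<And>k. 0 \<le> u $ k"
  shows "nc_weight l u (x # rs) \<le> nc_weight l (ar_matrix [x] *v u) rs"
proof -
  have "(1 :: 3) \<noteq> 2" by simp
  then obtain a where a: "a \<noteq> x" by metis
  then obtain b where b: "a \<noteq> b" "x \<noteq> b" by (rule third_letter)
  note three = b(1) a b(2)[symmetric]
  have "(u $ a + u $ b) * nc_measure l (x # rs) x
     \<le> (u $ a + u $ b) * (nc_measure l rs a + nc_measure l rs b + nc_measure l rs x)"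
    using assms by (intro mult_left_mono nc_measure_same three) (simp add: add_nonneg_nonneg)
  then show ?thesis
    unfolding nc_weight_three[OF three] ar_matrix_single_three[OF three]
    using a b by (simp add: nc_measure_other algebra_simps)
qed

lemma nc_weight_steps:
  assumes "\<And>k. 0 \<le> u $ k"
  shows "nc_weight l u (rev js @ rs) \<le> nc_weight l (ar_matrix js *v u) rs"
  using assms
proof (induction js arbitrary: u rule: rev_induct)
  case Nil
  then show ?case by (simp add: ar_matrix_Nil)
next
  case (snoc x js)
  have "nc_weight l u (rev (js @ [x]) @ rs) \<le> nc_weight l (ar_matrix [x] *v u) (rev js @ rs)"
    using nc_weight_step[OF snoc.prems] by simp
  also have "\<dots> \<le> nc_weight l (ar_matrix js *v (ar_matrix [x] *v u)) rs"
    by (rule snoc.IH) (rule ar_matrix_nonneg[OF snoc.prems])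
  finally show ?case by (simp add: ar_matrix_snoc)
qed

text \<open>\<open>nc_measure_adjacent\<close> has two summands where \<open>nc_measure_same\<close>
  has three. The omitted one, \<open>nc_measure l rs a\<close> with coefficient
  \<open>u $ a + u $ c\<close>, is the saving.\<close>

lemma nc_weight_adjacent:
  assumes "\<And>k. 0 \<le> u $ k" "a \<noteq> b" "a \<noteq> c" "c \<noteq> b"
  shows "nc_weight l u (b # c # rs) + (u $ a + u $ c) * nc_measure l rs a
    \<le> nc_weight l (ar_matrix [b] *v u) (c # rs)"
proof -
  note three = assms(3,2,4)
  have "(u $ a + u $ c) * nc_measure l (b # c # rs) b
     \<le> (u $ a + u $ c) * (nc_measure l (c # rs) c + nc_measure l (c # rs) b)"
    using assms(1)[of a] assms(1)[of c] by (intro mult_left_mono nc_measure_adjacent[OF assms(2-4)]) simp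
  moreover have "nc_measure l (c # rs) a = nc_measure l rs a" using assms by (simp add: nc_measure_other)
  moreover have "nc_measure l (b # c # rs) a = nc_measure l (c # rs) a"
    "nc_measure l (b # c # rs) c = nc_measure l (c # rs) c"
    using assms by (simp_all only: nc_measure_other not_False_eq_True)
  ultimately show ?thesis
    unfolding nc_weight_three[OF three] ar_matrix_single_three[OF three]
    using assms by (simp add: algebra_simps)
qed

lemma adjacent_distinct:
  assumes "x \<in> set js" "y \<in> set js" "x \<noteq> y"
  obtains A c b B where "js = A @ [c, b] @ B" "c \<noteq> b"
proof -
  have "\<exists>A c b B. js = A @ [c, b] @ B \<and> c \<noteq> b" if "\<not> (\<exists>z. set js \<subseteq> {z})"
    using that
  proof (induction js)
    case (Cons z js)
    show ?case
    proof (cases js)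
      case Nil
      then show ?thesis using Cons.prems by auto
    next
      case (Cons w ks)
      show ?thesis
      proof (cases "z = w")
        case True
        then have "\<not> (\<exists>z. set js \<subseteq> {z})" using Cons.prems Cons by auto
        then obtain A c b B where "js = A @ [c, b] @ B \<and> c \<noteq> b" using Cons.IH by blast
        then have "z # js = (z # A) @ [c, b] @ B \<and> c \<noteq> b" by simp
        then show ?thesis by blast
      next
        case False
        then have "z # js = [] @ [z, w] @ ks \<and> z \<noteq> w" using Cons by simp
        then show ?thesis by blast
      qed
    qed
  qed simp
  moreover have "\<not> (\<exists>z. set js \<subseteq> {z})" using assms by auto
  ultimately show ?thesis using that by blast
qed

definition list_power :: "'a list \<Rightarrow> nat \<Rightarrow> 'a list" where
  "list_power xs n = concat (replicate n xs)"

lemma list_power_simps [simp]: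
  "list_power xs 0 = []" "list_power xs (Suc n) = xs @ list_power xs n"
  by (simp_all add: list_power_def)

lemma list_power_Suc_right: "list_power xs (Suc n) = list_power xs n @ xs"
  by (induction n) simp_all

lemma ar_matrix_power: "ar_matrix (list_power js n) *v x = (((*v) (ar_matrix js)) ^^ n) x"
  by (induction n) (simp_all add: ar_matrix_Nil ar_matrix_append flip: matrix_vector_mul_assoc)

text \<open>The weight along \<open>v\<close>, divided by \<open>lam ^ n\<close>, loses
  \<open>e\<close> times the proportion for \<open>a\<close> in each period and stays nonnegative.
  Telescoping makes the losses summable, so the proportion for \<open>a\<close> tends to 0; every
  other letter is dominated by \<open>a\<close> one period later.\<close>

lemma nc_measure_decay:
  assumes eig: "ar_matrix js *v v = lam *\<^sub>R v" and v: "\<And>k. 0 < v $ k" and lam: "1 < lam"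
    and letters: "\<And>k. k \<in> set js"
  shows "(\<lambda>n. nc_measure l (rev (list_power js n)) d / lam ^ n) \<longlonglongrightarrow> 0"
proof -
  define Y where "Y = (\<lambda>n. nc_measure l (rev (list_power js n)))"
  define W where "W = (\<lambda>n. nc_weight l v (rev (list_power js n)) / lam ^ n)"
  have rev_Suc: "rev (list_power js (Suc n)) = rev js @ rev (list_power js n)" for n
    by (simp add: list_power_Suc_right del: list_power_simps)
  obtain A c b B where js: "js = A @ [c, b] @ B" and cb: "c \<noteq> b"
    by (rule adjacent_distinct[of 1 js 2]) (use letters in auto)
  obtain a where a: "a \<noteq> c" "a \<noteq> b" using third_letter[OF cb] by (metis (full_types))
  define u where "u = ar_matrix B *v v"
  have u: "0 < u $ k" for k unfolding u_def by (rule ar_matrix_pos[OF v])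
  \<comment> \<open>The saving is made at level \<open>Suc n\<close>, where weights are divided by
    \<open>lam ^ Suc n\<close>, but it is compared with the proportion at level \<open>n\<close>;
    hence the factor \<open>1 / lam\<close>.\<close>
  define e where "e = (u $ a + u $ c) / lam"
  have e: "0 < e" using u[of a] u[of c] lam by (simp add: e_def)
  have step: "W (Suc n) + e * (Y n a / lam ^ n) \<le> W n" for n
  proof -
    define rs where "rs = rev A @ rev (list_power js n)"
    have "nc_weight l v (rev (list_power js (Suc n))) = nc_weight l v (rev B @ b # c # rs)"
      unfolding rev_Suc rs_def by (simp add: js)
    also have "\<dots> \<le> nc_weight l u (b # c # rs)"
      unfolding u_def by (rule nc_weight_steps) (simp add: v less_imp_le)
    also have "\<dots> + (u $ a + u $ c) * nc_measure l rs a \<le> nc_weight l (ar_matrix [b] *v u) (c # rs)"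
      using u a cb by (intro nc_weight_adjacent) (auto simp: less_imp_le)
    also have "nc_weight l (ar_matrix [b] *v u) (c # rs)
        = nc_weight l (ar_matrix [b] *v u) (rev (A @ [c]) @ rev (list_power js n))"
      by (simp add: rs_def)
    also have "\<dots> \<le> nc_weight l (ar_matrix (A @ [c]) *v (ar_matrix [b] *v u)) (rev (list_power js n))"
      by (intro nc_weight_steps ar_matrix_nonneg) (simp add: u less_imp_le)
    also have "ar_matrix (A @ [c]) *v (ar_matrix [b] *v u) = ar_matrix js *v v"
      by (simp add: u_def js ar_matrix_append matrix_vector_mul_assoc[symmetric]
          ar_matrix_Cons[of c "b # B"] ar_matrix_Cons[of b B])
    also have "nc_weight l (ar_matrix js *v v) (rev (list_power js n)) = lam * nc_weight l v (rev (list_power js n))"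
      by (simp add: eig nc_weight_def sum_distrib_left algebra_simps)
    finally have *: "nc_weight l v (rev (list_power js (Suc n))) + (u $ a + u $ c) * nc_measure l rs a
       \<le> lam * nc_weight l v (rev (list_power js n))" by simp
    have "(u $ a + u $ c) * Y n a \<le> (u $ a + u $ c) * nc_measure l rs a"
      unfolding Y_def rs_def using u[of a] u[of c]
      by (intro mult_left_mono nc_measure_mono_append) auto
    with * have "nc_weight l v (rev (list_power js (Suc n))) + (u $ a + u $ c) * Y n a
       \<le> lam * nc_weight l v (rev (list_power js n))" by linarith
    then have "(nc_weight l v (rev (list_power js (Suc n))) + (u $ a + u $ c) * Y n a) / lam ^ Suc n
       \<le> (lam * nc_weight l v (rev (list_power js n))) / lam ^ Suc n"
      using lam by (intro divide_right_mono) auto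
    moreover have "e * (Y n a / lam ^ n) = (u $ a + u $ c) * Y n a / lam ^ Suc n"
      by (simp add: e_def)
    moreover have "lam * x / lam ^ Suc n = x / lam ^ n" for x
      using lam by simp
    ultimately show ?thesis
      by (simp only: W_def add_divide_distrib)
  qed
  have W0: "0 \<le> W n" for n
    unfolding W_def using v lam by (intro divide_nonneg_nonneg nc_weight_nonneg) (auto simp: less_imp_le)
  have Y0: "0 \<le> e * (Y n a / lam ^ n)" for n
    using e lam by (simp add: Y_def)
  have bound: "(\<Sum>k<n. e * (Y k a / lam ^ k)) \<le> W 0 - W n" for n
  proof (induction n)
    case (Suc n)
    then show ?case using step[of n] by simp
  qed simp
  have "summable (\<lambda>n. e * (Y n a / lam ^ n))"
  proof (rule bounded_imp_summable[of _ "W 0"])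
    show "(\<Sum>k\<le>n. e * (Y k a / lam ^ k)) \<le> W 0" for n
      using bound[of "Suc n"] W0[of "Suc n"] by (simp add: lessThan_Suc_atMost)
  qed (rule Y0)
  then have "(\<lambda>n. e * (Y n a / lam ^ n)) \<longlonglongrightarrow> 0" by (rule summable_LIMSEQ_zero)
  then have "(\<lambda>n. (1 / e) * (e * (Y n a / lam ^ n))) \<longlonglongrightarrow> (1 / e) * 0"
    by (intro tendsto_mult tendsto_const)
  then have lim: "(\<lambda>n. Y n a / lam ^ n) \<longlonglongrightarrow> 0" using e by simp
  \<comment> \<open>The set of the letter of a step contains a copy of the previous set of every
    letter, and \<open>a\<close> occurs in the period.\<close>
  have le: "Y n d \<le> Y (Suc n) a" for n
  proof -
    obtain P Q where PQ: "rev js = P @ a # Q" using letters[of a] by (metis set_rev split_list)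
    have "Y n d \<le> nc_measure l (Q @ rev (list_power js n)) d"
      unfolding Y_def by (rule nc_measure_mono_append)
    also have "\<dots> \<le> nc_measure l (a # Q @ rev (list_power js n)) a" by (rule nc_measure_same_ge)
    also have "\<dots> \<le> nc_measure l (P @ a # Q @ rev (list_power js n)) a" by (rule nc_measure_mono_append)
    finally show ?thesis unfolding Y_def rev_Suc PQ by simp
  qed
  have "(\<lambda>n. lam * (Y (Suc n) a / lam ^ Suc n)) \<longlonglongrightarrow> lam * 0"
    using LIMSEQ_Suc[OF lim] by (intro tendsto_mult tendsto_const)
  then have lim': "(\<lambda>n. lam * (Y (Suc n) a / lam ^ Suc n)) \<longlonglongrightarrow> 0" by simp
  have "Y n d / lam ^ n \<le> lam * (Y (Suc n) a / lam ^ Suc n)" for n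
  proof -
    have "Y n d / lam ^ n \<le> Y (Suc n) a / lam ^ n" using le lam by (intro divide_right_mono) auto
    also have "\<dots> = lam * (Y (Suc n) a / lam ^ Suc n)" using lam by simp
    finally show ?thesis .
  qed
  then have ev: "\<forall>\<^sub>F n in sequentially. Y n d / lam ^ n \<le> lam * (Y (Suc n) a / lam ^ Suc n)"
    by (intro always_eventually allI)
  have ev0: "\<forall>\<^sub>F n in sequentially. 0 \<le> Y n d / lam ^ n"
    using lam by (intro always_eventually allI) (simp add: Y_def)
  have "(\<lambda>n. Y n d / lam ^ n) \<longlonglongrightarrow> 0"
    by (rule tendsto_sandwich[OF ev0 ev tendsto_const lim'])
  then show ?thesis by (simp only: Y_def)
qed


section \<open>Common descendants\<close>

text \<open>\<open>K\<close> counts the flips that turn \<open>p\<close> into \<open>q\<close>. It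
  is chosen before the steps \<open>rs\<close> and the vertex \<open>z\<close>, so that the decay
  can be applied along all periods.\<close>

definition linked :: "real^3 \<Rightarrow> 3 list \<Rightarrow> 3 list \<Rightarrow> bool" where
  "linked l p q \<longleftrightarrow> abel p = abel q \<and>
     (\<exists>K\<ge>0. \<forall>rs z. \<exists>S\<in>lmeasurable. measure lebesgue S \<le> K * (\<Sum>c\<in>UNIV. nc_measure l rs c) \<and>
       (\<forall>t. t \<notin> S \<longrightarrow> at_height l z (arp (rev rs) p) t = at_height l z (arp (rev rs) q) t))"

lemma linked_refl: "linked l p p"
proof -
  have "\<exists>S\<in>lmeasurable. measure lebesgue S \<le> 0 * (\<Sum>c\<in>UNIV. nc_measure l rs c) \<and>
       (\<forall>t. t \<notin> S \<longrightarrow> at_height l z (arp (rev rs) p) t = at_height l z (arp (rev rs) p) t)" for rs z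
    by (rule bexI[of _ "{}"]) auto
  then show ?thesis unfolding linked_def by blast
qed

lemma linked_trans:
  assumes "linked l p q" "linked l q r"
  shows "linked l p r"
proof -
  obtain K where K: "K \<ge> 0" "\<And>rs z. \<exists>S\<in>lmeasurable. measure lebesgue S \<le> K * (\<Sum>c\<in>UNIV. nc_measure l rs c) \<and>
       (\<forall>t. t \<notin> S \<longrightarrow> at_height l z (arp (rev rs) p) t = at_height l z (arp (rev rs) q) t)"
    using assms(1) unfolding linked_def by blast
  obtain L where L: "L \<ge> 0" "\<And>rs z. \<exists>S\<in>lmeasurable. measure lebesgue S \<le> L * (\<Sum>c\<in>UNIV. nc_measure l rs c) \<and>
       (\<forall>t. t \<notin> S \<longrightarrow> at_height l z (arp (rev rs) q) t = at_height l z (arp (rev rs) r) t)"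
    using assms(2) unfolding linked_def by blast
  have "\<exists>S\<in>lmeasurable. measure lebesgue S \<le> (K + L) * (\<Sum>c\<in>UNIV. nc_measure l rs c) \<and>
       (\<forall>t. t \<notin> S \<longrightarrow> at_height l z (arp (rev rs) p) t = at_height l z (arp (rev rs) r) t)" for rs z
  proof -
    obtain S where S: "S \<in> lmeasurable" "measure lebesgue S \<le> K * (\<Sum>c\<in>UNIV. nc_measure l rs c)"
       "\<And>t. t \<notin> S \<Longrightarrow> at_height l z (arp (rev rs) p) t = at_height l z (arp (rev rs) q) t"
      using K(2)[of rs z] by blast
    obtain T where T: "T \<in> lmeasurable" "measure lebesgue T \<le> L * (\<Sum>c\<in>UNIV. nc_measure l rs c)"
       "\<And>t. t \<notin> T \<Longrightarrow> at_height l z (arp (rev rs) q) t = at_height l z (arp (rev rs) r) t"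
      using L(2)[of rs z] by blast
    have "measure lebesgue (S \<union> T) \<le> (K + L) * (\<Sum>c\<in>UNIV. nc_measure l rs c)"
      using measure_Un_le_lebesgue[OF S(1) T(1)] S(2) T(2) by (simp add: distrib_right)
    then show ?thesis using S T by (intro bexI[of _ "S \<union> T"]) auto
  qed
  moreover have "abel p = abel r" "K + L \<ge> 0" using assms K(1) L(1) by (auto simp: linked_def)
  ultimately show ?thesis unfolding linked_def by blast
qed

text \<open>A common prefix only moves the start vertex, and a common suffix starts at the same
  vertex because the abelianizations agree.\<close>

lemma linked_context:
  assumes "linked l p q"
  shows "linked l (u @ p @ w) (u @ q @ w)"
proof -
  have ab: "abel (arp js p) = abel (arp js q)" for js
    using assms by (simp add: linked_def abel_arp)
  obtain K where K: "K \<ge> 0" "\<And>rs z. \<exists>S\<in>lmeasurable. measure lebesgue S \<le> K * (\<Sum>c\<in>UNIV. nc_measure l rs c) \<and>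
       (\<forall>t. t \<notin> S \<longrightarrow> at_height l z (arp (rev rs) p) t = at_height l z (arp (rev rs) q) t)"
    using assms(1) unfolding linked_def by blast
  have "\<exists>S\<in>lmeasurable. measure lebesgue S \<le> K * (\<Sum>c\<in>UNIV. nc_measure l rs c) \<and>
       (\<forall>t. t \<notin> S \<longrightarrow> at_height l z (arp (rev rs) (u @ p @ w)) t = at_height l z (arp (rev rs) (u @ q @ w)) t)" for rs z
  proof -
    obtain S where S: "S \<in> lmeasurable" "measure lebesgue S \<le> K * (\<Sum>c\<in>UNIV. nc_measure l rs c)"
       "\<And>t. t \<notin> S \<Longrightarrow> at_height l (z + abel (arp (rev rs) u)) (arp (rev rs) p) t
          = at_height l (z + abel (arp (rev rs) u)) (arp (rev rs) q) t"
      using K(2)[of rs "z + abel (arp (rev rs) u)"] by blast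
    then show ?thesis
      by (intro bexI[of _ S]) (auto simp: at_height_append ab)
  qed
  moreover have "abel (u @ p @ w) = abel (u @ q @ w)" using assms by (simp add: linked_def)
  ultimately show ?thesis using K(1) unfolding linked_def by blast
qed

lemma linked_swap:
  assumes l: "\<And>k. 0 \<le> l $ k"
  shows "linked l [a, b] [b, a]"
proof (cases "a = b")
  case True
  then show ?thesis by (simp add: linked_refl)
next
  case False
  then obtain c where c: "a \<noteq> c" "b \<noteq> c" by (rule third_letter)
  have "\<exists>S\<in>lmeasurable. measure lebesgue S \<le> 1 * (\<Sum>c\<in>UNIV. nc_measure l rs c) \<and>
       (\<forall>t. t \<notin> S \<longrightarrow> at_height l z (arp (rev rs) [a, b]) t = at_height l z (arp (rev rs) [b, a]) t)" for rs z
  proof (rule bexI[of _ "(+) (l \<bullet> z) ` noncoin l rs c"], intro conjI allI impI)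
    have "nc_measure l rs c \<le> (\<Sum>c\<in>UNIV. nc_measure l rs c)"
      by (rule member_le_sum) auto
    then show "measure lebesgue ((+) (l \<bullet> z) ` noncoin l rs c) \<le> 1 * (\<Sum>c\<in>UNIV. nc_measure l rs c)"
      by (simp add: measure_translation nc_measure_def)
  next
    fix t assume "t \<notin> (+) (l \<bullet> z) ` noncoin l rs c"
    then have "t - l \<bullet> z \<notin> noncoin l rs c" by (force simp: image_iff)
    then show "at_height l z (arp (rev rs) [a, b]) t = at_height l z (arp (rev rs) [b, a]) t"
      by (rule at_height_flip[OF False c l])
  qed (intro measurable_translation noncoin_lmeasurable)
  moreover have "abel [a, b] = abel [b, a]" by (simp add: add.commute)
  moreover have "(0::real) \<le> 1" by simp
  ultimately show ?thesis unfolding linked_def by blast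
qed

lemma linked_move:
  assumes l: "\<And>k. 0 \<le> l $ k"
  shows "linked l (x # q @ r) (q @ x # r)"
proof (induction q)
  case Nil
  then show ?case by (simp add: linked_refl)
next
  case (Cons y q)
  have "linked l ([] @ [x, y] @ (q @ r)) ([] @ [y, x] @ (q @ r))"
    by (rule linked_context[OF linked_swap[OF l]])
  moreover have "linked l ([y] @ (x # q @ r) @ []) ([y] @ (q @ x # r) @ [])"
    by (rule linked_context[OF Cons])
  ultimately show ?case by (auto intro: linked_trans)
qed

lemma linked_perm:
  assumes l: "\<And>k. 0 \<le> l $ k"
  shows "mset p = mset q \<Longrightarrow> linked l p q"
proof (induction p arbitrary: q)
  case Nil
  then show ?case by (simp add: linked_refl)
next
  case (Cons x p)
  then have "x \<in> set q" by (metis list.set_intros(1) set_mset_mset)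
  then obtain q1 q2 where q: "q = q1 @ x # q2" by (metis split_list)
  have "linked l p (q1 @ q2)" using Cons.prems by (intro Cons.IH) (simp add: q)
  then have "linked l ([x] @ p @ []) ([x] @ (q1 @ q2) @ [])" by (rule linked_context)
  then show ?case using linked_trans[OF _ linked_move[OF l, of x q1 q2]] q by simp
qed

lemma mset_eq_of_abel: "abel p = abel q \<Longrightarrow> mset p = mset q"
  by (simp add: multiset_eq_iff count_mset abel_def vec_eq_iff)

lemma word_with_abel:
  fixes d :: "real^3"
  assumes "\<And>k. d $ k \<in> \<int>" "\<And>k. 0 \<le> d $ k"
  obtains w where "abel w = d"
proof -
  let ?n = "\<lambda>k. nat \<lfloor>d $ k\<rfloor>"
  have n: "real (?n k) = d $ k" for k
    using assms[of k] by (auto simp: elim!: Ints_cases)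
  let ?w = "replicate (?n 1) 1 @ replicate (?n 2) 2 @ replicate (?n 3) (3 :: 3)"
  have c: "count_list (replicate m x) y = (if x = y then m else 0)" for m and x y :: 3
    by (induction m) auto
  have "abel ?w $ k = d $ k" for k
    using n[of k] exhaust_3[of k] by (auto simp: abel_def c)
  then show ?thesis using that[of ?w] by (simp add: vec_eq_iff)
qed

text \<open>Join the two edges to common end points by broken lines, which are then linked by flips.\<close>

lemma common_descendant:
  assumes eig: "ar_matrix js *v v = lam *\<^sub>R v" and v: "\<And>k. 0 < v $ k" and lam: "1 < lam"
    and letters: "\<And>k. k \<in> set js"
    and l: "\<And>k. 0 < l $ k" and l_eig: "\<And>x. l \<bullet> (ar_matrix js *v x) = lam * (l \<bullet> x)"
    and Ints: "\<And>k. y $ k \<in> \<int>" "\<And>k. y' $ k \<in> \<int>"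
    and overlap: "l \<bullet> y < l \<bullet> y' + l $ j'" "l \<bullet> y' < l \<bullet> y + l $ j"
  obtains n e where "e \<in> edges (ar_matrix (list_power js n) *v y) (arp (list_power js n) [j])"
    "e \<in> edges (ar_matrix (list_power js n) *v y') (arp (list_power js n) [j'])"
proof -
  \<comment> \<open>The common start is the componentwise minimum. The common end is one unit beyond
    the componentwise maximum, which leaves room for the edges \<open>j\<close> and
    \<open>j'\<close>, so all connecting vectors are nonnegative and integral.\<close>
  define s :: "real^3" where "s = (\<chi> k. min (y $ k) (y' $ k))"
  define f :: "real^3" where "f = (\<chi> k. max (y $ k) (y' $ k) + 1)"
  have axis_le: "(axis i 1 :: real^3) $ k \<le> 1" "(axis i 1 :: real^3) $ k \<in> \<int>" for i k
    by (auto simp: axis_def)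
  obtain A where A: "abel A = y - s"
    by (rule word_with_abel[of "y - s"]) (use Ints in \<open>auto simp: s_def min_def\<close>)
  obtain A' where A': "abel A' = y' - s"
    by (rule word_with_abel[of "y' - s"]) (use Ints in \<open>auto simp: s_def min_def\<close>)
  obtain B where B: "abel B = f - (y + axis j 1)"
  proof (rule word_with_abel[of "f - (y + axis j 1)"])
    show "0 \<le> (f - (y + axis j 1)) $ k" for k
      using axis_le(1)[of j k] by (simp add: f_def max_def)
  qed (use Ints axis_le in \<open>auto simp: f_def max_def intro!: Ints_add Ints_diff\<close>)
  obtain B' where B': "abel B' = f - (y' + axis j' 1)"
  proof (rule word_with_abel[of "f - (y' + axis j' 1)"])
    show "0 \<le> (f - (y' + axis j' 1)) $ k" for k
      using axis_le(1)[of j' k] by (simp add: f_def max_def)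
  qed (use Ints axis_le in \<open>auto simp: f_def max_def intro!: Ints_add Ints_diff\<close>)
  define p where "p = A @ [j] @ B"
  define q where "q = A' @ [j'] @ B'"
  have "abel p = abel q" by (simp add: p_def q_def A A' B B' algebra_simps)
  then have "linked l p q"
    by (intro linked_perm mset_eq_of_abel) (simp_all add: l less_imp_le)
  then obtain K where K: "K \<ge> 0" "\<And>rs z. \<exists>S\<in>lmeasurable. measure lebesgue S \<le> K * (\<Sum>c\<in>UNIV. nc_measure l rs c) \<and>
       (\<forall>t. t \<notin> S \<longrightarrow> at_height l z (arp (rev rs) p) t = at_height l z (arp (rev rs) q) t)"
    unfolding linked_def by blast
  define P where "P = (\<lambda>n. list_power js n)"
  define M where "M = (\<lambda>n. (*v) (ar_matrix (P n)))"
  have lM: "l \<bullet> M n x = lam ^ n * (l \<bullet> x)" for n x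
    unfolding M_def P_def ar_matrix_power by (induction n) (simp_all add: l_eig)
  define t0 where "t0 = max (l \<bullet> y) (l \<bullet> y')"
  define t1 where "t1 = min (l \<bullet> y + l $ j) (l \<bullet> y' + l $ j')"
  have t01: "t0 < t1" using overlap l[of j] l[of j'] by (auto simp: t0_def t1_def)
  show ?thesis
  proof (cases "\<exists>n e. e \<in> edges (M n y) (arp (P n) [j]) \<and> e \<in> edges (M n y') (arp (P n) [j'])")
    case True
    then show ?thesis using that by (auto simp: M_def P_def)
  next
    case False
    have bound: "t1 - t0 \<le> K * (\<Sum>c\<in>UNIV. nc_measure l (rev (P n)) c / lam ^ n)" for n
    proof -
      let ?I = "{lam ^ n * t0..<lam ^ n * t1}"
      obtain S where S: "S \<in> lmeasurable" "measure lebesgue S \<le> K * (\<Sum>c\<in>UNIV. nc_measure l (rev (P n)) c)"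
        "\<And>t. t \<notin> S \<Longrightarrow> at_height l (M n s) (arp (P n) p) t = at_height l (M n s) (arp (P n) q) t"
        using K(2)[of "rev (P n)" "M n s"] by auto
      \<comment> \<open>Outside \<open>S\<close> both image paths have the same edge at height
        \<open>t\<close>. For \<open>t\<close> in the stretched overlap \<open>?I\<close> this edge
        would lie in the images of both given edges, hence be a common descendant.\<close>
      have "?I \<subseteq> S"
      proof
        fix t assume t: "t \<in> ?I"
        have lamn: "0 < lam ^ n" using lam by simp
        have split: "at_height l (M n s) (arp (P n) (C @ [i] @ D)) t =
            at_height l (M n s) (arp (P n) C) t \<union> at_height l (M n x) (arp (P n) [i]) t \<union>
            at_height l (M n (x + axis i 1)) (arp (P n) D) t" if "abel C = x - s" for C D x i
        proof -
          have "M n s + abel (arp (P n) C) = M n x"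
            by (simp add: that abel_arp M_def matrix_vector_mult_diff_distrib)
          moreover have "M n x + abel (arp (P n) [i]) = M n (x + axis i 1)"
            by (simp add: abel_arp M_def matrix_vector_right_distrib)
          ultimately show ?thesis
            unfolding arp_append at_height_append by (simp add: add.assoc[symmetric] Un_assoc)
        qed
        have ex: "\<exists>e. e \<in> at_height l (M n x) (arp (P n) [i]) t"
          if "l \<bullet> x \<le> t0" "t1 \<le> l \<bullet> x + l $ i" for x i
        proof (rule at_height_exists)
          have "lam ^ n * (l \<bullet> x) \<le> lam ^ n * t0" using that lamn by simp
          then show "l \<bullet> M n x \<le> t" using t by (simp add: lM)
          have "l \<bullet> abel (arp (P n) [i]) = lam ^ n * (l $ i)"
            using lM[of n "axis i 1"] by (simp add: abel_arp M_def)
          moreover have "lam ^ n * t1 \<le> lam ^ n * (l \<bullet> x + l $ i)" using that lamn by simp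
          ultimately show "t < l \<bullet> M n x + l \<bullet> abel (arp (P n) [i])"
            using t by (simp add: lM distrib_left)
        qed
        show "t \<in> S"
        proof (rule ccontr)
          assume "t \<notin> S"
          then have eq: "at_height l (M n s) (arp (P n) p) t = at_height l (M n s) (arp (P n) q) t"
            by (rule S(3))
          obtain e where e: "e \<in> at_height l (M n y) (arp (P n) [j]) t"
            using ex[of y j] by (auto simp: t0_def t1_def)
          obtain e' where e': "e' \<in> at_height l (M n y') (arp (P n) [j']) t"
            using ex[of y' j'] by (auto simp: t0_def t1_def)
          have "e \<in> at_height l (M n s) (arp (P n) p) t"
            unfolding p_def split[OF A] using e by blast
          moreover have "e' \<in> at_height l (M n s) (arp (P n) p) t"
            unfolding eq unfolding q_def split[OF A'] using e' by blast
          ultimately have "e = e'" by (rule at_height_unique) (simp add: l less_imp_le)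
          then show False using False e e' by (auto simp: at_height_def)
        qed
      qed
      have "lam ^ n * t0 \<le> lam ^ n * t1" using t01 lam by simp
      then have "lam ^ n * (t1 - t0) = measure lebesgue ?I" by (simp add: right_diff_distrib)
      also have "\<dots> \<le> measure lebesgue S"
        using \<open>?I \<subseteq> S\<close> S(1) by (intro measure_mono_fmeasurable) auto
      also have "\<dots> \<le> K * (\<Sum>c\<in>UNIV. nc_measure l (rev (P n)) c)" by (rule S(2))
      finally have "t1 - t0 \<le> K * (\<Sum>c\<in>UNIV. nc_measure l (rev (P n)) c) / lam ^ n"
        using lam by (simp add: pos_le_divide_eq mult.commute)
      then show ?thesis by (simp add: sum_divide_distrib[symmetric])
    qed
    have "(\<lambda>n. K * (\<Sum>c\<in>UNIV. nc_measure l (rev (P n)) c / lam ^ n)) \<longlonglongrightarrow> K * (\<Sum>c\<in>(UNIV :: 3 set). 0)"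
      unfolding P_def by (intro tendsto_intros nc_measure_decay[OF eig v lam letters])
    then have "t1 - t0 \<le> K * (\<Sum>c\<in>(UNIV :: 3 set). 0)"
      by (rule LIMSEQ_le_const) (use bound in auto)
    then show ?thesis using t01 by simp
  qed
qed


section \<open>Exchange of pieces and connectedness\<close>

text \<open>Any two points are joined inside \<open>A\<close> by a chain with jumps at most
  \<open>d\<close>, expressed as an induction principle instead of through explicit chains.\<close>

definition chained :: "real \<Rightarrow> 'a::metric_space set \<Rightarrow> bool" where
  "chained d A \<longleftrightarrow> (\<forall>P. (\<exists>x\<in>A. P x) \<and> (\<forall>x\<in>A. \<forall>y\<in>A. P x \<and> dist x y \<le> d \<longrightarrow> P y) \<longrightarrow> (\<forall>x\<in>A. P x))"

lemma chainedD:
  "chained d A \<Longrightarrow> x \<in> A \<Longrightarrow> P x \<Longrightarrow> (\<And>x y. x \<in> A \<Longrightarrow> y \<in> A \<Longrightarrow> P x \<Longrightarrow> dist x y \<le> d \<Longrightarrow> P y)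
    \<Longrightarrow> y \<in> A \<Longrightarrow> P y"
  unfolding chained_def by blast

lemma chained_translation:
  fixes A :: "'a::real_normed_vector set"
  assumes "chained d A"
  shows "chained d ((\<lambda>x. x + c) ` A)"
  unfolding chained_def
proof (intro allI impI ballI)
  fix P y assume P: "(\<exists>x\<in>(\<lambda>x. x + c) ` A. P x) \<and>
    (\<forall>x\<in>(\<lambda>x. x + c) ` A. \<forall>y\<in>(\<lambda>x. x + c) ` A. P x \<and> dist x y \<le> d \<longrightarrow> P y)"
    and "y \<in> (\<lambda>x. x + c) ` A"
  then obtain x y' where xy: "x \<in> A" "P (x + c)" "y' \<in> A" "y = y' + c" by blast
  have step: "P (w + c)" if "u \<in> A" "w \<in> A" "P (u + c)" "dist u w \<le> d" for u w
  proof -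
    have "dist (u + c) (w + c) \<le> d" using that by (simp add: dist_norm)
    with P that show ?thesis by blast
  qed
  have "P (y' + c)"
    by (rule chainedD[OF assms xy(1), of "\<lambda>z. P (z + c)", OF xy(2) step xy(3)])
  then show "P y" using xy by simp
qed

lemma chained_Union:
  assumes "\<And>i. chained d (A i)" "\<And>i. z \<in> A i"
  shows "chained d (\<Union>i. A i)"
  unfolding chained_def
proof (intro allI impI ballI)
  fix P y assume P: "(\<exists>x\<in>(\<Union>i. A i). P x) \<and> (\<forall>x\<in>(\<Union>i. A i). \<forall>y\<in>(\<Union>i. A i). P x \<and> dist x y \<le> d \<longrightarrow> P y)"
    and "y \<in> (\<Union>i. A i)"
  then obtain x i j where xy: "x \<in> A i" "P x" "y \<in> A j" by blast
  have step: "P w" if "u \<in> A k" "w \<in> A k" "P u" "dist u w \<le> d" for u w k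
    using P that by blast
  have "P z" by (rule chainedD[OF assms(1)[of i] xy(1), of P, OF xy(2) step[of _ i] assms(2)])
  then show "P y" by (rule chainedD[OF assms(1)[of j] assms(2)[of j], of P, OF _ step[of _ j] xy(3)])
qed

text \<open>A separation of a compact set has a positive gap, which chains with jumps of half its
  size cannot cross.\<close>

lemma compact_chained_imp_connected:
  fixes A :: "'a::euclidean_space set"
  assumes "compact A" "\<And>d. 0 < d \<Longrightarrow> chained d A"
  shows "connected A"
  unfolding connected_closed
proof (rule notI, elim exE conjE)
  fix U V assume UV: "closed U" "closed V" "A \<subseteq> U \<union> V" "U \<inter> V \<inter> A = {}" "U \<inter> A \<noteq> {}" "V \<inter> A \<noteq> {}"
  have cU: "compact (A \<inter> U)" using assms(1) UV by (simp add: compact_Int_closed)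
  have "closed (A \<inter> V)" using assms(1) UV by (simp add: compact_imp_closed closed_Int)
  with cU obtain d where d: "d > 0" "\<And>x y. x \<in> A \<inter> U \<Longrightarrow> y \<in> A \<inter> V \<Longrightarrow> d \<le> dist x y"
    using separate_compact_closed[of "A \<inter> U" "A \<inter> V"] UV(4) by blast
  obtain x y where xy: "x \<in> A" "x \<in> U" "y \<in> A" "y \<in> V" using UV by blast
  have "y \<in> U"
  proof (rule chainedD[OF assms(2)[of "d / 2"] xy(1), of "\<lambda>x. x \<in> U"])
    fix x y assume "x \<in> A" "y \<in> A" "x \<in> U" "dist x y \<le> d / 2"
    then show "y \<in> U" using d(2)[of x y] d(1) UV(3) by fastforce
  qed (use d xy in auto)
  then show False using xy UV(4) by blast
qed

text \<open>One application of a graph-directed set equation. \<open>D\<close> turns prefixes into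
  translations and the contraction is left to \<open>T\<close>; keeping \<open>D\<close> free allows
  a product of steps to be unfolded one step at a time, with the matrix of the outer step absorbed
  into \<open>D\<close>.\<close>

definition gifs :: "(real^3 \<Rightarrow> real^3) \<Rightarrow> 3 list \<Rightarrow> (3 \<Rightarrow> (real^3) set) \<Rightarrow> 3 \<Rightarrow> (real^3) set" where
  "gifs D ks T i = (\<Union>j. \<Union>p\<in>{p. (p, i) \<in> edges 0 (arp ks [j])}. (\<lambda>x. x - D p) ` T j)"

lemma mem_gifs: "y \<in> gifs D ks T i \<longleftrightarrow> (\<exists>j p t. (p, i) \<in> edges 0 (arp ks [j]) \<and> t \<in> T j \<and> y = t - D p)"
  by (auto simp: gifs_def)

lemma edges_arp_shift:
  "(q, i) \<in> edges 0 (arp ks (arp ms [j])) \<longleftrightarrow>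
    (\<exists>p k. (p, k) \<in> edges 0 (arp ms [j]) \<and> (q - ar_matrix ks *v p, i) \<in> edges 0 (arp ks [k]))"
proof -
  have "(q, i) \<in> edges (ar_matrix ks *v p) w \<longleftrightarrow> (q - ar_matrix ks *v p, i) \<in> edges 0 w" for p w
    using edges_shift[of q i 0] by simp
  then show ?thesis using edges_refine[of ks 0 "arp ms [j]"] by fastforce
qed

lemma gifs_append:
  assumes "linear D"
  shows "gifs D (ks @ ms) T i = gifs D ks (gifs (\<lambda>x. D (ar_matrix ks *v x)) ms T) i"
proof (intro set_eqI iffI)
  fix y assume "y \<in> gifs D (ks @ ms) T i"
  then obtain j q t where q: "(q, i) \<in> edges 0 (arp ks (arp ms [j]))" and t: "t \<in> T j" "y = t - D q"
    by (auto simp: mem_gifs arp_append_list)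
  then obtain p k where pk: "(p, k) \<in> edges 0 (arp ms [j])" "(q - ar_matrix ks *v p, i) \<in> edges 0 (arp ks [k])"
    using edges_arp_shift by blast
  have "y = (t - D (ar_matrix ks *v p)) - D (q - ar_matrix ks *v p)"
    using t assms by (simp add: linear_diff)
  moreover have "t - D (ar_matrix ks *v p) \<in> gifs (\<lambda>x. D (ar_matrix ks *v x)) ms T k"
    using pk(1) t(1) unfolding mem_gifs by blast
  ultimately show "y \<in> gifs D ks (gifs (\<lambda>x. D (ar_matrix ks *v x)) ms T) i"
    using pk(2) unfolding mem_gifs by blast
next
  fix y assume "y \<in> gifs D ks (gifs (\<lambda>x. D (ar_matrix ks *v x)) ms T) i"
  then obtain k r j p t where *: "(r, i) \<in> edges 0 (arp ks [k])" "(p, k) \<in> edges 0 (arp ms [j])" "t \<in> T j"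
      "y = t - D (ar_matrix ks *v p) - D r"
    by (auto simp: mem_gifs)
  have "(r + ar_matrix ks *v p, i) \<in> edges 0 (arp ks (arp ms [j]))"
    unfolding edges_arp_shift using * by (metis add_diff_cancel_right')
  moreover have "y = t - D (r + ar_matrix ks *v p)" using * assms by (simp add: linear_add)
  ultimately show "y \<in> gifs D (ks @ ms) T i"
    using *(3) by (auto simp: mem_gifs arp_append_list)
qed

lemma gifs_Nil: "linear D \<Longrightarrow> gifs D [] T i = T i"
  by (auto simp: gifs_def arnoux_rauzy_product_simps linear_0)

lemma ar_matrix_single_axis:
  "ar_matrix [x] *v axis j 1 = (if j = x then axis x 1 else axis j 1 + axis x 1)"
  by (auto simp: vec_eq_iff ar_matrix_single) (use exhaust_3 in \<open>auto simp: axis_def\<close>)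

lemma edges_single:
  "(p, i) \<in> edges 0 (arp [x] [j]) \<longleftrightarrow> (p = 0 \<and> i = j) \<or> (j \<noteq> x \<and> i = x \<and> p = axis j 1)"
  by (auto simp: arp_single arnoux_rauzy_def)

lemma gifs_single_other:
  assumes "linear D" "i \<noteq> x"
  shows "gifs D [x] T i = T i"
  using assms by (auto simp: gifs_def edges_single linear_0)

text \<open>The letter \<open>x\<close> is the last letter of \<open>arp [x] [j]\<close> for every
  \<open>j\<close>, so its prefix is the image of \<open>axis j 1\<close> minus
  \<open>axis x 1\<close>, uniformly in \<open>j\<close>. This is what makes the new piece a
  translate of one exchanged union.\<close>

lemma gifs_single_same:
  assumes "linear D"
  shows "gifs D [x] T x = (\<lambda>y. y + D (axis x 1)) ` (\<Union>j. (\<lambda>y. y - D (ar_matrix [x] *v axis j 1)) ` T j)"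
proof (intro set_eqI iffI)
  fix y assume "y \<in> gifs D [x] T x"
  then obtain j p t where *: "(p, x) \<in> edges 0 (arp [x] [j])" "t \<in> T j" "y = t - D p"
    by (auto simp: mem_gifs)
  have "y = t - D (ar_matrix [x] *v axis j 1) + D (axis x 1)"
    using * assms by (auto simp: edges_single ar_matrix_single_axis linear_0 linear_add split: if_splits)
  then show "y \<in> (\<lambda>y. y + D (axis x 1)) ` (\<Union>j. (\<lambda>y. y - D (ar_matrix [x] *v axis j 1)) ` T j)"
    using *(2) by blast
next
  fix y assume "y \<in> (\<lambda>y. y + D (axis x 1)) ` (\<Union>j. (\<lambda>y. y - D (ar_matrix [x] *v axis j 1)) ` T j)"
  then obtain j t where *: "t \<in> T j" "y = t - D (ar_matrix [x] *v axis j 1) + D (axis x 1)" by auto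
  let ?p = "if j = x then 0 else axis j 1 :: real^3"
  have "(?p, x) \<in> edges 0 (arp [x] [j])" by (auto simp: edges_single)
  moreover have "y = t - D ?p" using * assms
    by (auto simp: ar_matrix_single_axis linear_0 linear_add)
  ultimately show "y \<in> gifs D [x] T x" using *(1) unfolding mem_gifs by blast
qed

text \<open>The last hypothesis says that the three pieces can be exchanged by translations within
  their union. It turns the piece created by one step into a translate of the union of all pieces,
  which is connected as soon as the pieces are.\<close>

lemma gifs_exchange:
  assumes "linear D" "\<And>j. 0 \<in> T j" "\<And>j. chained d (T j)"
    and "(\<Union>j. T j) = (\<Union>j. (\<lambda>y. y - D (ar_matrix ks *v axis j 1)) ` T j)"
  shows "(\<forall>i. 0 \<in> gifs D ks T i \<and> chained d (gifs D ks T i)) \<and>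
    (\<Union>i. gifs D ks T i) = (\<Union>i. (\<lambda>y. y - D (axis i 1)) ` gifs D ks T i)"
  using assms
proof (induction ks arbitrary: D)
  case Nil
  then show ?case by (simp add: gifs_Nil ar_matrix_Nil)
next
  case (Cons x ks)
  define D1 where "D1 = (\<lambda>y. D (ar_matrix [x] *v y))"
  define T1 where "T1 = gifs D1 ks T"
  define T2 where "T2 = gifs D [x] T1"
  have lin: "linear D1" unfolding D1_def
    using linear_compose[OF matrix_vector_mul_linear Cons.prems(1)] by (simp add: o_def)
  have IH: "0 \<in> T1 i" "chained d (T1 i)"
    "(\<Union>i. T1 i) = (\<Union>i. (\<lambda>y. y - D1 (axis i 1)) ` T1 i)" for i
    using Cons.IH[OF lin Cons.prems(2,3)] Cons.prems(4)
    unfolding T1_def D1_def ar_matrix_Cons[of x ks] by blast+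
  define c where "c = D (axis x 1)"
  have T2: "gifs D (x # ks) T = T2"
    using gifs_append[OF Cons.prems(1), of "[x]" ks T] by (auto simp: T2_def T1_def D1_def)
  have D1: "D1 (axis j 1) = (if j = x then c else D (axis j 1) + c)" for j
    using Cons.prems(1) by (simp add: D1_def ar_matrix_single_axis c_def linear_add)
  have x: "T2 x = (\<lambda>y. y + c) ` (\<Union>j. T1 j)"
    unfolding T2_def gifs_single_same[OF Cons.prems(1)] IH(3) by (simp add: D1_def c_def)
  have o: "T2 i = T1 i" if "i \<noteq> x" for i
    using gifs_single_other[OF Cons.prems(1) that] by (simp add: T2_def)
  have ch: "chained d (T2 i)" for i
    using chained_translation[OF chained_Union[of d T1, OF IH(2,1)], of c] IH(2)[of i] x o[of i]
    by (cases "i = x") simp_all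
  \<comment> \<open>The exchange moves the piece of \<open>x\<close> by \<open>- c\<close>, so the
    union contains \<open>- c\<close>, and its translate by \<open>c\<close> contains 0.\<close>
  have "0 - D1 (axis x 1) \<in> (\<Union>j. T1 j)" unfolding IH(3) using IH(1) by blast
  then have "- c \<in> (\<Union>j. T1 j)" by (simp add: D1)
  then have "0 \<in> T2 x" unfolding x by force
  then have z: "0 \<in> T2 i" for i using o[of i] IH(1)[of i] by (cases "i = x") simp_all
  have exch1: "y - c \<in> (\<Union>j. T1 j)" if "y \<in> T1 x" for y
    unfolding IH(3) using that by (auto simp: D1 intro!: exI[of _ x])
  have exch2: "y - D (axis i 1) - c \<in> (\<Union>j. T1 j)" if "y \<in> T1 i" "i \<noteq> x" for y i
  proof -
    have "y - D1 (axis i 1) \<in> (\<Union>j. T1 j)" unfolding IH(3) using that by blast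
    then show ?thesis using that by (simp add: D1 algebra_simps)
  qed
  have exch3: "(y + c \<in> T1 x) \<or> (\<exists>i t. i \<noteq> x \<and> t \<in> T1 i \<and> y + c = t - D (axis i 1))" if y: "y \<in> (\<Union>j. T1 j)" for y
  proof -
    obtain i t where "t \<in> T1 i" "y = t - D1 (axis i 1)" using y unfolding IH(3) by blast
    then show ?thesis by (cases "i = x") (auto simp: D1 algebra_simps)
  qed
  \<comment> \<open>Both sides consist of the union of all \<open>T1 j\<close> together with the
    sets \<open>T1 i\<close> moved by \<open>- D (axis i 1)\<close> for \<open>i\<close> other than
    \<open>x\<close>: the exchange for \<open>D1\<close> describes the union moved by
    \<open>c\<close>, and the exchange for \<open>D\<close> moves \<open>T2 x\<close> back by
    \<open>c\<close>.\<close>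
  have "(\<Union>i. T2 i) = (\<Union>i. (\<lambda>y. y - D (axis i 1)) ` T2 i)"
  proof (intro set_eqI iffI)
    fix y assume "y \<in> (\<Union>i. T2 i)"
    then obtain i where i: "y \<in> T2 i" by blast
    have inx: "u \<in> (\<Union>i. (\<lambda>y. y - D (axis i 1)) ` T2 i)" if "u \<in> (\<Union>j. T1 j)" for u
    proof -
      have "u + c \<in> T2 x" unfolding x using that by blast
      then have "(u + c) - D (axis x 1) \<in> (\<Union>i. (\<lambda>y. y - D (axis i 1)) ` T2 i)" by blast
      then show ?thesis by (simp add: c_def)
    qed
    show "y \<in> (\<Union>i. (\<lambda>y. y - D (axis i 1)) ` T2 i)"
    proof (cases "i = x")
      case True
      then obtain u where "u \<in> (\<Union>j. T1 j)" "y = u + c" using i x by auto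
      with exch3 consider "y \<in> T1 x" | i t where "i \<noteq> x" "t \<in> T1 i" "y = t - D (axis i 1)" by blast
      then show ?thesis
      proof cases
        case 1
        then show ?thesis using inx by blast
      next
        case 2
        then show ?thesis using o by blast
      qed
    next
      case False
      then show ?thesis using inx i o by blast
    qed
  next
    fix y assume "y \<in> (\<Union>i. (\<lambda>y. y - D (axis i 1)) ` T2 i)"
    then obtain i t where i: "t \<in> T2 i" "y = t - D (axis i 1)" by blast
    show "y \<in> (\<Union>i. T2 i)"
    proof (cases "i = x")
      case True
      then have "y \<in> (\<Union>j. T1 j)" using i x by (auto simp: c_def)
      then obtain j where j: "y \<in> T1 j" by blast
      show ?thesis
      proof (cases "j = x")
        case True
        then have "(y - c) + c \<in> T2 x" unfolding x using exch1 j by blast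
        then show ?thesis by auto
      next
        case False
        then show ?thesis using o j by blast
      qed
    next
      case False
      then have "(y - c) + c \<in> T2 x" unfolding x using exch2[of t i] i o by blast
      then show ?thesis by auto
    qed
  qed
  then show ?case using z ch unfolding T2 by blast
qed


section \<open>Rauzy fractals\<close>

lemma edges_iff: "(x, i) \<in> edges z w \<longleftrightarrow> (\<exists>p s. w = p @ i # s \<and> x = z + abel p)"
proof
  assume "(x, i) \<in> edges z w"
  then show "\<exists>p s. w = p @ i # s \<and> x = z + abel p"
  proof (induction w arbitrary: z)
    case (Cons a w)
    show ?case
    proof (cases "(x, i) = (z, a)")
      case True
      then have "a # w = [] @ i # w \<and> x = z + abel []" by simp
      then show ?thesis by blast
    next
      case False
      then obtain p s where "w = p @ i # s" "x = z + axis a 1 + abel p"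
        using Cons.prems Cons.IH[of "z + axis a 1"] by auto
      then have "a # w = (a # p) @ i # s \<and> x = z + abel (a # p)" by simp
      then show ?thesis by blast
    qed
  qed simp
next
  assume "\<exists>p s. w = p @ i # s \<and> x = z + abel p"
  then show "(x, i) \<in> edges z w" by (auto simp: edges_append)
qed

lemma closure_image_bounded:
  fixes f :: "'a::euclidean_space \<Rightarrow> 'b::euclidean_space"
  assumes "bounded A" "continuous_on UNIV f"
  shows "closure (f ` A) = f ` closure A"
proof
  have "compact (f ` closure A)"
    using assms by (intro compact_continuous_image) (auto intro: continuous_on_subset simp: compact_closure)
  then show "closure (f ` A) \<subseteq> f ` closure A"
    using closure_subset[of A] by (intro closure_minimal) (auto simp: compact_imp_closed)
  show "f ` closure A \<subseteq> closure (f ` A)"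
    using assms closure_subset[of "f ` A"] by (intro image_closure_subset) (auto intro: continuous_on_subset)
qed

lemma closure_UN_finite: "finite I \<Longrightarrow> closure (\<Union>i\<in>I. A i) = (\<Union>i\<in>I. closure (A i))"
  by (induction I rule: finite_induct) simp_all

text \<open>The geometry sees Pisot irreducibility only through these data. \<open>kap\<close>
  bounds the powers of the matrix on the plane orthogonal to \<open>l\<close>; its summability
  bounds the Rauzy fractals, its convergence to 0 gives the approximations.\<close>

locale ar_pisot =
  fixes js :: "3 list" and lam :: real and l v :: "real^3" and kap :: "nat \<Rightarrow> real"
  assumes lam: "1 < lam"
    and l_pos: "\<And>k. 0 < l $ k"
    and v_pos: "\<And>k. 0 < v $ k"
    and M_v: "ar_matrix js *v v = lam *\<^sub>R v"
    and l_M: "\<And>x. l \<bullet> (ar_matrix js *v x) = lam * (l \<bullet> x)"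
    and l_v: "l \<bullet> v = 1"
    and letters: "\<And>k. k \<in> set js"
    and kap: "summable kap" "\<And>n x. l \<bullet> x = 0 \<Longrightarrow> norm (ar_matrix (list_power js n) *v x) \<le> kap n * norm x"
begin

section \<open>Projection to the contracting plane along the expanding line\<close>

abbreviation M :: "real^3 \<Rightarrow> real^3" where
  "M x \<equiv> ar_matrix js *v x"

abbreviation mpow :: "nat \<Rightarrow> real^3 \<Rightarrow> real^3" where
  "mpow n x \<equiv> ar_matrix (list_power js n) *v x"

definition proj :: "real^3 \<Rightarrow> real^3" where
  "proj x = x - (l \<bullet> x) *\<^sub>R v"

lemma linear_proj: "linear proj"
  by (intro linearI) (simp_all add: proj_def inner_add_right algebra_simps)

lemmas proj_simps = linear_add[OF linear_proj] linear_diff[OF linear_proj] linear_neg[OF linear_proj]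
  linear_0[OF linear_proj]

lemma continuous_proj: "continuous_on A proj"
  by (intro linear_continuous_on linear_conv_bounded_linear[THEN iffD1] linear_proj)

lemma l_proj [simp]: "l \<bullet> proj x = 0"
  by (simp add: proj_def inner_diff_right l_v)

lemma proj_ker: "l \<bullet> x = 0 \<Longrightarrow> proj x = x"
  by (simp add: proj_def)

lemma proj_decomp: "x = proj x + (l \<bullet> x) *\<^sub>R v"
  by (simp add: proj_def)

lemma proj_M: "proj (M x) = M (proj x)"
  by (simp add: proj_def l_M matrix_vector_mult_diff_distrib matrix_vector_mult_scaleR M_v mult.commute)

lemma mpow_0 [simp]: "mpow 0 x = x"
  by (simp add: ar_matrix_Nil)

lemma mpow_Suc: "mpow (Suc n) x = M (mpow n x)"
  by (simp add: ar_matrix_append flip: matrix_vector_mul_assoc)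

lemma mpow_Suc_right: "mpow (Suc n) x = mpow n (M x)"
  by (simp add: list_power_Suc_right ar_matrix_append del: list_power_simps flip: matrix_vector_mul_assoc)

lemma proj_mpow: "proj (mpow n x) = mpow n (proj x)"
  by (induction n) (simp_all only: mpow_Suc mpow_0 proj_M)

lemma continuous_M: "continuous_on A M"
  by (intro linear_continuous_on matrix_vector_mul_bounded_linear)

lemma kap_tendsto: "kap \<longlonglongrightarrow> 0"
  using kap(1) by (rule summable_LIMSEQ_zero)

lemma kap_nonneg: "0 \<le> kap n"
proof -
  define x :: "real^3" where "x = axis 1 1"
  have x: "proj x \<noteq> 0"
  proof
    assume "proj x = 0"
    then have "x = (l \<bullet> x) *\<^sub>R v" by (simp add: proj_def)
    then have "x $ 2 = ((l \<bullet> x) *\<^sub>R v) $ 2" by (rule arg_cong)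
    then show False using l_pos[of 1] v_pos[of 2] by (simp add: x_def) (simp add: axis_def)
  qed
  have "0 \<le> kap n * norm (proj x)"
    using kap(2)[of "proj x" n] norm_ge_zero order_trans by (metis l_proj)
  then show ?thesis using x by (simp add: zero_le_mult_iff)
qed

text \<open>A descendant of an edge at \<open>y\<close> starts at \<open>mpow n y + x\<close>. Seen
  from there, the image of \<open>y\<close> is at \<open>- x\<close>, so with this sign membership
  passes from parents to children.\<close>

definition rauzy_points :: "3 \<Rightarrow> (real^3) set" where
  "rauzy_points i = {- x | x n j. (x, i) \<in> edges 0 (arp (list_power js n) [j])}"

definition rauzy :: "3 \<Rightarrow> (real^3) set" where
  "rauzy i = closure (proj ` rauzy_points i)"

lemma zero_rauzy_points: "0 \<in> rauzy_points i"
proof -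
  obtain w where "arp (list_power js 0) [i] = i # w" using arp_hd by blast
  then have "(0, i) \<in> edges 0 (arp (list_power js 0) [i])" by simp
  then show ?thesis unfolding rauzy_points_def using minus_zero by fastforce
qed

lemma rauzy_points_gifs:
  "rauzy_points i = (\<Union>j. \<Union>p\<in>{p. (p, i) \<in> edges 0 (arp js [j])}. (\<lambda>y. M y - p) ` rauzy_points j)"
proof (intro set_eqI iffI)
  fix y assume "y \<in> rauzy_points i"
  then obtain x n k where x: "y = - x" "(x, i) \<in> edges 0 (arp (list_power js n) [k])"
    by (auto simp: rauzy_points_def)
  have *: "\<exists>j p x'. (p, i) \<in> edges 0 (arp js [j]) \<and> x' \<in> rauzy_points j \<and> y = M x' - p"
  proof (cases n)
    \<comment> \<open>The edge at the origin is its own child, because the image of \<open>i\<close>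
      begins with \<open>i\<close>.\<close>
    case 0
    then have "x = 0" "i = k" using x by (auto simp: arnoux_rauzy_product_simps)
    moreover have "(0, i) \<in> edges 0 (arp js [i])" using arp_hd[of js i] by auto
    moreover have "0 \<in> rauzy_points i" by (rule zero_rauzy_points)
    moreover have "y = M 0 - 0" using x \<open>x = 0\<close> by simp
    ultimately show ?thesis by blast
  next
    case (Suc m)
    then have "(x, i) \<in> edges 0 (arp js (arp (list_power js m) [k]))"
      using x by (simp add: arp_append_list)
    then obtain q j where qj: "(q, j) \<in> edges 0 (arp (list_power js m) [k])"
      "(x - M q, i) \<in> edges 0 (arp js [j])"
      using edges_arp_shift by blast
    have "- q \<in> rauzy_points j" using qj(1) by (auto simp: rauzy_points_def)
    moreover have "y = M (- q) - (x - M q)"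
      using x(1) matrix_vector_mult_diff_distrib[of "ar_matrix js" 0 q] by simp
    ultimately show ?thesis using qj(2) by blast
  qed
  then show "y \<in> (\<Union>j. \<Union>p\<in>{p. (p, i) \<in> edges 0 (arp js [j])}. (\<lambda>y. M y - p) ` rauzy_points j)"
    by blast
next
  fix y assume "y \<in> (\<Union>j. \<Union>p\<in>{p. (p, i) \<in> edges 0 (arp js [j])}. (\<lambda>y. M y - p) ` rauzy_points j)"
  then obtain j p x n k where *: "(p, i) \<in> edges 0 (arp js [j])" "y = M (- x) - p"
      "(x, j) \<in> edges 0 (arp (list_power js n) [k])"
    by (auto simp: rauzy_points_def)
  have "(p + M x, i) \<in> edges 0 (arp js (arp (list_power js n) [k]))"
    unfolding edges_arp_shift using * by (metis add_diff_cancel_right')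
  then have "(p + M x, i) \<in> edges 0 (arp (list_power js (Suc n)) [k])" by (simp add: arp_append_list)
  moreover have "y = - (p + M x)"
    using * matrix_vector_mult_diff_distrib[of "ar_matrix js" 0 x] by simp
  ultimately show "y \<in> rauzy_points i" unfolding rauzy_points_def by blast
qed

text \<open>Unfolding the innermost period first writes a projected prefix as a sum of terms
  \<open>mpow k (proj p)\<close>, where \<open>p\<close> runs over the finitely many prefixes within
  one period. The series of \<open>kap\<close> bounds the sum.\<close>

lemma bounded_rauzy_points: "bounded (proj ` rauzy_points i)"
proof -
  define F where "F = (\<Union>j. (\<lambda>e. norm (proj (fst e))) ` edges 0 (arp js [j]))"
  have fin: "finite F" by (auto simp: F_def)
  define B where "B = Max (insert 0 F)"
  have B0: "0 \<le> B" unfolding B_def using fin by (intro Max_ge) auto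
  have B: "norm (proj p) \<le> B" if "(p, i) \<in> edges 0 (arp js [j])" for p i j
  proof -
    have "norm (proj (fst (p, i))) \<in> F" using that unfolding F_def by blast
    then show ?thesis unfolding B_def using fin by (intro Max_ge) auto
  qed
  have "norm (proj x) \<le> (\<Sum>k<n. kap k) * B" if "(x, i) \<in> edges 0 (arp (list_power js n) [j])" for x n i j
    using that
  proof (induction n arbitrary: x i j)
    case 0
    then show ?case by (simp add: arnoux_rauzy_product_simps proj_simps)
  next
    case (Suc n)
    then have "(x, i) \<in> edges 0 (arp (list_power js n) (arp js [j]))"
      by (simp add: list_power_Suc_right arp_append_list del: list_power_simps)
    then obtain p k where pk: "(p, k) \<in> edges 0 (arp js [j])"
      "(x - mpow n p, i) \<in> edges 0 (arp (list_power js n) [k])"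
      using edges_arp_shift by blast
    have "norm (proj x) = norm (proj (x - mpow n p) + mpow n (proj p))"
      by (simp add: proj_simps proj_mpow)
    also have "\<dots> \<le> norm (proj (x - mpow n p)) + norm (mpow n (proj p))" by (rule norm_triangle_ineq)
    also have "norm (proj (x - mpow n p)) \<le> (\<Sum>k<n. kap k) * B" by (rule Suc.IH[OF pk(2)])
    also have "norm (mpow n (proj p)) \<le> kap n * B"
      using kap(2)[of "proj p" n] mult_left_mono[OF B[OF pk(1)] kap_nonneg[of n]] by simp
    finally show ?case by (simp add: distrib_right)
  qed
  moreover have "(\<Sum>k<n. kap k) * B \<le> suminf kap * B" for n
    using B0 kap by (intro mult_right_mono sum_le_suminf) (auto simp: kap_nonneg)
  ultimately have "norm (proj x) \<le> suminf kap * B" if "(x, i) \<in> edges 0 (arp (list_power js n) [j])" for x n i j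
    using that by (meson order_trans)
  then show ?thesis
    unfolding bounded_iff rauzy_points_def by (fastforce simp: proj_simps)
qed

lemma compact_rauzy: "compact (rauzy i)"
  unfolding rauzy_def compact_closure by (rule bounded_rauzy_points)

lemma rauzy_ker: "x \<in> rauzy i \<Longrightarrow> l \<bullet> x = 0"
proof -
  have "closed {x. l \<bullet> x = 0}" by (simp add: closed_hyperplane)
  then have "rauzy i \<subseteq> {x. l \<bullet> x = 0}"
    unfolding rauzy_def by (intro closure_minimal) auto
  then show "x \<in> rauzy i \<Longrightarrow> l \<bullet> x = 0" by blast
qed

lemma proj_rauzy: "x \<in> rauzy_points i \<Longrightarrow> proj x \<in> rauzy i"
  unfolding rauzy_def by (intro subsetD[OF closure_subset] imageI)

lemma zero_rauzy: "0 \<in> rauzy i"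
  using proj_rauzy[OF zero_rauzy_points] by (simp only: proj_simps)

lemma finite_parents: "finite {p. (p, i) \<in> edges 0 w}"
proof -
  have "{p. (p, i) \<in> edges 0 w} \<subseteq> fst ` edges 0 w" by force
  then show ?thesis by (rule finite_subset) simp
qed

lemma rauzy_gifs: "rauzy i = gifs proj js (\<lambda>j. M ` rauzy j) i"
proof -
  have "proj ` rauzy_points i =
      (\<Union>j. \<Union>p\<in>{p. (p, i) \<in> edges 0 (arp js [j])}. (\<lambda>y. M y - proj p) ` proj ` rauzy_points j)"
    by (subst rauzy_points_gifs) (auto simp: image_UN image_image proj_simps proj_M)
  then have "rauzy i = (\<Union>j. \<Union>p\<in>{p. (p, i) \<in> edges 0 (arp js [j])}.
      closure ((\<lambda>y. M y - proj p) ` proj ` rauzy_points j))"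
    unfolding rauzy_def by (simp add: closure_UN_finite finite_parents)
  also have "\<dots> = (\<Union>j. \<Union>p\<in>{p. (p, i) \<in> edges 0 (arp js [j])}. (\<lambda>y. M y - proj p) ` rauzy j)"
    unfolding rauzy_def
    by (simp add: closure_image_bounded[OF bounded_rauzy_points] continuous_on_diff continuous_M)
  finally show ?thesis unfolding gifs_def by (simp add: image_image)
qed

text \<open>A letter fixed by the period would have a fixed basis vector, whose positive height
  would be multiplied by \<open>lam > 1\<close>.\<close>

lemma arp_js_length: obtains k w where "arp js [j] = j # k # w"
proof -
  obtain u where u: "arp js [j] = j # u" using arp_hd by blast
  have "u \<noteq> []"
  proof
    assume "u = []"
    then have "M (axis j 1) = axis j 1" using abel_arp[of js "[j]"] u by simp
    then have "lam * l $ j = l $ j" using l_M[of "axis j 1"] by simp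
    then show False using lam l_pos[of j] by simp
  qed
  then show ?thesis using u that by (cases u) auto
qed

text \<open>Subtracting \<open>axis i 1\<close> from \<open>- x\<close> passes from the prefix
  before an occurrence of \<open>i\<close> to the prefix after it. Inside a word this matches all
  prefixes; only the empty prefix and the whole word need an argument.\<close>

lemma rauzy_exchange: "(\<Union>i. rauzy i) = (\<Union>i. (\<lambda>y. y - proj (axis i 1)) ` rauzy i)"
proof
  let ?R = "\<Union>i. (\<lambda>y. y - proj (axis i 1)) ` rauzy i"
  have "compact ((\<lambda>y. y - proj (axis i 1)) ` rauzy i)" for i
    by (intro compact_continuous_image compact_rauzy continuous_intros)
  then have cR: "closed ?R" by (intro closed_UN finite ballI compact_imp_closed)
  have last: "proj (- abel p) \<in> ?R" if "arp (list_power js n) [j] = p @ s" "p \<noteq> []" for p s n j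
  proof -
    obtain p' k where p: "p = p' @ [k]" using \<open>p \<noteq> []\<close> by (metis append_butlast_last_id)
    have "(abel p', k) \<in> edges 0 (arp (list_power js n) [j])" unfolding edges_iff using that p by auto
    then have "- abel p' \<in> rauzy_points k" by (auto simp: rauzy_points_def)
    then have "proj (- abel p') \<in> rauzy k" by (rule proj_rauzy)
    then have "proj (- abel p') - proj (axis k 1) \<in> ?R" by blast
    then show ?thesis by (simp add: p proj_simps)
  qed
  \<comment> \<open>The empty prefix has no predecessor. Instead, 0 is the limit of the points of
    whole words, whose projections are contracted.\<close>
  have zero: "0 \<in> ?R"
  proof (rule closed_sequentially[OF cR])
    show "proj (- abel (arp (list_power js n) [1])) \<in> ?R" for n
      by (rule last[of n 1 _ "[]"]) (use arp_hd[of "list_power js n" 1] in auto)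
    have "norm (proj (- abel (arp (list_power js n) [1]))) \<le> kap n * norm (proj (axis 1 1))" for n
      using kap(2)[of "proj (axis 1 1)" n] by (simp add: abel_arp proj_simps proj_mpow)
    moreover have "(\<lambda>n. kap n * norm (proj (axis 1 1))) \<longlonglongrightarrow> 0"
      using kap_tendsto by (rule tendsto_mult_left_zero)
    ultimately show "(\<lambda>n. proj (- abel (arp (list_power js n) [1]))) \<longlonglongrightarrow> 0"
      by (rule Lim_null_comparison[OF always_eventually[OF allI]])
  qed
  have "proj ` rauzy_points i \<subseteq> ?R" for i
  proof
    fix y assume "y \<in> proj ` rauzy_points i"
    then obtain x n j where x: "y = proj (- x)" "(x, i) \<in> edges 0 (arp (list_power js n) [j])"
      by (auto simp: rauzy_points_def)
    then obtain p s where p: "arp (list_power js n) [j] = p @ i # s" "x = abel p"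
      unfolding edges_iff by auto
    show "y \<in> ?R"
    proof (cases "p = []")
      case True
      then have "y = 0" using x(1) p(2) by (simp add: proj_simps)
      then show ?thesis using zero by (simp only:)
    next
      case False
      then have "proj (- abel p) \<in> ?R" by (rule last[OF p(1)])
      then show ?thesis by (simp only: x(1) p(2))
    qed
  qed
  then have "rauzy i \<subseteq> ?R" for i
    unfolding rauzy_def[of i] by (intro closure_minimal cR)
  then show "(\<Union>i. rauzy i) \<subseteq> ?R" by blast
next
  let ?L = "\<Union>i. rauzy i"
  have cL: "closed ?L" by (intro closed_UN finite ballI compact_imp_closed compact_rauzy)
  have mem: "proj (- abel p) \<in> ?L" if "arp (list_power js n) [j] = p @ k # s" for p k s n j
  proof -
    have "(abel p, k) \<in> edges 0 (arp (list_power js n) [j])" unfolding edges_iff using that by auto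
    then have "- abel p \<in> rauzy_points k" by (auto simp: rauzy_points_def)
    then show ?thesis using proj_rauzy by blast
  qed
  have "(\<lambda>y. y - proj (axis i 1)) ` rauzy i \<subseteq> ?L" for i
  proof -
    have "(\<lambda>y. y - proj (axis i 1)) ` proj ` rauzy_points i \<subseteq> ?L"
    proof
      fix y assume "y \<in> (\<lambda>y. y - proj (axis i 1)) ` proj ` rauzy_points i"
      then obtain x n j where x: "y = proj (- x) - proj (axis i 1)"
        "(x, i) \<in> edges 0 (arp (list_power js n) [j])"
        by (auto simp: rauzy_points_def)
      then obtain p s where p: "arp (list_power js n) [j] = p @ i # s" "x = abel p"
        unfolding edges_iff by auto
      have y: "y = proj (- abel (p @ [i]))" using x p by (simp add: proj_simps)
      show "y \<in> ?L"
      proof (cases s)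
        \<comment> \<open>The prefix is the whole word. Since the image of \<open>j\<close> begins
          with \<open>j\<close> and \<open>k\<close>, the word of the next level continues it with a
          word beginning with \<open>k\<close>.\<close>
        case Nil
        obtain k w where kw: "arp js [j] = j # k # w" by (rule arp_js_length)
        obtain w' where w': "arp (list_power js n) [k] = k # w'" using arp_hd by blast
        have "arp (list_power js (Suc n)) [j] = arp (list_power js n) [j] @ arp (list_power js n) [k] @ arp (list_power js n) w"
          by (simp add: list_power_Suc_right arp_append_list kw arp_Cons[of _ j "k # w"] arp_Cons[of _ k w] del: list_power_simps)
        then have "arp (list_power js (Suc n)) [j] = (p @ [i]) @ k # (w' @ arp (list_power js n) w)"
          by (simp add: w' p Nil del: list_power_simps)
        then show ?thesis unfolding y by (rule mem)
      next
        case (Cons k s')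
        then have "arp (list_power js n) [j] = (p @ [i]) @ k # s'" using p by simp
        then show ?thesis unfolding y by (rule mem)
      qed
    qed
    then have "closure ((\<lambda>y. y - proj (axis i 1)) ` proj ` rauzy_points i) \<subseteq> ?L"
      by (intro closure_minimal cL)
    then show ?thesis
      unfolding closure_image_bounded[OF bounded_rauzy_points continuous_on_diff[OF continuous_on_id continuous_on_const]]
      by (simp add: rauzy_def)
  qed
  then show "(\<Union>i. (\<lambda>y. y - proj (axis i 1)) ` rauzy i) \<subseteq> ?L" by blast
qed

lemma connected_rauzy: "connected (rauzy i)"
proof (rule compact_chained_imp_connected[OF compact_rauzy])
  fix d :: real assume d: "0 < d"
  have step: "\<forall>i. chained d (mpow n ` rauzy i)" if "\<forall>j. chained d (mpow (Suc n) ` rauzy j)" for n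
  proof -
    \<comment> \<open>\<open>mpow n\<close> applied to the set equation builds the pieces of level
      \<open>n\<close> from those of level \<open>Suc n\<close>, with translations
      \<open>mpow n (proj p)\<close>. The exchange at level \<open>Suc n\<close> is the image of
      \<open>rauzy_exchange\<close>.\<close>
    let ?D = "\<lambda>x. mpow n (proj x)"
    have lin: "linear ?D"
      using linear_compose[OF linear_proj matrix_vector_mul_linear[of "ar_matrix (list_power js n)"]]
      by (simp add: o_def)
    have g: "gifs ?D js (\<lambda>j. mpow (Suc n) ` rauzy j) i = mpow n ` rauzy i" for i
      by (subst (2) rauzy_gifs) (auto simp: gifs_def image_UN image_image mpow_Suc_right matrix_vector_mult_diff_distrib simp del: list_power_simps)
    have e: "(\<Union>j. mpow (Suc n) ` rauzy j) = (\<Union>j. (\<lambda>y. y - mpow n (proj (M (axis j 1)))) ` mpow (Suc n) ` rauzy j)"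
    proof -
      have "(\<Union>j. mpow (Suc n) ` rauzy j) = mpow (Suc n) ` (\<Union>j. rauzy j)" by blast
      also have "\<dots> = (\<Union>j. (\<lambda>y. y - mpow n (proj (M (axis j 1)))) ` mpow (Suc n) ` rauzy j)"
        unfolding rauzy_exchange
        by (simp add: image_UN image_image matrix_vector_mult_diff_distrib proj_M mpow_Suc_right del: list_power_simps)
      finally show ?thesis .
    qed
    have "(\<forall>i. 0 \<in> gifs ?D js (\<lambda>j. mpow (Suc n) ` rauzy j) i \<and> chained d (gifs ?D js (\<lambda>j. mpow (Suc n) ` rauzy j) i)) \<and>
      (\<Union>i. gifs ?D js (\<lambda>j. mpow (Suc n) ` rauzy j) i) =
        (\<Union>i. (\<lambda>y. y - ?D (axis i 1)) ` gifs ?D js (\<lambda>j. mpow (Suc n) ` rauzy j) i)"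
    proof (rule gifs_exchange[OF lin _ _ e])
      show "0 \<in> mpow (Suc n) ` rauzy j" for j
        using zero_rauzy[of j] by (metis imageI matrix_vector_mult_0_right)
    qed (use that in blast)
    then show ?thesis unfolding g by blast
  qed
  have down: "\<forall>i. chained d (rauzy i)" if "\<forall>i. chained d (mpow n ` rauzy i)" for n
    using that
  proof (induction n)
    case (Suc n)
    then show ?case using step by blast
  qed (simp add: ar_matrix_Nil)
  obtain B where B: "0 < B" "\<And>i x. x \<in> rauzy i \<Longrightarrow> norm x \<le> B"
  proof -
    have "bounded (\<Union>i. rauzy i)" by (intro bounded_UN finite) (auto intro: compact_imp_bounded compact_rauzy)
    then show ?thesis using that unfolding bounded_pos by blast
  qed
  have "(\<lambda>n. kap n * (2 * B)) \<longlonglongrightarrow> 0" using kap_tendsto by (rule tendsto_mult_left_zero)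
  then obtain n where n: "kap n * (2 * B) < d"
    using d by (metis (no_types, lifting) eventually_sequentially order_tendstoD(2) order_refl)
  have "chained d (mpow n ` rauzy i)" for i
  proof -
    have "dist (mpow n x) (mpow n y) \<le> d" if "x \<in> rauzy i" "y \<in> rauzy i" for x y
    proof -
      have "dist (mpow n x) (mpow n y) = norm (mpow n (x - y))"
        by (simp add: dist_norm matrix_vector_mult_diff_distrib)
      also have "\<dots> \<le> kap n * norm (x - y)"
        using that rauzy_ker by (intro kap) (simp add: inner_diff_right)
      also have "\<dots> \<le> kap n * (2 * B)"
        using norm_triangle_ineq4[of x y] B(2)[OF that(1)] B(2)[OF that(2)]
        by (intro mult_left_mono kap_nonneg) simp
      finally show ?thesis using n by simp
    qed
    then show ?thesis unfolding chained_def by blast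
  qed
  then show "chained d (rauzy i)" using down by blast
qed

end


section \<open>Overlaps of tiles are negligible\<close>

lemma negligible_linear_image_same_dim:
  fixes f :: "'a::euclidean_space \<Rightarrow> 'a"
  assumes "linear f" "negligible S"
  shows "negligible (f ` S)"
  using assms by (intro negligible_differentiable_image_negligible) (auto intro: linear_imp_differentiable_on)

lemma det_rank_one:
  fixes l v :: "real^3"
  shows "det (matrix (\<lambda>x. x + (c * (l \<bullet> x)) *\<^sub>R v)) = 1 + c * (l \<bullet> v)"
proof -
  have "matrix (\<lambda>x. x + (c * (l \<bullet> x)) *\<^sub>R v) $ i $ j = (if i = j then 1 else 0) + c * l $ j * v $ i" for i j
    by (simp add: matrix_def axis_def[of j] inner_axis_one[unfolded axis_def])
  then show ?thesis
    by (simp add: det_3 inner_vec_def sum_3 algebra_simps)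
qed

text \<open>The positive functional \<open>l\<close> increases strictly along the path, so different
  occurrences of a letter start at different vertices.\<close>

lemma card_edges:
  fixes l :: "real^3"
  assumes "\<And>k. 0 < l $ k"
  shows "card {p. (p, i) \<in> edges z w} = count_list w i"
proof (induction w arbitrary: z)
  case (Cons a w)
  have fin: "finite {p. (p, i) \<in> edges (z + axis a 1) w}"
    by (rule finite_subset[of _ "fst ` edges (z + axis a 1) w"]) force+
  have "(z, i) \<notin> edges (z + axis a 1) w"
  proof
    assume "(z, i) \<in> edges (z + axis a 1) w"
    then have "l \<bullet> (z + axis a 1) \<le> l \<bullet> z"
      by (rule edges_height_ge) (simp add: assms less_imp_le)
    then show False using assms[of a] by (simp add: inner_add_right)
  qed
  moreover have "{p. (p, i) \<in> edges z (a # w)} =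
      (if i = a then insert z {p. (p, i) \<in> edges (z + axis a 1) w} else {p. (p, i) \<in> edges (z + axis a 1) w})"
    by auto
  ultimately show ?case using Cons fin by auto
qed simp

context ar_pisot
begin

text \<open>Thickening a subset of the plane to height 1 lets three-dimensional Lebesgue measure
  play the role of area in the plane.\<close>

definition slab :: "(real^3) set \<Rightarrow> (real^3) set" where
  "slab A = {x. proj x \<in> A \<and> 0 \<le> l \<bullet> x \<and> l \<bullet> x \<le> 1}"

lemma slab_image:
  assumes "\<And>a. a \<in> A \<Longrightarrow> l \<bullet> a = 0"
  shows "slab A = (\<lambda>(a, s). a + s *\<^sub>R v) ` (A \<times> {0..1})"
proof (intro set_eqI iffI)
  fix x assume "x \<in> slab A"
  then have "(proj x, l \<bullet> x) \<in> A \<times> {0..1}" "x = (\<lambda>(a, s). a + s *\<^sub>R v) (proj x, l \<bullet> x)"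
    using proj_decomp[of x] by (auto simp: slab_def)
  then show "x \<in> (\<lambda>(a, s). a + s *\<^sub>R v) ` (A \<times> {0..1})" by blast
next
  fix x assume "x \<in> (\<lambda>(a, s). a + s *\<^sub>R v) ` (A \<times> {0..1})"
  then obtain a s where "a \<in> A" "0 \<le> s" "s \<le> 1" "x = a + s *\<^sub>R v" by auto
  then show "x \<in> slab A"
    using assms by (simp add: slab_def proj_def inner_add_right l_v)
qed

lemma compact_slab:
  assumes "compact A" "\<And>a. a \<in> A \<Longrightarrow> l \<bullet> a = 0"
  shows "compact (slab A)"
proof -
  have "compact ((\<lambda>(a, s). a + s *\<^sub>R v) ` (A \<times> {0..1}))"
    unfolding split_beta
    by (intro compact_continuous_image compact_Times assms(1) compact_Icc continuous_intros)
  then show ?thesis by (simp only: slab_image[OF assms(2)])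
qed

lemma slab_translation:
  assumes "l \<bullet> c = 0"
  shows "slab ((\<lambda>a. a - c) ` A) = (+) (- c) ` slab A"
proof (intro set_eqI iffI)
  fix x assume "x \<in> slab ((\<lambda>a. a - c) ` A)"
  then have "x + c \<in> slab A"
    using assms by (auto simp: slab_def proj_simps proj_ker inner_add_right)
  moreover have "x = - c + (x + c)" by simp
  ultimately show "x \<in> (+) (- c) ` slab A" by blast
next
  fix x assume "x \<in> (+) (- c) ` slab A"
  then obtain y where y: "y \<in> slab A" "x = y - c" by auto
  then have "proj x = proj y - c" using assms by (simp add: proj_simps proj_ker)
  then show "x \<in> slab ((\<lambda>a. a - c) ` A)"
    using y assms by (simp add: slab_def inner_diff_right)
qed

text \<open>The linear map in the proof contracts the line spanned by \<open>v\<close> by \<open>lam\<close> before applying \<open>M\<close>, so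
  that it agrees with \<open>M\<close> on the plane and preserves heights.\<close>

lemma measure_slab_M:
  assumes "compact A" "\<And>a. a \<in> A \<Longrightarrow> l \<bullet> a = 0"
  shows "measure lebesgue (slab (M ` A)) = measure lebesgue (slab A) / lam"
proof -
  define c where "c = 1 / lam - 1"
  define L where "L = (\<lambda>x. M (x + (c * (l \<bullet> x)) *\<^sub>R v))"
  have lin1: "linear (\<lambda>x. x + (c * (l \<bullet> x)) *\<^sub>R v)"
    by (intro linearI) (simp_all add: inner_add_right algebra_simps)
  have linL: "linear L"
    using linear_compose[OF lin1 matrix_vector_mul_linear[of "ar_matrix js"]] by (simp add: L_def o_def)
  have "matrix L = ar_matrix js ** matrix (\<lambda>x. x + (c * (l \<bullet> x)) *\<^sub>R v)"
    using matrix_compose[OF lin1 matrix_vector_mul_linear[of "ar_matrix js"]] by (simp add: L_def o_def)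
  then have det: "det (matrix L) = 1 / lam"
    by (simp add: det_mul det_ar_matrix det_rank_one l_v c_def)
  have L: "L x = M (proj x) + (l \<bullet> x) *\<^sub>R v" for x
  proof -
    have "x + (c * (l \<bullet> x)) *\<^sub>R v = proj x + ((l \<bullet> x) / lam) *\<^sub>R v"
      by (simp add: proj_def c_def algebra_simps)
    then show ?thesis using lam unfolding L_def
      by (simp add: matrix_vector_right_distrib matrix_vector_mult_scaleR M_v)
  qed
  have "slab (M ` A) = L ` slab A"
  proof (intro set_eqI iffI)
    fix x assume "x \<in> slab (M ` A)"
    then obtain a where a: "a \<in> A" "proj x = M a" "0 \<le> l \<bullet> x" "l \<bullet> x \<le> 1" by (auto simp: slab_def)
    let ?y = "a + (l \<bullet> x) *\<^sub>R v"
    have la: "l \<bullet> a = 0" using a assms by blast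
    have ly: "l \<bullet> ?y = l \<bullet> x" by (simp add: inner_add_right l_v la)
    have py: "proj ?y = a" unfolding proj_def ly by simp
    have "?y \<in> slab A" using a ly py by (simp add: slab_def)
    moreover have "x = L ?y" using proj_decomp[of x] by (simp only: L ly py a(2))
    ultimately show "x \<in> L ` slab A" by blast
  next
    fix x assume "x \<in> L ` slab A"
    then obtain y where y: "proj y \<in> A" "0 \<le> l \<bullet> y" "l \<bullet> y \<le> 1" "x = M (proj y) + (l \<bullet> y) *\<^sub>R v"
      by (auto simp: slab_def L)
    then have lx: "l \<bullet> x = l \<bullet> y" by (simp add: inner_add_right l_M l_v)
    have "proj x = x - (l \<bullet> y) *\<^sub>R v" by (simp only: proj_def lx)
    then have "proj x = M (proj y)" by (simp only: y(4) add_diff_cancel_right')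
    then show "x \<in> slab (M ` A)" using y lx by (simp add: slab_def)
  qed
  moreover have "slab A \<in> lmeasurable" by (intro lmeasurable_compact compact_slab assms)
  ultimately show ?thesis
    using measure_linear_image[OF linL] det lam by simp
qed

definition piece :: "3 \<times> (real^3) \<Rightarrow> (real^3) set" where
  "piece e = (\<lambda>a. a - proj (snd e)) ` M ` rauzy (fst e)"

definition pieces :: "3 \<Rightarrow> (3 \<times> (real^3)) set" where
  "pieces i = {(j, p). (p, i) \<in> edges 0 (arp js [j])}"

lemma pieces_Sigma: "pieces i = (SIGMA j:UNIV. {p. (p, i) \<in> edges 0 (arp js [j])})"
  by (auto simp: pieces_def)

lemma finite_pieces: "finite (pieces i)"
  unfolding pieces_Sigma by (intro finite_SigmaI finite finite_parents)

lemma rauzy_pieces: "rauzy i = (\<Union>e\<in>pieces i. piece e)"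
proof (intro set_eqI iffI)
  fix y assume "y \<in> rauzy i"
  then obtain j p t where *: "(p, i) \<in> edges 0 (arp js [j])" "t \<in> M ` rauzy j" "y = t - proj p"
    unfolding rauzy_gifs[of i] mem_gifs by blast
  then have "(j, p) \<in> pieces i" "y \<in> piece (j, p)" by (auto simp: pieces_def piece_def)
  then show "y \<in> (\<Union>e\<in>pieces i. piece e)" by blast
next
  fix y assume "y \<in> (\<Union>e\<in>pieces i. piece e)"
  then obtain j p t where *: "(p, i) \<in> edges 0 (arp js [j])" "t \<in> M ` rauzy j" "y = t - proj p"
    by (auto simp: pieces_def piece_def)
  then show "y \<in> rauzy i" unfolding rauzy_gifs[of i] mem_gifs by blast
qed

lemma piece_ker: "a \<in> piece e \<Longrightarrow> l \<bullet> a = 0"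
  by (auto simp: piece_def inner_diff_right l_M rauzy_ker)

lemma compact_piece: "compact (piece e)"
proof -
  have "compact (M ` rauzy (fst e))"
    by (intro compact_continuous_image compact_rauzy continuous_M)
  then show ?thesis unfolding piece_def
    by (rule compact_continuous_image[rotated]) (intro continuous_intros)
qed

lemma slab_piece_lmeasurable: "slab (piece e) \<in> lmeasurable"
  by (intro lmeasurable_compact compact_slab compact_piece piece_ker)

lemma measure_slab_piece: "measure lebesgue (slab (piece e)) = measure lebesgue (slab (rauzy (fst e))) / lam"
proof -
  have "slab (piece e) = (+) (- proj (snd e)) ` slab (M ` rauzy (fst e))"
    unfolding piece_def by (rule slab_translation) simp
  then show ?thesis
    using measure_slab_M[OF compact_rauzy rauzy_ker, of "fst e"] by (simp only: measure_translation)
qed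

text \<open>Subadditivity bounds the volumes \<open>w\<close> by their image under the matrix
  divided by \<open>lam\<close>. Paired with the left eigenvector \<open>l\<close>, the nonnegative
  deficits sum to 0, and \<open>l\<close> is positive, so each deficit vanishes.\<close>

lemma measure_slab_rauzy: "measure lebesgue (slab (rauzy i)) = (\<Sum>e\<in>pieces i. measure lebesgue (slab (piece e)))"
proof -
  define w where "w = (\<lambda>i. measure lebesgue (slab (rauzy i)))"
  have slab_UN: "slab (rauzy i) = (\<Union>e\<in>pieces i. slab (piece e))" for i
    by (subst rauzy_pieces) (auto simp: slab_def)
  have le: "w i \<le> (\<Sum>e\<in>pieces i. measure lebesgue (slab (piece e)))" for i
    unfolding w_def slab_UN
    by (intro measure_UNION_le finite_pieces fmeasurableD slab_piece_lmeasurable)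
  have eq: "(\<Sum>e\<in>pieces i. measure lebesgue (slab (piece e))) = (ar_matrix js *v (\<chi> j. w j)) $ i / lam" for i
  proof -
    have "(\<Sum>e\<in>pieces i. measure lebesgue (slab (piece e))) = (\<Sum>e\<in>pieces i. w (fst e) / lam)"
      by (simp only: measure_slab_piece w_def)
    also have "\<dots> = (\<Sum>j\<in>UNIV. \<Sum>p\<in>{p. (p, i) \<in> edges 0 (arp js [j])}. w j / lam)"
      unfolding pieces_Sigma by (subst sum.Sigma) (auto simp: finite_parents split_beta)
    also have "\<dots> = (\<Sum>j\<in>UNIV. real (count_list (arp js [j]) i) * (w j / lam))"
      by (simp add: card_edges[OF l_pos])
    also have "\<dots> = (ar_matrix js *v (\<chi> j. w j)) $ i / lam"
      by (simp add: matrix_vector_mult_def incidence_matrix_def sum_divide_distrib)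
    finally show ?thesis .
  qed
  define d where "d = (\<lambda>i. (ar_matrix js *v (\<chi> j. w j)) $ i / lam - w i)"
  have d0: "0 \<le> d i" for i using le[of i] eq[of i] by (simp add: d_def)
  have "(\<Sum>i\<in>UNIV. l $ i * d i) = (l \<bullet> M (\<chi> j. w j)) / lam - l \<bullet> (\<chi> j. w j)"
    by (simp add: d_def inner_vec_def sum_subtractf right_diff_distrib sum_divide_distrib)
  also have "\<dots> = 0" using lam by (simp add: l_M)
  finally have "\<forall>i\<in>UNIV. l $ i * d i = 0"
    by (subst sum_nonneg_eq_0_iff[symmetric]) (auto simp: d0 l_pos less_imp_le)
  then have "d i = 0" using l_pos[of i] by (metis UNIV_I less_irrefl mult_eq_0_iff)
  then show ?thesis unfolding eq by (simp add: d_def w_def)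
qed

definition cyl :: "(real^3) set \<Rightarrow> (real^3) set" where
  "cyl A = {x. proj x \<in> A}"

text \<open>As \<open>l \<bullet> v = 1\<close>, the translates of the slab by integer multiples of
  \<open>v\<close> cover the cylinder.\<close>

lemma negligible_cyl:
  assumes "negligible (slab A)"
  shows "negligible (cyl A)"
proof -
  have "cyl A \<subseteq> (\<Union>k::int. (+) (of_int k *\<^sub>R v) ` slab A)"
  proof
    fix x assume x: "x \<in> cyl A"
    let ?y = "x - of_int \<lfloor>l \<bullet> x\<rfloor> *\<^sub>R v"
    have ly: "l \<bullet> ?y = l \<bullet> x - of_int \<lfloor>l \<bullet> x\<rfloor>" by (simp add: inner_diff_right l_v)
    have "proj ?y = proj x" unfolding proj_def ly by (simp add: algebra_simps)
    moreover have "0 \<le> l \<bullet> ?y" "l \<bullet> ?y \<le> 1" unfolding ly by linarith+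
    ultimately have "?y \<in> slab A"
      unfolding slab_def mem_Collect_eq using x by (simp only: cyl_def mem_Collect_eq)
    moreover have "x = of_int \<lfloor>l \<bullet> x\<rfloor> *\<^sub>R v + ?y" by simp
    ultimately show "x \<in> (\<Union>k::int. (+) (of_int k *\<^sub>R v) ` slab A)" by blast
  qed
  moreover have "negligible (\<Union>k::int. (+) (of_int k *\<^sub>R v) ` slab A)"
    unfolding negligible_iff_null_sets
    by (intro null_sets_UN') (use negligible_translation[OF assms] in \<open>auto simp: negligible_iff_null_sets\<close>)
  ultimately show ?thesis by (rule negligible_subset[rotated])
qed

text \<open>An overlap of positive volume would be counted twice and make the subadditivity strict,
  against \<open>measure_slab_rauzy\<close>.\<close>

lemma negligible_cyl_pieces:
  assumes "e \<in> pieces i" "e' \<in> pieces i" "e \<noteq> e'"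
  shows "negligible (cyl (piece e \<inter> piece e'))"
proof (rule negligible_cyl)
  let ?m = "\<lambda>e. measure lebesgue (slab (piece e))"
  let ?R = "pieces i - {e, e'}"
  let ?r = "\<Union>f\<in>?R. slab (piece f)"
  have UN: "slab (rauzy i) = (slab (piece e) \<union> slab (piece e')) \<union> ?r"
    using assms by (subst rauzy_pieces) (auto simp: slab_def)
  have r: "?r \<in> lmeasurable"
    by (intro fmeasurable.finite_UN finite_Diff finite_pieces slab_piece_lmeasurable)
  have s: "slab (piece e \<inter> piece e') = slab (piece e) \<inter> slab (piece e')"
    by (auto simp: slab_def)
  have lm: "slab (piece e) \<inter> slab (piece e') \<in> lmeasurable"
    by (intro fmeasurable_Int_fmeasurable slab_piece_lmeasurable fmeasurableD)
  have "measure lebesgue (slab (rauzy i)) \<le> measure lebesgue (slab (piece e) \<union> slab (piece e')) + measure lebesgue ?r"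
    unfolding UN by (intro measure_Un_le_lebesgue fmeasurable.Un slab_piece_lmeasurable r)
  also have "measure lebesgue ?r \<le> (\<Sum>f\<in>?R. ?m f)"
    by (intro measure_UNION_le finite_Diff finite_pieces fmeasurableD slab_piece_lmeasurable)
  also have "measure lebesgue (slab (piece e) \<union> slab (piece e')) =
      ?m e + ?m e' - measure lebesgue (slab (piece e) \<inter> slab (piece e'))"
    by (intro measure_Un3 slab_piece_lmeasurable)
  finally have "measure lebesgue (slab (rauzy i)) + measure lebesgue (slab (piece e) \<inter> slab (piece e'))
      \<le> ?m e + ?m e' + (\<Sum>f\<in>?R. ?m f)" by simp
  also have "\<dots> = (\<Sum>f\<in>pieces i. ?m f)"
  proof -
    have "pieces i = insert e (insert e' ?R)" using assms by blast
    then have "(\<Sum>f\<in>pieces i. ?m f) = (\<Sum>f\<in>insert e (insert e' ?R). ?m f)" by simp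
    also have "\<dots> = ?m e + (?m e' + (\<Sum>f\<in>?R. ?m f))"
      using assms finite_pieces[of i] by (subst sum.insert; auto)+
    finally show ?thesis by simp
  qed
  finally have "measure lebesgue (slab (piece e) \<inter> slab (piece e')) \<le> 0"
    by (simp add: measure_slab_rauzy)
  then show "negligible (slab (piece e \<inter> piece e'))"
    unfolding s negligible_iff_measure0[OF lm] by (simp add: order_antisym)
qed

lemma negligible_M:
  assumes "negligible (M ` S)"
  shows "negligible S"
proof -
  have "invertible (ar_matrix js)" by (simp add: invertible_det_nz det_ar_matrix)
  then obtain N where N: "N ** ar_matrix js = mat 1" unfolding invertible_def by blast
  have "S = (\<lambda>x. N *v x) ` M ` S"
    by (simp add: image_image matrix_vector_mul_assoc N)
  also have "negligible \<dots>"
    by (intro negligible_linear_image_same_dim assms matrix_vector_mul_linear)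
  finally show ?thesis .
qed

text \<open>Heights are dropped so that the image of a point lies over every child of the edge, not
  only over the child at its own height. A common descendant then controls all points of the two
  tiles.\<close>

definition tile_cyl :: "real^3 \<Rightarrow> 3 \<Rightarrow> (real^3) set" where
  "tile_cyl y j = {x. proj (x - y) \<in> rauzy j}"

lemma tile_cyl_child:
  assumes "x \<in> tile_cyl y j" "(z, i) \<in> edges (M y) (arp js [j])"
  shows "M x - z \<in> cyl (piece (j, z - M y))" "(j, z - M y) \<in> pieces i"
proof -
  have "proj (M x - z) = M (proj (x - y)) - proj (z - M y)"
    by (simp add: proj_simps proj_M matrix_vector_mult_diff_distrib)
  then show "M x - z \<in> cyl (piece (j, z - M y))"
    using assms(1) by (auto simp: cyl_def piece_def tile_cyl_def)
  show "(j, z - M y) \<in> pieces i"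
    using assms(2) edges_shift[of z i 0 "M y"] by (simp add: pieces_def)
qed

lemma tile_cyl_M:
  assumes "x \<in> tile_cyl y j" "(z, i) \<in> edges (M y) (arp js [j])"
  shows "M x \<in> tile_cyl z i"
  using tile_cyl_child[OF assms] rauzy_pieces[of i] by (auto simp: cyl_def tile_cyl_def)

text \<open>\<open>M\<close> maps the intersection into a translate of the cylinder over two pieces
  of the same fractal. They have different indices because \<open>M\<close> is injective.\<close>

lemma negligible_tile_cyl_common_child:
  assumes "(z, i) \<in> edges (M y) (arp js [j])" "(z, i) \<in> edges (M y') (arp js [j'])" "(y, j) \<noteq> (y', j')"
  shows "negligible (tile_cyl y j \<inter> tile_cyl y' j')"
proof (cases "tile_cyl y j \<inter> tile_cyl y' j' = {}")
  case False
  then obtain x where x: "x \<in> tile_cyl y j" "x \<in> tile_cyl y' j'" by blast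
  have "M y \<noteq> M y'" if "j = j'"
  proof
    assume "M y = M y'"
    moreover have "invertible (ar_matrix js)" by (simp add: invertible_det_nz det_ar_matrix)
    ultimately have "y = y'"
      by (metis inj_matrix_vector_mult injD)
    then show False using that assms(3) by simp
  qed
  then have ne: "(j, z - M y) \<noteq> (j', z - M y')" by auto
  have sub: "M ` (tile_cyl y j \<inter> tile_cyl y' j') \<subseteq> (+) z ` cyl (piece (j, z - M y) \<inter> piece (j', z - M y'))"
  proof
    fix u assume "u \<in> M ` (tile_cyl y j \<inter> tile_cyl y' j')"
    then obtain x where x: "x \<in> tile_cyl y j" "x \<in> tile_cyl y' j'" "u = M x" by blast
    have "M x - z \<in> cyl (piece (j, z - M y) \<inter> piece (j', z - M y'))"
      using tile_cyl_child(1)[OF x(1) assms(1)] tile_cyl_child(1)[OF x(2) assms(2)] by (simp add: cyl_def)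
    moreover have "u = z + (M x - z)" using x by simp
    ultimately show "u \<in> (+) z ` cyl (piece (j, z - M y) \<inter> piece (j', z - M y'))" by blast
  qed
  have n: "negligible ((+) z ` cyl (piece (j, z - M y) \<inter> piece (j', z - M y')))"
    using tile_cyl_child(2)[OF x(1) assms(1)] tile_cyl_child(2)[OF x(2) assms(2)] ne
    by (intro negligible_translation negligible_cyl_pieces)
  show ?thesis by (rule negligible_M[OF negligible_subset[OF n sub]])
qed simp

text \<open>Follow the two lineages until they merge. Before that, \<open>M\<close> carries the
  intersection into the intersection of the next two cylinders.\<close>

lemma negligible_tile_cyl_common_descendant:
  assumes "e \<in> edges (mpow n y) (arp (list_power js n) [j])" "e \<in> edges (mpow n y') (arp (list_power js n) [j'])"
    "(y, j) \<noteq> (y', j')"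
  shows "negligible (tile_cyl y j \<inter> tile_cyl y' j')"
  using assms
proof (induction n arbitrary: y j y' j')
  case 0
  have "edges (mpow 0 y) (arp (list_power js 0) [j]) = {(y, j)}" for y j
    by (simp only: mpow_0) (simp add: arnoux_rauzy_product_simps)
  then show ?case using 0 by simp
next
  case (Suc n)
  have split: "edges (mpow (Suc n) y) (arp (list_power js (Suc n)) [j]) =
      (\<Union>(x, i)\<in>edges (M y) (arp js [j]). edges (mpow n x) (arp (list_power js n) [i]))" for y j
  proof -
    have "arp (list_power js (Suc n)) [j] = arp (list_power js n) (arp js [j])"
      by (simp only: list_power_Suc_right arp_append_list)
    then show ?thesis
      using edges_refine[of "list_power js n" "M y" "arp js [j]"] by (simp only: mpow_Suc_right)
  qed
  obtain z i where z: "(z, i) \<in> edges (M y) (arp js [j])" "e \<in> edges (mpow n z) (arp (list_power js n) [i])"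
    using Suc.prems(1) unfolding split by blast
  obtain z' i' where z': "(z', i') \<in> edges (M y') (arp js [j'])" "e \<in> edges (mpow n z') (arp (list_power js n) [i'])"
    using Suc.prems(2) unfolding split by blast
  show ?case
  proof (cases "(z, i) = (z', i')")
    case True
    then show ?thesis
      using negligible_tile_cyl_common_child[OF z(1) _ Suc.prems(3)] z' by simp
  next
    case False
    have n: "negligible (tile_cyl z i \<inter> tile_cyl z' i')" by (rule Suc.IH[OF z(2) z'(2) False])
    have sub: "M ` (tile_cyl y j \<inter> tile_cyl y' j') \<subseteq> tile_cyl z i \<inter> tile_cyl z' i'"
      using tile_cyl_M z(1) z'(1) by blast
    show ?thesis by (rule negligible_M[OF negligible_subset[OF n sub]])
  qed
qed

definition tile :: "real^3 \<Rightarrow> 3 \<Rightarrow> (real^3) set" where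
  "tile y j = {x. proj (x - y) \<in> rauzy j \<and> l \<bullet> y \<le> l \<bullet> x \<and> l \<bullet> x \<le> l \<bullet> y + l $ j}"

lemma negligible_tile_Int:
  assumes "\<And>k. y $ k \<in> \<int>" "\<And>k. y' $ k \<in> \<int>" "(y, j) \<noteq> (y', j')"
  shows "negligible (tile y j \<inter> tile y' j')"
proof (cases "l \<bullet> y < l \<bullet> y' + l $ j' \<and> l \<bullet> y' < l \<bullet> y + l $ j")
  case True
  then obtain n e where "e \<in> edges (mpow n y) (arp (list_power js n) [j])"
    "e \<in> edges (mpow n y') (arp (list_power js n) [j'])"
    using common_descendant[OF M_v v_pos lam letters l_pos l_M assms(1,2)] by blast
  then have "negligible (tile_cyl y j \<inter> tile_cyl y' j')"
    using negligible_tile_cyl_common_descendant assms(3) by blast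
  then show ?thesis
    by (rule negligible_subset) (auto simp: tile_def tile_cyl_def)
next
  case False
  \<comment> \<open>The height intervals meet in at most one point, so the intersection lies in the
    bottom plane of one of the tiles.\<close>
  have "l \<noteq> 0" using l_pos[of 1] by auto
  then have "negligible ({x. l \<bullet> x = l \<bullet> y} \<union> {x. l \<bullet> x = l \<bullet> y'})"
    by (intro negligible_Un negligible_hyperplane) auto
  then show ?thesis
    by (rule negligible_subset) (use False in \<open>auto simp: tile_def\<close>)
qed

end


section \<open>Tiles cover space\<close>

text \<open>A step adds all coordinates into the one of its letter and leaves the others unchanged.
  Once all letters occur, the product is therefore a positive matrix.\<close>

lemma ar_matrix_support:
  assumes "\<And>k. 0 \<le> u $ k" "0 < u $ m" "i \<in> set js \<or> 0 < u $ i"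
  shows "0 < (ar_matrix js *v u) $ i"
  using assms(3)
proof (induction js arbitrary: i)
  case Nil
  then show ?case by (simp add: ar_matrix_Nil)
next
  case (Cons x js)
  let ?w = "ar_matrix js *v u"
  show ?case
  proof (cases "i = x")
    case True
    have "0 < (\<Sum>k\<in>UNIV. ?w $ k)"
      by (rule sum_pos2[of _ m]) (use Cons.IH[of m] assms in \<open>auto intro: ar_matrix_nonneg\<close>)
    then show ?thesis unfolding ar_matrix_Cons[of x js] using True by (simp add: ar_matrix_single sum_3)
  next
    case False
    then have "0 < ?w $ i" using Cons by auto
    then show ?thesis unfolding ar_matrix_Cons[of x js] using False by (simp add: ar_matrix_single)
  qed
qed

lemma edges_cover:
  assumes "w \<noteq> []" "l \<bullet> z \<le> t" "t \<le> l \<bullet> z + l \<bullet> abel w"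
  obtains x i where "(x, i) \<in> edges z w" "l \<bullet> x \<le> t" "t \<le> l \<bullet> x + l $ i"
proof -
  have "\<exists>x i. (x, i) \<in> edges z w \<and> l \<bullet> x \<le> t \<and> t \<le> l \<bullet> x + l $ i"
    using assms
  proof (induction w arbitrary: z)
    case (Cons a w)
    show ?case
    proof (cases "t \<le> l \<bullet> z + l $ a")
      case True
      then show ?thesis using Cons.prems by auto
    next
      case False
      then have "w \<noteq> []" using Cons.prems by (auto simp: inner_add_right)
      then show ?thesis
        using Cons.IH[of "z + axis a 1"] Cons.prems False by (auto simp: inner_add_right)
    qed
  qed simp
  then show ?thesis using that by blast
qed

definition int_lattice :: "(real^3) set" where
  "int_lattice = {x. \<forall>k. x $ k \<in> \<int>}"

lemma int_lattice_ar_matrix: "x \<in> int_lattice \<Longrightarrow> ar_matrix js *v x \<in> int_lattice"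
  by (auto simp: int_lattice_def matrix_vector_mult_def incidence_matrix_def intro!: Ints_sum Ints_mult)

lemma int_lattice_edges: "(x, i) \<in> edges z w \<Longrightarrow> z \<in> int_lattice \<Longrightarrow> x \<in> int_lattice"
  using edges_Ints by (auto simp: int_lattice_def)

lemma zero_int_lattice: "0 \<in> int_lattice"
  by (simp add: int_lattice_def)

lemma closed_int_lattice: "closed int_lattice"
proof -
  have "closed ((\<lambda>x :: real^3. x $ k) -` \<int>)" for k
    by (intro closed_vimage closed_Ints continuous_intros)
  then have "closed (\<Inter>k. (\<lambda>x :: real^3. x $ k) -` \<int>)" by (intro closed_INT) auto
  moreover have "int_lattice = (\<Inter>k. (\<lambda>x :: real^3. x $ k) -` \<int>)" by (auto simp: int_lattice_def)
  ultimately show ?thesis by simp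
qed

lemma countable_int_lattice: "countable int_lattice"
proof -
  have "int_lattice \<subseteq> range (\<lambda>(a, b, c). \<chi> k. if k = 1 then of_int a else if k = 2 then of_int b else of_int c)"
  proof
    fix x :: "real^3" assume "x \<in> int_lattice"
    then have "x $ k = of_int \<lfloor>x $ k\<rfloor>" for k by (auto simp: int_lattice_def elim!: Ints_cases)
    then have "x = (\<lambda>(a, b, c). \<chi> k. if k = 1 then of_int a else if k = 2 then of_int b else of_int c)
        (\<lfloor>x $ 1\<rfloor>, \<lfloor>x $ 2\<rfloor>, \<lfloor>x $ 3\<rfloor>)"
      using exhaust_3 by (auto simp: vec_eq_iff)
    then show "x \<in> range (\<lambda>(a, b, c). \<chi> k. if k = 1 then of_int a else if k = 2 then of_int b else of_int c)"
      by blast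
  qed
  then show ?thesis by (rule countable_subset) auto
qed

context ar_pisot
begin

lemma negligible_tile_overlap:
  "y \<in> int_lattice \<Longrightarrow> y' \<in> int_lattice \<Longrightarrow> (y, j) \<noteq> (y', j') \<Longrightarrow> negligible (tile y j \<inter> tile y' j')"
  by (rule negligible_tile_Int) (auto simp: int_lattice_def)

lemma M_inverse: "\<exists>N. (\<forall>x. N *v M x = x) \<and> (\<forall>x. M (N *v x) = x)"
proof -
  have "invertible (ar_matrix js)" by (simp add: invertible_det_nz det_ar_matrix)
  then obtain N where "N ** ar_matrix js = mat 1" "ar_matrix js ** N = mat 1" unfolding invertible_def by blast
  then show ?thesis by (intro exI[of _ N]) (simp add: matrix_vector_mul_assoc)
qed

lemma mem_tile_shift: "x \<in> tile (y + z) j \<longleftrightarrow> x - z \<in> tile y j"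
  by (simp add: tile_def algebra_simps)

lemma mem_tile_zero: "x \<in> tile y j \<longleftrightarrow> x - y \<in> tile 0 j"
  using mem_tile_shift[of x 0 y j] by simp

lemma tile_zero_image: "tile 0 j = (\<lambda>(a, s). a + s *\<^sub>R v) ` (rauzy j \<times> {0..l $ j})"
proof (intro set_eqI iffI)
  fix x assume "x \<in> tile 0 j"
  then have "(proj x, l \<bullet> x) \<in> rauzy j \<times> {0..l $ j}" "x = (\<lambda>(a, s). a + s *\<^sub>R v) (proj x, l \<bullet> x)"
    using proj_decomp[of x] by (auto simp: tile_def)
  then show "x \<in> (\<lambda>(a, s). a + s *\<^sub>R v) ` (rauzy j \<times> {0..l $ j})" by blast
next
  fix x assume "x \<in> (\<lambda>(a, s). a + s *\<^sub>R v) ` (rauzy j \<times> {0..l $ j})"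
  then obtain a s where "a \<in> rauzy j" "0 \<le> s" "s \<le> l $ j" "x = a + s *\<^sub>R v" by auto
  then show "x \<in> tile 0 j"
    using rauzy_ker by (simp add: tile_def proj_def inner_add_right l_v)
qed

lemma compact_tile_zero: "compact (tile 0 j)"
  unfolding tile_zero_image split_beta
  by (intro compact_continuous_image compact_Times compact_rauzy compact_Icc continuous_intros)

lemma tile_image: "tile y j = (+) y ` tile 0 j"
proof (intro set_eqI iffI)
  fix x assume "x \<in> tile y j"
  then have "x - y \<in> tile 0 j" using mem_tile_zero by blast
  moreover have "x = y + (x - y)" by simp
  ultimately show "x \<in> (+) y ` tile 0 j" by blast
next
  fix x assume "x \<in> (+) y ` tile 0 j"
  then show "x \<in> tile y j" using mem_tile_zero[of x y j] by auto
qed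

lemma closed_tile: "closed (tile y j)"
  by (subst tile_image) (intro closed_translation compact_imp_closed compact_tile_zero)

lemma closed_UN_tile: "closed (\<Union>y\<in>int_lattice. tile y j)"
proof -
  have "tile y j = (\<Union>b\<in>tile 0 j. {y + b})" for y
    by (subst tile_image) blast
  then have "(\<Union>y\<in>int_lattice. tile y j) = (\<Union>y\<in>int_lattice. \<Union>b\<in>tile 0 j. {y + b})"
    by (intro SUP_cong refl)
  then show ?thesis using closed_compact_sums[OF closed_int_lattice compact_tile_zero[of j]] by simp
qed

text \<open>The height chooses the child: \<open>M\<close> stretches the height interval to that of
  the substituted path, whose edges cover it, and the plane coordinate fits every child.\<close>

lemma tile_M:
  assumes "x \<in> tile y j"
  obtains z i where "(z, i) \<in> edges (M y) (arp js [j])" "M x \<in> tile z i"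
proof -
  have la: "l \<bullet> abel (arp js [j]) = lam * l $ j"
    using l_M[of "axis j 1"] by (simp add: abel_arp)
  have "arp js [j] \<noteq> []" using arp_hd[of js j] by auto
  moreover have "l \<bullet> M y \<le> l \<bullet> M x" using assms lam by (simp add: l_M tile_def)
  moreover have "l \<bullet> M x \<le> l \<bullet> M y + l \<bullet> abel (arp js [j])"
  proof -
    have "lam * (l \<bullet> x) \<le> lam * (l \<bullet> y + l $ j)"
      using assms lam by (intro mult_left_mono) (auto simp: tile_def)
    then show ?thesis by (simp add: l_M la distrib_left)
  qed
  ultimately obtain z i where zi: "(z, i) \<in> edges (M y) (arp js [j])" "l \<bullet> z \<le> l \<bullet> M x" "l \<bullet> M x \<le> l \<bullet> z + l $ i"
    by (rule edges_cover)
  moreover have "x \<in> tile_cyl y j" using assms by (simp add: tile_def tile_cyl_def)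
  ultimately have "M x \<in> tile z i"
    using tile_cyl_M[of x y j z i] by (simp add: tile_def tile_cyl_def)
  then show ?thesis using that zi(1) by blast
qed

definition tiled :: "(real^3) set" where
  "tiled = (\<Union>j. \<Union>y\<in>int_lattice. tile y j)"

lemma tiled_M: "x \<in> tiled \<Longrightarrow> M x \<in> tiled"
proof -
  assume "x \<in> tiled"
  then obtain y j where y: "y \<in> int_lattice" "x \<in> tile y j" by (auto simp: tiled_def)
  obtain z i where zi: "(z, i) \<in> edges (M y) (arp js [j])" "M x \<in> tile z i" using tile_M[OF y(2)] .
  have "z \<in> int_lattice" by (rule int_lattice_edges[OF zi(1) int_lattice_ar_matrix[OF y(1)]])
  then show "M x \<in> tiled" unfolding tiled_def using zi(2) by blast
qed

lemma tiled_mpow: "x \<in> tiled \<Longrightarrow> mpow n x \<in> tiled"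
proof (induction n)
  case (Suc n)
  then show ?case unfolding mpow_Suc by (intro tiled_M)
qed (simp only: mpow_0)

lemma closed_tiled: "closed tiled"
  unfolding tiled_def by (intro closed_UN finite ballI closed_UN_tile)

lemma mpow_surj: "\<exists>q. mpow n q = p"
proof -
  have "invertible (ar_matrix (list_power js n))" by (simp add: invertible_det_nz det_ar_matrix)
  then obtain N where "ar_matrix (list_power js n) ** N = mat 1" unfolding invertible_def by blast
  then have "mpow n (N *v p) = p" by (simp add: matrix_vector_mul_assoc)
  then show ?thesis by blast
qed

text \<open>Lattice points come uniformly close to every point along the plane, and \<open>M\<close> contracts that
  direction.\<close>

lemma tiled_UNIV: "tiled = UNIV"
proof -
  have "bounded_linear proj" using linear_proj linear_conv_bounded_linear by blast
  then obtain K where K: "0 < K" "\<And>x. norm (proj x) \<le> norm x * K"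
    using bounded_linear.pos_bounded by blast
  \<comment> \<open>The path \<open>[1, 2, 3]\<close> crosses the unit cube of \<open>q\<close> and
    has an edge at the height of \<open>q\<close>. Since 0 lies in every fractal, its tile contains
    a point \<open>g\<close> at that height on the line along \<open>v\<close> through its vertex.
    The constant 3 bounds the sum of three coordinate differences.\<close>
  have near: "\<exists>g\<in>tiled. l \<bullet> g = l \<bullet> q \<and> norm (q - g) \<le> 3 * K" for q
  proof -
    define y :: "real^3" where "y = (\<chi> k. of_int \<lfloor>q $ k\<rfloor>)"
    have y: "y \<in> int_lattice" by (simp add: y_def int_lattice_def)
    have fl: "y $ k \<le> q $ k" "q $ k \<le> y $ k + 1" for k
      unfolding y_def using floor_correct[of "q $ k"] by simp_all
    have lo: "l \<bullet> y \<le> l \<bullet> q"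
      unfolding inner_vec_def using fl(1) l_pos by (intro sum_mono) (simp add: less_imp_le)
    have hi: "l \<bullet> q \<le> l \<bullet> y + l \<bullet> abel [1, 2, 3]"
    proof -
      have "l $ k * q $ k \<le> l $ k * y $ k + l $ k" for k
        using mult_left_mono[OF fl(2)[of k], of "l $ k"] l_pos[of k] by (simp add: distrib_left)
      from this[of 1] this[of 2] this[of 3] show ?thesis
        by (simp add: inner_vec_def[of l y] inner_vec_def[of l q] sum_3 inner_add_right)
    qed
    obtain x i where x: "(x, i) \<in> edges y [1, 2, 3]" "l \<bullet> x \<le> l \<bullet> q" "l \<bullet> q \<le> l \<bullet> x + l $ i"
      using edges_cover[OF _ lo hi] by blast
    have "0 \<le> (x - y) $ k \<and> (x - y) $ k \<le> 1" for k
      using x(1) exhaust_3[of k] by (auto simp: axis_def)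
    then have "\<bar>(q - x) $ k\<bar> \<le> 1" for k
      using fl[of k] by (simp add: abs_le_iff) (smt (verit, best) vector_minus_component)
    then have "(\<Sum>k\<in>UNIV. \<bar>(q - x) $ k\<bar>) \<le> (\<Sum>k\<in>(UNIV :: 3 set). 1)" by (intro sum_mono)
    then have n: "norm (q - x) \<le> 3" using norm_le_l1_cart[of "q - x"] by simp
    define g where "g = x + (l \<bullet> q - l \<bullet> x) *\<^sub>R v"
    have lg: "l \<bullet> g = l \<bullet> q" by (simp add: g_def inner_add_right l_v)
    have "proj (g - x) = 0" by (simp add: g_def proj_def l_v)
    then have "g \<in> tile x i" using x zero_rauzy by (simp add: tile_def lg)
    then have "g \<in> tiled" using int_lattice_edges[OF x(1) y] by (auto simp: tiled_def)
    moreover have "norm (q - g) \<le> 3 * K"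
    proof -
      have "q - g = proj (q - x)" by (simp add: g_def proj_def inner_diff_right algebra_simps)
      then have "norm (q - g) \<le> norm (q - x) * K" using K(2) by (simp only:)
      also have "\<dots> \<le> 3 * K" using n K(1) by (intro mult_right_mono) auto
      finally show ?thesis .
    qed
    ultimately show ?thesis using lg by blast
  qed
  have "p \<in> tiled" for p
  proof -
    have "\<exists>h\<in>tiled. norm (p - h) \<le> kap n * (3 * K)" for n
    proof -
      obtain q where q: "mpow n q = p" using mpow_surj by blast
      obtain g where g: "g \<in> tiled" "l \<bullet> g = l \<bullet> q" "norm (q - g) \<le> 3 * K" using near by blast
      have "norm (p - mpow n g) = norm (mpow n (q - g))" by (simp add: q matrix_vector_mult_diff_distrib)
      also have "\<dots> \<le> kap n * norm (q - g)" using g by (intro kap) (simp add: inner_diff_right)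
      also have "\<dots> \<le> kap n * (3 * K)" using g by (intro mult_left_mono kap_nonneg)
      finally show ?thesis using tiled_mpow[OF g(1)] by blast
    qed
    then obtain h where h: "\<And>n. h n \<in> tiled" "\<And>n. norm (p - h n) \<le> kap n * (3 * K)" by metis
    have "(\<lambda>n. kap n * (3 * K)) \<longlonglongrightarrow> 0" using kap_tendsto by (rule tendsto_mult_left_zero)
    then have "(\<lambda>n. p - h n) \<longlonglongrightarrow> 0"
      by (rule Lim_null_comparison[OF always_eventually[OF allI[OF h(2)]]])
    then have "(\<lambda>n. p - (p - h n)) \<longlonglongrightarrow> p - 0" by (intro tendsto_intros)
    then have "h \<longlonglongrightarrow> p" by simp
    then show ?thesis by (rule closed_sequentially[OF closed_tiled h(1)])
  qed
  then show ?thesis by blast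
qed

section \<open>Interior points of the Rauzy fractals\<close>

definition Es :: "(real^3) set" where "Es = {x. l \<bullet> x = 0}"

definition Eu :: "(real^3) set" where "Eu = range (\<lambda>s. s *\<^sub>R v)"

definition fiber :: "3 \<Rightarrow> (real^3) set" where "fiber j = (\<lambda>s. s *\<^sub>R v) ` {0..l $ j}"

lemma rauzy_Es: "rauzy j \<subseteq> Es"
  using rauzy_ker by (auto simp: Es_def)

lemma mem_int_in: "a \<in> int_in E A \<longleftrightarrow> (\<exists>W. open W \<and> a \<in> W \<and> a \<in> E \<and> E \<inter> W \<subseteq> A)"
  unfolding interior_of_def openin_open by blast

lemma openin_int_in: "openin (top_of_set E) (int_in E A)"
  by (rule openin_interior_of)

lemma int_in_subset: "int_in E A \<subseteq> A"
  by (rule interior_of_subset)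

text \<open>Countably many closed tiles cover space, so by Baire one has an interior point. The
  horizontal slice through it is open in the plane and lies in a translated fractal.\<close>

lemma int_rauzy_exists: "\<exists>j. int_in Es (rauzy j) \<noteq> {}"
proof -
  have "\<exists>y j. interior (tile y j) \<noteq> {}"
  proof (rule ccontr)
    assume *: "\<not> ?thesis"
    let ?G = "(\<lambda>(y, j). - tile y j) ` (int_lattice \<times> UNIV)"
    have "UNIV \<subseteq> closure (\<Inter>?G)"
    proof (rule Baire)
      show "countable ?G" by (intro countable_image countable_SIGMA countable_int_lattice countable_finite finite)
      show "openin (top_of_set UNIV) T \<and> UNIV \<subseteq> closure T" if "T \<in> ?G" for T
        using that * closed_tile by (auto simp: closure_complement)
    qed simp
    moreover have "\<Inter>?G = {}" using tiled_UNIV unfolding tiled_def by blast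
    ultimately show False by simp
  qed
  then obtain y j p where p: "p \<in> interior (tile y j)" by blast
  let ?s = "(l \<bullet> (p - y)) *\<^sub>R v"
  let ?W = "(\<lambda>a. a + (?s + y)) -` interior (tile y j)"
  have "open ?W" by (intro open_vimage open_interior continuous_intros)
  moreover have "proj (p - y) \<in> ?W" using p by (simp add: proj_def)
  moreover have "Es \<inter> ?W \<subseteq> rauzy j"
  proof
    fix a assume a: "a \<in> Es \<inter> ?W"
    then have "a + (?s + y) \<in> tile y j" using interior_subset by blast
    then have "proj (a + (?s + y) - y) \<in> rauzy j" by (simp add: tile_def)
    moreover have "proj (a + (?s + y) - y) = a" using a by (simp add: proj_def Es_def inner_add_right l_v)
    ultimately show "a \<in> rauzy j" by simp
  qed
  moreover have "proj (p - y) \<in> Es" by (simp add: Es_def)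
  ultimately have "proj (p - y) \<in> int_in Es (rauzy j)" unfolding mem_int_in by blast
  then show ?thesis by blast
qed

lemma rauzy_child:
  assumes "a \<in> rauzy j" "(p, i) \<in> edges 0 (arp js [j])"
  shows "M a - proj p \<in> rauzy i"
  unfolding rauzy_gifs[of i] mem_gifs using assms by blast

lemma int_rauzy_child:
  assumes a: "a \<in> int_in Es (rauzy j)" and p: "(p, i) \<in> edges 0 (arp js [j])"
  shows "M a - proj p \<in> int_in Es (rauzy i)"
proof -
  obtain W where W: "open W" "a \<in> W" "a \<in> Es" "Es \<inter> W \<subseteq> rauzy j" using a unfolding mem_int_in by blast
  obtain N where N: "\<And>x. N *v M x = x" "\<And>x. M (N *v x) = x" using M_inverse by blast
  let ?W = "(\<lambda>b. N *v (b + proj p)) -` W"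
  have "continuous_on UNIV (\<lambda>b. N *v (b + proj p))"
    by (rule continuous_on_compose2[OF linear_continuous_on[OF matrix_vector_mul_bounded_linear, of UNIV N]])
      (auto intro: continuous_intros)
  then have "open ?W" using W(1) by (intro open_vimage)
  moreover have "M a - proj p \<in> ?W" using W N by simp
  moreover have "M a - proj p \<in> Es" using W by (simp add: Es_def inner_diff_right l_M)
  moreover have "Es \<inter> ?W \<subseteq> rauzy i"
  proof
    fix b assume b: "b \<in> Es \<inter> ?W"
    let ?c = "N *v (b + proj p)"
    have "lam * (l \<bullet> ?c) = l \<bullet> (b + proj p)" using l_M[of ?c] N by simp
    then have "?c \<in> Es" using b lam by (simp add: Es_def inner_add_right)
    then have "?c \<in> rauzy j" using b W by blast
    then have "M ?c - proj p \<in> rauzy i" by (rule rauzy_child[OF _ p])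
    then show "b \<in> rauzy i" using N by simp
  qed
  ultimately show ?thesis unfolding mem_int_in by blast
qed

lemma edges_letter: "\<exists>p. (p, i) \<in> edges 0 (arp js [j])"
proof -
  have "0 < (M (axis j 1)) $ i"
    by (rule ar_matrix_support[of _ j]) (use letters in \<open>auto simp: axis_def\<close>)
  then have "0 < abel (arp js [j]) $ i" by (simp add: abel_arp)
  then have "count_list (arp js [j]) i \<noteq> 0" by (simp add: abel_def)
  then have "i \<in> set (arp js [j])" by (metis count_list_0_iff)
  then show ?thesis unfolding edges_iff by (metis split_list)
qed

lemma int_rauzy_nonempty: "int_in Es (rauzy i) \<noteq> {}"
  using int_rauzy_exists int_rauzy_child edges_letter by (metis ex_in_conv)

lemma int_rauzy_descendant:
  assumes "a \<in> int_in Es (rauzy j)" "(x, i) \<in> edges 0 (arp (list_power js n) [j])"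
  shows "mpow n a - proj x \<in> int_in Es (rauzy i)"
  using assms(2)
proof (induction n arbitrary: x i)
  case 0
  then have "x = 0" "i = j" by (auto simp: arnoux_rauzy_product_simps)
  then show ?case using assms(1) by (simp only: mpow_0 proj_simps diff_zero)
next
  case (Suc n)
  then have "(x, i) \<in> edges 0 (arp js (arp (list_power js n) [j]))" by (simp add: arp_append_list)
  then obtain q k where q: "(q, k) \<in> edges 0 (arp (list_power js n) [j])" "(x - M q, i) \<in> edges 0 (arp js [k])"
    using edges_arp_shift by blast
  have "M (mpow n a - proj q) - proj (x - M q) \<in> int_in Es (rauzy i)"
    by (rule int_rauzy_child[OF Suc.IH[OF q(1)] q(2)])
  moreover have "M (mpow n a - proj q) - proj (x - M q) = mpow (Suc n) a - proj x"
    by (simp only: mpow_Suc matrix_vector_mult_diff_distrib proj_simps proj_M) simp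
  ultimately show ?case by (simp only:)
qed

text \<open>A prefix \<open>x\<close> of level \<open>n\<close> is also a prefix at every later
  level, because the words extend each other. Carrying an interior point \<open>a\<close> along
  these levels gives interior points \<open>mpow (n + m) a - proj x\<close>, which converge to the
  point of \<open>x\<close>.\<close>

lemma rauzy_subset_closure: "rauzy i \<subseteq> closure (int_in Es (rauzy i))"
proof -
  have "proj ` rauzy_points i \<subseteq> closure (int_in Es (rauzy i))"
  proof
    fix y assume "y \<in> proj ` rauzy_points i"
    then obtain x n j where x: "y = - proj x" "(x, i) \<in> edges 0 (arp (list_power js n) [j])"
      by (auto simp: rauzy_points_def proj_simps)
    obtain a where a: "a \<in> int_in Es (rauzy j)" using int_rauzy_nonempty by blast
    have mem: "mpow (n + m) a - proj x \<in> int_in Es (rauzy i)" for m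
    proof (rule int_rauzy_descendant[OF a])
      obtain w where w: "arp (list_power js m) [j] = j # w" using arp_hd by blast
      have "list_power js (n + m) = list_power js n @ list_power js m"
        by (induction n) simp_all
      then have "arp (list_power js (n + m)) [j] = arp (list_power js n) [j] @ arp (list_power js n) w"
        by (simp add: arp_append_list w arp_Cons[of _ j w])
      then show "(x, i) \<in> edges 0 (arp (list_power js (n + m)) [j])"
        using x(2) by (simp add: edges_append)
    qed
    have la: "l \<bullet> a = 0" using a openin_subset[OF openin_int_in] by (auto simp: Es_def)
    have "(\<lambda>m. kap (m + n)) \<longlonglongrightarrow> 0" using kap_tendsto by (rule LIMSEQ_ignore_initial_segment)
    then have "(\<lambda>m. kap (n + m) * norm a) \<longlonglongrightarrow> 0"
      by (intro tendsto_mult_left_zero) (simp add: add.commute)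
    then have "(\<lambda>m. mpow (n + m) a) \<longlonglongrightarrow> 0"
      by (rule Lim_null_comparison[rotated]) (intro always_eventually allI kap(2)[OF la])
    then have "(\<lambda>m. mpow (n + m) a - proj x) \<longlonglongrightarrow> 0 - proj x" by (intro tendsto_intros)
    then have "(\<lambda>m. mpow (n + m) a - proj x) \<longlonglongrightarrow> y" using x(1) by simp
    then show "y \<in> closure (int_in Es (rauzy i))" unfolding closure_sequential
      by (intro exI[of _ "\<lambda>m. mpow (n + m) a - proj x"] conjI allI mem)
  qed
  then show ?thesis unfolding rauzy_def by (intro closure_minimal closed_closure)
qed

end


section \<open>The Markov partition\<close>

lemma to_torus_eq_iff: "to_torus x = to_torus y \<longleftrightarrow> x - y \<in> int_lattice"
  by (simp add: torus.abs_eq_iff torus_rel_def int_lattice_def)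

lemma to_torus_surj: "\<exists>x. P = to_torus x"
  by (metis Quotient_torus Quotient_abs_rep)

lemma to_torus_vimage_image: "to_torus -` (to_torus ` A) = (\<Union>z\<in>int_lattice. (+) z ` A)"
proof (intro set_eqI iffI)
  fix x assume "x \<in> to_torus -` (to_torus ` A)"
  then obtain a where "a \<in> A" "x - a \<in> int_lattice" by (auto simp: to_torus_eq_iff)
  moreover have "x = (x - a) + a" by simp
  ultimately show "x \<in> (\<Union>z\<in>int_lattice. (+) z ` A)" by blast
next
  fix x assume "x \<in> (\<Union>z\<in>int_lattice. (+) z ` A)"
  then obtain z a where "z \<in> int_lattice" "a \<in> A" "x = z + a" by blast
  then have "to_torus x = to_torus a" by (simp add: to_torus_eq_iff)
  with \<open>a \<in> A\<close> show "x \<in> to_torus -` (to_torus ` A)" by auto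
qed

lemma continuous_to_torus: "continuous_on A to_torus"
  by (rule continuous_on_subset[of UNIV])
    (auto simp: continuous_on_open_vimage open_torus_def)

lemma open_to_torus_image: "open U \<Longrightarrow> open (to_torus ` U)"
  unfolding open_torus_def to_torus_vimage_image by (intro open_UN ballI open_translation)

lemma closed_torus_iff: "closed S \<longleftrightarrow> closed (to_torus -` S)"
  by (simp add: closed_def open_torus_def vimage_Compl)

context ar_pisot
begin

definition part :: "3 \<Rightarrow> torus set" where "part j = to_torus ` tile 0 j"

lemma mem_Eu: "x \<in> Eu \<longleftrightarrow> proj x = 0"
proof
  assume "proj x = 0"
  then have "x = (l \<bullet> x) *\<^sub>R v" by (simp add: proj_def)
  then show "x \<in> Eu" unfolding Eu_def by blast
qed (auto simp: Eu_def proj_def l_v)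

lemma mem_Es: "x \<in> Es \<longleftrightarrow> l \<bullet> x = 0"
  by (simp add: Es_def)

lemma box_coords:
  assumes "a \<in> Es" "b \<in> Eu"
  shows "proj (0 + a + b) = a" "l \<bullet> (0 + a + b) = l \<bullet> b" "b = (l \<bullet> b) *\<^sub>R v"
proof -
  show "proj (0 + a + b) = a" using assms by (simp add: proj_simps proj_ker mem_Eu mem_Es)
  show "l \<bullet> (0 + a + b) = l \<bullet> b" using assms by (simp add: inner_add_right mem_Es)
  show "b = (l \<bullet> b) *\<^sub>R v" using assms by (simp add: mem_Eu proj_def)
qed

lemma fiber_iff: "b \<in> fiber j \<longleftrightarrow> b \<in> Eu \<and> 0 \<le> l \<bullet> b \<and> l \<bullet> b \<le> l $ j"
proof
  assume "b \<in> fiber j"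
  then show "b \<in> Eu \<and> 0 \<le> l \<bullet> b \<and> l \<bullet> b \<le> l $ j" by (auto simp: fiber_def Eu_def l_v)
next
  assume b: "b \<in> Eu \<and> 0 \<le> l \<bullet> b \<and> l \<bullet> b \<le> l $ j"
  then have "b = (l \<bullet> b) *\<^sub>R v" by (simp add: mem_Eu proj_def)
  with b show "b \<in> fiber j" unfolding fiber_def by (metis atLeastAtMost_iff imageI)
qed

lemma box_sum_tile: "box_sum 0 (rauzy j) (fiber j) = tile 0 j"
  unfolding tile_zero_image box_sum_def fiber_def by auto

lemma open_box_sum:
  assumes "openin (top_of_set Es) U" "openin (top_of_set Eu) V"
  shows "open (box_sum 0 U V)"
proof -
  obtain A B where AB: "open A" "U = Es \<inter> A" "open B" "V = Eu \<inter> B" using assms unfolding openin_open by blast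
  have "box_sum 0 U V = proj -` A \<inter> (\<lambda>x. (l \<bullet> x) *\<^sub>R v) -` B"
  proof (intro set_eqI iffI)
    fix x assume "x \<in> box_sum 0 U V"
    then obtain a b where ab: "a \<in> U" "b \<in> V" "x = 0 + a + b" by (auto simp: box_sum_def)
    then show "x \<in> proj -` A \<inter> (\<lambda>x. (l \<bullet> x) *\<^sub>R v) -` B"
      using box_coords[of a b] AB by (simp add: inner_add_right mem_Es)
  next
    fix x assume "x \<in> proj -` A \<inter> (\<lambda>x. (l \<bullet> x) *\<^sub>R v) -` B"
    then have "proj x \<in> U" "(l \<bullet> x) *\<^sub>R v \<in> V" using AB by (auto simp: mem_Es Eu_def)
    moreover have "x = 0 + proj x + (l \<bullet> x) *\<^sub>R v" by (simp add: proj_def)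
    ultimately show "x \<in> box_sum 0 U V" unfolding box_sum_def by blast
  qed
  moreover have "open (proj -` A)" using AB by (intro open_vimage continuous_proj)
  moreover have "open ((\<lambda>x. (l \<bullet> x) *\<^sub>R v) -` B)" using AB by (intro open_vimage continuous_intros)
  ultimately show ?thesis by (simp add: open_Int)
qed

definition box_interior :: "3 \<Rightarrow> (real^3) set" where
  "box_interior j = box_sum 0 (int_in Es (rauzy j)) (int_in Eu (fiber j))"

lemma open_box_interior: "open (box_interior j)"
  unfolding box_interior_def by (intro open_box_sum openin_int_in)

lemma box_interior_subset: "box_interior j \<subseteq> tile 0 j"
  unfolding box_interior_def box_sum_tile[symmetric]
  using int_in_subset[of Es "rauzy j"] int_in_subset[of Eu "fiber j"] by (auto simp: box_sum_def)

lemma fiber_interior: "(\<lambda>s. s *\<^sub>R v) ` {0<..<l $ j} \<subseteq> int_in Eu (fiber j)"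
proof
  fix b assume "b \<in> (\<lambda>s. s *\<^sub>R v) ` {0<..<l $ j}"
  then obtain s where s: "0 < s" "s < l $ j" "b = s *\<^sub>R v" by auto
  let ?W = "(\<lambda>x. l \<bullet> x) -` {0<..<l $ j}"
  have "open ?W" by (intro open_vimage continuous_intros open_greaterThanLessThan)
  moreover have "b \<in> ?W" using s by (simp add: l_v)
  moreover have "Eu \<inter> ?W \<subseteq> fiber j" by (auto simp: fiber_iff)
  moreover have "b \<in> Eu" unfolding Eu_def s(3) by (rule rangeI)
  ultimately show "b \<in> int_in Eu (fiber j)" unfolding mem_int_in by blast
qed

lemma compact_fiber: "compact (fiber j)"
  unfolding fiber_def by (intro compact_continuous_image compact_Icc continuous_intros)

lemma fiber_subset_closure: "fiber j \<subseteq> closure (int_in Eu (fiber j))"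
proof -
  have "fiber j = (\<lambda>s. s *\<^sub>R v) ` closure {0<..<l $ j}" using l_pos[of j] by (simp add: fiber_def)
  also have "\<dots> \<subseteq> closure (int_in Eu (fiber j))"
    using fiber_interior closure_subset[of "int_in Eu (fiber j)"]
    by (intro image_closure_subset closed_closure continuous_intros) blast
  finally show ?thesis .
qed

lemma tile_subset_closure: "tile 0 j \<subseteq> closure (box_interior j)"
proof -
  have "tile 0 j \<subseteq> (\<lambda>(a, b). a + b) ` (rauzy j \<times> fiber j)"
    unfolding box_sum_tile[symmetric] box_sum_def by auto
  also have "\<dots> \<subseteq> (\<lambda>(a, b). a + b) ` closure (int_in Es (rauzy j) \<times> int_in Eu (fiber j))"
    unfolding closure_Times using rauzy_subset_closure fiber_subset_closure by (intro image_mono Sigma_mono) auto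
  also have "\<dots> \<subseteq> closure (box_interior j)"
  proof (rule image_closure_subset)
    show "(\<lambda>(a, b). a + b) ` (int_in Es (rauzy j) \<times> int_in Eu (fiber j)) \<subseteq> closure (box_interior j)"
      using closure_subset[of "box_interior j"] by (auto simp: box_interior_def box_sum_def)
  qed (auto simp: split_beta intro!: continuous_intros)
  finally show ?thesis .
qed

lemma box_interior_nonempty: "box_interior j \<noteq> {}"
proof
  assume "box_interior j = {}"
  then have "tile 0 j = {}" using tile_subset_closure[of j] by simp
  moreover have "0 \<in> tile 0 j" using zero_rauzy l_pos[of j] by (simp add: tile_def proj_simps less_imp_le)
  ultimately show False by blast
qed

lemma cl_in_int_in:
  assumes "closed A" "A \<subseteq> E" "A \<subseteq> closure (int_in E A)"
  shows "cl_in E (int_in E A) = A"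
proof -
  have "int_in E A \<subseteq> E" using int_in_subset assms(2) by blast
  then have "cl_in E (int_in E A) = E \<inter> closure (int_in E A)"
    by (simp add: closure_of_subtopology Int_absorb1)
  moreover have "closure (int_in E A) \<subseteq> A" using int_in_subset assms(1) by (intro closure_minimal)
  ultimately show ?thesis using assms(2,3) by blast
qed

lemma open_negligible_empty: "open U \<Longrightarrow> negligible (U :: (real^3) set) \<Longrightarrow> U = {}"
  using open_not_negligible by blast

text \<open>Two points of the open box that differ by a nonzero lattice vector would give a nonempty
  open set inside the null overlap of two tiles.\<close>

lemma box_interior_inj: "inj_on to_torus (box_interior j)"
proof (rule inj_onI)
  fix x y assume xy: "x \<in> box_interior j" "y \<in> box_interior j" "to_torus x = to_torus y"
  let ?z = "x - y"
  have z: "?z \<in> int_lattice" using xy by (simp add: to_torus_eq_iff)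
  show "x = y"
  proof (rule ccontr)
    assume "x \<noteq> y"
    then have "negligible (tile 0 j \<inter> tile ?z j)"
      using z by (intro negligible_tile_overlap zero_int_lattice) auto
    moreover have "box_interior j \<inter> (+) ?z ` box_interior j \<subseteq> tile 0 j \<inter> tile ?z j"
      using box_interior_subset[of j] by (subst (2) tile_image) blast
    moreover have "open (box_interior j \<inter> (+) ?z ` box_interior j)"
      by (intro open_Int open_translation open_box_interior)
    ultimately have "box_interior j \<inter> (+) ?z ` box_interior j = {}"
      using negligible_subset open_negligible_empty by blast
    moreover have "x \<in> (+) ?z ` box_interior j" using xy by (auto intro!: image_eqI[of _ _ y])
    ultimately show False using xy by blast
  qed
qed

lemma part_vimage: "to_torus -` part j = (\<Union>z\<in>int_lattice. tile z j)"
  unfolding part_def to_torus_vimage_image by (intro SUP_cong refl tile_image[symmetric])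

lemma closed_part: "closed (part j)"
  unfolding closed_torus_iff part_vimage by (rule closed_UN_tile)

lemma closure_interior_part: "closure (interior (part j)) = part j"
proof
  show "closure (interior (part j)) \<subseteq> part j"
    by (intro closure_minimal closed_part interior_subset)
  have "to_torus ` box_interior j \<subseteq> interior (part j)"
    unfolding part_def using box_interior_subset
    by (intro interior_maximal open_to_torus_image open_box_interior image_mono)
  then have "to_torus ` closure (box_interior j) \<subseteq> closure (interior (part j))"
    using closure_subset[of "interior (part j)"]
    by (intro image_closure_subset continuous_to_torus closed_closure) blast
  then show "part j \<subseteq> closure (interior (part j))"
    unfolding part_def using tile_subset_closure by blast
qed

lemma part_disjoint:
  assumes "i \<noteq> j"
  shows "interior (part i) \<inter> interior (part j) = {}"
proof -
  let ?U = "interior (part i) \<inter> interior (part j)"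
  have "open ?U" by (intro open_Int open_interior)
  then have "open (to_torus -` ?U)" by (rule open_torus_def[THEN iffD1])
  moreover have "negligible (to_torus -` ?U)"
  proof (rule negligible_subset)
    show "to_torus -` ?U \<subseteq> (\<Union>z\<in>int_lattice. \<Union>z'\<in>int_lattice. tile z i \<inter> tile z' j)"
    proof
      fix x assume "x \<in> to_torus -` ?U"
      then have "to_torus x \<in> part i" "to_torus x \<in> part j"
        by (auto dest: subsetD[OF interior_subset])
      then have "x \<in> (\<Union>z\<in>int_lattice. tile z i)" "x \<in> (\<Union>z\<in>int_lattice. tile z j)"
        by (simp_all only: part_vimage[symmetric] vimage_eq)
      then show "x \<in> (\<Union>z\<in>int_lattice. \<Union>z'\<in>int_lattice. tile z i \<inter> tile z' j)" by blast
    qed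
    have n: "tile z i \<inter> tile z' j \<in> null_sets lebesgue" if "z \<in> int_lattice" "z' \<in> int_lattice" for z z'
      using negligible_tile_overlap[OF that, of i j] assms by (simp add: negligible_iff_null_sets)
    show "negligible (\<Union>z\<in>int_lattice. \<Union>z'\<in>int_lattice. tile z i \<inter> tile z' j)"
      unfolding negligible_iff_null_sets by (intro null_sets_UN' countable_int_lattice n)
  qed
  ultimately have empty: "to_torus -` ?U = {}" by (rule open_negligible_empty)
  show ?thesis
  proof (rule equals0I)
    fix q assume q: "q \<in> ?U"
    obtain x where "q = to_torus x" using to_torus_surj by blast
    with q have "x \<in> to_torus -` ?U" by (simp only: vimage_eq)
    then show False unfolding empty by simp
  qed
qed

lemma part_cover: "(\<Union>j. part j) = UNIV"
proof -
  have "q \<in> (\<Union>j. part j)" for q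
  proof -
    obtain x where x: "q = to_torus x" using to_torus_surj by blast
    have "x \<in> tiled" by (simp add: tiled_UNIV)
    then obtain j where "x \<in> (\<Union>z\<in>int_lattice. tile z j)" unfolding tiled_def by (rule UN_E)
    then have "q \<in> part j" unfolding x part_vimage[symmetric] vimage_eq .
    then show ?thesis by blast
  qed
  then show ?thesis by blast
qed

lemma connected_part: "connected (part j)"
proof -
  have "connected (tile 0 j)"
    unfolding tile_zero_image split_beta
    by (intro connected_continuous_image connected_Times connected_rauzy connected_Icc continuous_intros)
  then show ?thesis unfolding part_def by (intro connected_continuous_image continuous_to_torus)
qed

lemma product_structure_part: "product_structure Es Eu (part j) 0 (rauzy j) (fiber j)"
  unfolding product_structure_def
proof (intro conjI)
  show "cl_in Es (int_in Es (rauzy j)) = rauzy j"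
    by (intro cl_in_int_in compact_imp_closed compact_rauzy rauzy_Es rauzy_subset_closure)
  show "fiber j \<subseteq> Eu" by (auto simp: fiber_iff)
  then show "cl_in Eu (int_in Eu (fiber j)) = fiber j"
    by (intro cl_in_int_in compact_imp_closed compact_fiber fiber_subset_closure)
  show "part j = to_torus ` box_sum 0 (rauzy j) (fiber j)" by (simp add: part_def box_sum_tile)
  show "inj_on to_torus (box_sum 0 (int_in Es (rauzy j)) (int_in Eu (fiber j)))"
    using box_interior_inj by (simp add: box_interior_def)
qed (rule rauzy_Es compact_rauzy compact_fiber)+

lemma toral_M: "toral_automorphism (arp js) (to_torus x) = to_torus (M x)"
  by (rule toral_automorphism.abs_eq)

text \<open>The image of a box meets a translate of a box in an open set only if the translate belongs to an
  edge of the substituted path, because distinct tiles overlap in null sets.\<close>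

lemma transition:
  assumes "x \<in> box_interior i" "M x - z \<in> box_interior j" "z \<in> int_lattice"
  shows "(z, j) \<in> edges 0 (arp js [i])"
proof (rule ccontr)
  assume ne: "(z, j) \<notin> edges 0 (arp js [i])"
  let ?V = "box_interior i \<inter> (\<lambda>x. M x - z) -` box_interior j"
  have "open ?V"
    by (intro open_Int open_box_interior open_vimage continuous_on_diff continuous_M continuous_on_const)
  moreover have "negligible ?V"
  proof (rule negligible_M, rule negligible_subset)
    show "M ` ?V \<subseteq> (\<Union>(y, k)\<in>edges 0 (arp js [i]). tile y k \<inter> tile z j)"
    proof
      fix u assume "u \<in> M ` ?V"
      then obtain x where x: "x \<in> box_interior i" "M x - z \<in> box_interior j" "u = M x" by auto
      then have "x \<in> tile 0 i" "M x \<in> tile z j"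
        using box_interior_subset mem_tile_zero[of "M x" z j] by blast+
      then obtain y k where "(y, k) \<in> edges (M 0) (arp js [i])" "M x \<in> tile y k" using tile_M by blast
      then show "u \<in> (\<Union>(y, k)\<in>edges 0 (arp js [i]). tile y k \<inter> tile z j)"
        using x \<open>M x \<in> tile z j\<close> by auto
    qed
    have "negligible (tile y k \<inter> tile z j)" if "(y, k) \<in> edges 0 (arp js [i])" for y k
      using that ne int_lattice_edges[OF that zero_int_lattice] assms(3)
      by (intro negligible_tile_overlap) auto
    then show "negligible (\<Union>(y, k)\<in>edges 0 (arp js [i]). tile y k \<inter> tile z j)"
      by (intro negligible_Union finite_imageI finite_edges) auto
  qed
  ultimately have "?V = {}" by (rule open_negligible_empty)
  then show False using assms by blast
qed

text \<open>By \<open>transition\<close>, the lattice vector \<open>z\<close> between the lifts is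
  an edge of the substituted path. The set equation for this edge gives the stable inclusion; its
  height interval lies in that of the whole image path, which gives the unstable one.\<close>

lemma markov_property_part:
  "markov_property (toral_automorphism (arp js)) Es Eu (\<lambda>_. 0) rauzy fiber"
  unfolding markov_property_def
proof (intro allI impI)
  fix i j a b a' b'
  assume *: "a \<in> int_in Es (rauzy i) \<and> b \<in> int_in Eu (fiber i) \<and> a' \<in> int_in Es (rauzy j) \<and>
     b' \<in> int_in Eu (fiber j) \<and> toral_automorphism (arp js) (to_torus (0 + a + b)) = to_torus (0 + a' + b')"
  define z where "z = M (0 + a + b) - (0 + a' + b')"
  have z: "z \<in> int_lattice" using * by (simp add: z_def toral_M to_torus_eq_iff)
  have x: "0 + a + b \<in> box_interior i" "M (0 + a + b) - z \<in> box_interior j"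
    using * unfolding z_def box_interior_def box_sum_def by auto
  have edge: "(z, j) \<in> edges 0 (arp js [i])" by (rule transition[OF x z])
  have mem: "a \<in> rauzy i" "b \<in> fiber i" "a' \<in> rauzy j" "b' \<in> fiber j"
    using * int_in_subset by blast+
  then have mem': "a \<in> Es" "b \<in> Eu" "a' \<in> Es" "b' \<in> Eu" using rauzy_Es fiber_iff by blast+
  have za: "M a - proj z = a'"
  proof -
    have "proj z = proj (M (0 + a + b)) - proj (0 + a' + b')"
      unfolding z_def by (rule linear_diff[OF linear_proj])
    also have "\<dots> = M a - a'"
      by (simp only: proj_M box_coords(1)[OF mem'(1,2)] box_coords(1)[OF mem'(3,4)])
    finally show ?thesis by simp
  qed
  have zb: "l \<bullet> z = lam * (l \<bullet> b) - l \<bullet> b'"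
    by (simp only: z_def inner_diff_right l_M box_coords(2)[OF mem'(1,2)] box_coords(2)[OF mem'(3,4)])
  have Meu: "M w = (lam * (l \<bullet> w)) *\<^sub>R v" if "w \<in> Eu" for w
    using box_coords(3)[OF mem'(1) that] by (metis M_v matrix_vector_mult_scaleR scaleR_scaleR mult.commute)
  have zdec: "z = proj z + (l \<bullet> z) *\<^sub>R v" by (rule proj_decomp)
  show "toral_automorphism (arp js) ` stable_set 0 (rauzy i) b \<subseteq> stable_set 0 (rauzy j) b' \<and>
        unstable_set 0 a' (fiber j) \<subseteq> toral_automorphism (arp js) ` unstable_set 0 a (fiber i)"
  proof
    show "toral_automorphism (arp js) ` stable_set 0 (rauzy i) b \<subseteq> stable_set 0 (rauzy j) b'"
    proof
      fix u assume "u \<in> toral_automorphism (arp js) ` stable_set 0 (rauzy i) b"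
      then obtain c where c: "c \<in> rauzy i" "u = to_torus (M (0 + c + b))"
        by (auto simp: stable_set_def box_sum_def toral_M)
      have "M c - proj z \<in> rauzy j" by (rule rauzy_child[OF c(1) edge])
      moreover have "M (0 + c + b) - (0 + (M c - proj z) + b') = z"
      proof -
        have "M b - b' = (l \<bullet> z) *\<^sub>R v"
          using Meu[OF mem'(2)] box_coords(3)[OF mem'(3,4)] unfolding zb by (metis scaleR_left_diff_distrib)
        then show ?thesis using zdec by (simp add: matrix_vector_right_distrib algebra_simps)
      qed
      then have "u = to_torus (0 + (M c - proj z) + b')" using c z by (simp only: to_torus_eq_iff)
      ultimately show "u \<in> stable_set 0 (rauzy j) b'" unfolding stable_set_def box_sum_def by blast
    qed
    show "unstable_set 0 a' (fiber j) \<subseteq> toral_automorphism (arp js) ` unstable_set 0 a (fiber i)"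
    proof
      fix u assume "u \<in> unstable_set 0 a' (fiber j)"
      then obtain d where d: "d \<in> fiber j" "u = to_torus (0 + a' + d)"
        by (auto simp: unstable_set_def box_sum_def)
      have dE: "d \<in> Eu" "0 \<le> l \<bullet> d" "l \<bullet> d \<le> l $ j" using d fiber_iff by blast+
      \<comment> \<open>The height in the fiber of \<open>i\<close> that \<open>M\<close> sends to
        the height of \<open>d\<close> above the vertex \<open>z\<close>.\<close>
      define r where "r = (l \<bullet> d + l \<bullet> z) / lam"
      have "l \<bullet> 0 \<le> l \<bullet> z" by (rule edges_height_ge[OF edge]) (simp add: l_pos less_imp_le)
      moreover have "l \<bullet> z + l $ j \<le> l \<bullet> 0 + l \<bullet> abel (arp js [i])"
        by (rule edges_height_le[OF edge]) (simp add: l_pos less_imp_le)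
      moreover have "l \<bullet> abel (arp js [i]) = lam * l $ i"
        using l_M[of "axis i 1"] by (simp add: abel_arp)
      ultimately have r: "0 \<le> r" "r \<le> l $ i"
        using dE lam by (auto simp: r_def divide_simps mult.commute)
      then have "r *\<^sub>R v \<in> fiber i" unfolding fiber_def by (intro imageI) simp
      moreover have "M (0 + a + r *\<^sub>R v) - (0 + a' + d) = z"
      proof -
        have "M (r *\<^sub>R v) = (lam * r) *\<^sub>R v" by (simp add: matrix_vector_mult_scaleR M_v mult.commute)
        moreover have "lam * r = l \<bullet> d + l \<bullet> z" using lam by (simp add: r_def)
        moreover have "d = (l \<bullet> d) *\<^sub>R v" by (rule box_coords(3)[OF mem'(1) dE(1)])
        ultimately have "M (r *\<^sub>R v) - d = (l \<bullet> z) *\<^sub>R v" by (metis add_diff_cancel_left' scaleR_left_distrib)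
        then show ?thesis using zdec za by (simp add: matrix_vector_right_distrib algebra_simps)
      qed
      then have "u = to_torus (M (0 + a + r *\<^sub>R v))" 
        using d z by (metis to_torus_eq_iff)
      ultimately show "u \<in> toral_automorphism (arp js) ` unstable_set 0 a (fiber i)"
        unfolding unstable_set_def box_sum_def toral_M[symmetric] by blast
    qed
  qed
qed

lemma markov_partition_part: "markov_partition (toral_automorphism (arp js)) Es Eu part"
  unfolding markov_partition_def
proof (intro conjI allI impI)
  show "part i \<noteq> {}" for i
    using box_interior_nonempty box_interior_subset unfolding part_def by blast
  show "\<exists>t A B. (\<forall>i. product_structure Es Eu (part i) (t i) (A i) (B i)) \<and>
      markov_property (toral_automorphism (arp js)) Es Eu t A B"
    by (intro exI[of _ "\<lambda>_. 0"] exI[of _ rauzy] exI[of _ fiber] conjI allI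
        product_structure_part markov_property_part)
qed (simp_all add: closed_part closure_interior_part part_cover part_disjoint)

end


section \<open>Spectral data of a Pisot irreducible product\<close>

definition second_minors :: "'a::comm_ring_1^3^3 \<Rightarrow> 'a" where
  "second_minors m = (m$1$1 * m$2$2 - m$1$2 * m$2$1) + (m$1$1 * m$3$3 - m$1$3 * m$3$1)
     + (m$2$2 * m$3$3 - m$2$3 * m$3$2)"

lemma charpoly_three:
  fixes m :: "'a::comm_ring_1^3^3"
  shows "charpoly m = [:- det m, second_minors m, - trace m, 1:]"
  unfolding charpoly_def det_3 second_minors_def trace_def sum_3
  by (simp add: mat_def map_matrix_def) (simp add: algebra_simps)

lemma det_char_three:
  fixes m :: "real^3^3"
  shows "det (mat x - m) = x ^ 3 - trace m * x ^ 2 + second_minors m * x - det m"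
  unfolding det_3 second_minors_def trace_def sum_3
  by (simp add: mat_def) (simp add: algebra_simps power2_eq_square power3_eq_cube)

lemma eigenvalue_iff: "eigenvalue m x \<longleftrightarrow> x ^ 3 - trace m * x ^ 2 + second_minors m * x - det m = 0"
proof -
  have "(mat x - m) *v v = x *\<^sub>R v - m *v v" for v
    by (simp add: vec_eq_iff forall_3 matrix_vector_mult_def sum_3 mat_def algebra_simps)
  then have "eigenvalue m x \<longleftrightarrow> (\<exists>v. v \<noteq> 0 \<and> (mat x - m) *v v = 0)"
    unfolding eigenvalue_def by auto
  also have "\<dots> \<longleftrightarrow> det (mat x - m) = 0"
    unfolding matrix_nonfull_linear_equations_eq det_eq_0_rank using rank_bound[of "mat x - m"] by auto
  finally show ?thesis unfolding det_char_three .
qed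

lemma cayley_hamilton_three:
  fixes m :: "real^3^3"
  shows "m *v (m *v (m *v x)) = trace m *\<^sub>R (m *v (m *v x)) - second_minors m *\<^sub>R (m *v x) + det m *\<^sub>R x"
  unfolding vec_eq_iff forall_3 det_3 second_minors_def trace_def sum_3
  by (simp add: matrix_vector_mult_def sum_3) (simp add: algebra_simps)

text \<open>The maximum is taken over the real roots of a cubic: a finite set, nonempty by the
  intermediate value theorem.\<close>

lemma max_eigenvalue_eigenvalue: "eigenvalue m (max_eigenvalue m)"
proof -
  let ?p = "[:- det m, second_minors m, - trace m, 1:]"
  have p: "poly ?p x = x ^ 3 - trace m * x ^ 2 + second_minors m * x - det m" for x
    by (simp add: power2_eq_square power3_eq_cube algebra_simps)
  have E: "{x. eigenvalue m x} = {x. poly ?p x = 0}"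
    unfolding eigenvalue_iff p ..
  have fin: "finite {x. poly ?p x = 0}" by (rule poly_roots_finite) simp
  \<comment> \<open>With this \<open>K\<close> the leading term dominates the lower ones at
    \<open>K\<close> and at \<open>- K\<close>, so the cubic changes sign between them.\<close>
  define K where "K = 1 + \<bar>det m\<bar> + \<bar>second_minors m\<bar> + \<bar>trace m\<bar>"
  have K: "1 \<le> K" by (simp add: K_def)
  have bnd: "\<bar>poly ?p x - x ^ 3\<bar> \<le> (K - 1) * K ^ 2" if "\<bar>x\<bar> = K" for x
  proof -
    have "poly ?p x - x ^ 3 = (- trace m) * x ^ 2 + second_minors m * x + (- det m)" unfolding p by simp
    also have "\<bar>\<dots>\<bar> \<le> \<bar>trace m\<bar> * K ^ 2 + \<bar>second_minors m\<bar> * K + \<bar>det m\<bar>"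
      using that by (intro order_trans[OF abs_triangle_ineq] add_mono)
        (auto simp: abs_mult power_abs intro: order_trans[OF abs_triangle_ineq])
    also have "\<dots> \<le> \<bar>trace m\<bar> * K ^ 2 + \<bar>second_minors m\<bar> * K ^ 2 + \<bar>det m\<bar> * K ^ 2"
    proof (intro add_mono mult_left_mono)
      show "K \<le> K ^ 2" using K by (simp add: power2_eq_square)
      have "1 \<le> K ^ 2" using K by (rule one_le_power)
      then have "\<bar>det m\<bar> * 1 \<le> \<bar>det m\<bar> * K ^ 2" by (intro mult_left_mono) auto
      then show "\<bar>det m\<bar> \<le> \<bar>det m\<bar> * K ^ 2" by simp
    qed auto
    also have "\<dots> = (K - 1) * K ^ 2" by (simp add: K_def algebra_simps)
    finally show ?thesis .
  qed
  have cube: "(K - 1) * K ^ 2 \<le> K ^ 3" by (simp add: power2_eq_square power3_eq_cube left_diff_distrib)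
  have "0 \<le> poly ?p K" using bnd[of K] cube K by linarith
  moreover have "poly ?p (- K) \<le> 0" using bnd[of "- K"] cube K by simp
  moreover have "continuous_on {- K..K} (poly ?p)" by (intro continuous_intros)
  moreover have "- K \<le> K" using K by simp
  ultimately have "\<exists>x\<ge>- K. x \<le> K \<and> poly ?p x = 0" by (intro IVT')
  then have "{x. poly ?p x = 0} \<noteq> {}" by blast
  then have "max_eigenvalue m \<in> {x. eigenvalue m x}"
    unfolding max_eigenvalue_def E using fin by (rule Max_in[rotated])
  then show ?thesis by simp
qed

lemma irreducible_cubic_no_root:
  fixes a b c r :: rat
  assumes "irreducible [:c, b, a, 1:]"
  shows "poly [:c, b, a, 1:] r \<noteq> 0"
proof
  assume "poly [:c, b, a, 1:] r = 0"
  then have "[:- r, 1:] dvd [:c, b, a, 1:]" by (rule poly_eq_0_iff_dvd[THEN iffD1])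
  then have "[:c, b, a, 1:] dvd [:- r, 1:] \<or> is_unit [:- r, 1:]" by (rule irreducibleD'[OF assms])
  then show False
  proof
    assume "[:c, b, a, 1:] dvd [:- r, 1:]"
    then have "degree [:c, b, a, 1:] \<le> degree [:- r, 1:]" by (rule dvd_imp_degree_le) simp
    then show False by simp
  next
    assume "is_unit [:- r, 1:]"
    then show False by (simp add: is_unit_iff_degree)
  qed
qed

text \<open>If \<open>x\<close> were a double root, the remainder of the cubic modulo its derivative, which is linear,
  would give a rational root.\<close>

lemma irreducible_cubic_simple_root:
  fixes t s d :: rat and x :: real
  assumes irr: "irreducible [:- d, s, - t, 1:]"
    and root: "x ^ 3 - of_rat t * x ^ 2 + of_rat s * x - of_rat d = 0"
  shows "3 * x ^ 2 - 2 * of_rat t * x + of_rat s \<noteq> 0"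
proof
  assume der: "3 * x ^ 2 - 2 * of_rat t * x + of_rat s = 0"
  have no: "r ^ 3 - t * r ^ 2 + s * r - d \<noteq> 0" for r
    using irreducible_cubic_no_root[OF irr, of r]
    by (simp add: power2_eq_square power3_eq_cube algebra_simps)
  have "(6 * of_rat s - 2 * of_rat t ^ 2) * x + (of_rat s * of_rat t - 9 * of_rat d) = 
     9 * (x ^ 3 - of_rat t * x ^ 2 + of_rat s * x - of_rat d) - (3 * x - of_rat t) * (3 * x ^ 2 - 2 * of_rat t * x + of_rat s)"
    by (simp add: power2_eq_square power3_eq_cube algebra_simps)
  then have lin: "(6 * of_rat s - 2 * of_rat t ^ 2) * x + (of_rat s * of_rat t - 9 * of_rat d) = 0"
    using root der by simp
  show False
  proof (cases "6 * s - 2 * t ^ 2 = 0")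
    case False
    define r where "r = (9 * d - s * t) / (6 * s - 2 * t ^ 2)"
    have "of_rat (6 * s - 2 * t ^ 2) * x = of_rat (9 * d - s * t)"
      using lin by (simp add: of_rat_diff of_rat_mult of_rat_power)
    then have "x = of_rat r"
      using False unfolding r_def of_rat_divide by (simp add: eq_divide_eq mult.commute)
    then have "of_rat (r ^ 3 - t * r ^ 2 + s * r - d) = (0 :: real)"
      using root by (simp add: of_rat_diff of_rat_add of_rat_mult of_rat_power)
    then show False using no[of r] by simp
  next
    \<comment> \<open>The remainder vanishes identically, and the cubic is the cube of a linear
      factor with the rational root \<open>t / 3\<close>.\<close>
    case True
    then have s: "s = t ^ 2 / 3" by simp
    have "of_rat (6 * s - 2 * t ^ 2) = (0 :: real)" using True by simp
    then have z: "6 * of_rat s - 2 * of_rat t ^ 2 = (0 :: real)"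
      by (simp add: of_rat_diff of_rat_mult of_rat_power)
    have "of_rat (s * t - 9 * d) = (0 :: real)"
      using lin unfolding z by (simp add: of_rat_diff of_rat_mult)
    then have "s * t - 9 * d = 0" by simp
    then have "d = t ^ 3 / 27" using s by (simp add: power2_eq_square power3_eq_cube)
    then have "(t / 3) ^ 3 - t * (t / 3) ^ 2 + s * (t / 3) - d = 0"
      using s by (simp add: power2_eq_square power3_eq_cube field_simps)
    then show False using no by blast
  qed
qed

text \<open>The Lucas sequence of \<open>z ^ 2 - P * z + Q\<close>. Where a matrix satisfies this
  quadratic, its powers are combinations of the matrix and the identity with coefficients from this
  sequence.\<close>

fun lin_rec :: "real \<Rightarrow> real \<Rightarrow> nat \<Rightarrow> real" where
  "lin_rec P Q 0 = 0"
| "lin_rec P Q (Suc 0) = 1"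
| "lin_rec P Q (Suc (Suc n)) = P * lin_rec P Q (Suc n) - Q * lin_rec P Q n"

text \<open>Splitting off one root leaves a recursion of first order with inhomogeneity
  \<open>b ^ n\<close>. The resulting bound \<open>(n + 1) * r ^ n\<close> also covers a double
  root.\<close>

lemma lin_rec_summable:
  assumes ab: "a + b = complex_of_real P" "a * b = complex_of_real Q" "cmod a < 1" "cmod b < 1"
  shows "summable (\<lambda>n. \<bar>lin_rec P Q n\<bar>)"
proof -
  define u where "u = lin_rec P Q"
  have u: "u 0 = 0" "u 1 = 1" "u (Suc (Suc n)) = P * u (Suc n) - Q * u n" for n
    by (simp_all add: u_def)
  define r where "r = max (cmod a) (cmod b)"
  have r: "0 \<le> r" "r < 1" "cmod a \<le> r" "cmod b \<le> r" using ab by (auto simp: r_def le_max_iff_disj)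
  have step: "complex_of_real (u (Suc n)) = a * u n + b ^ n" for n
  proof (induction n)
    case (Suc n)
    have "complex_of_real (u (Suc (Suc n))) = (a + b) * u (Suc n) - (a * b) * u n"
      unfolding u(3) ab by simp
    also have "\<dots> = a * u (Suc n) + b * (u (Suc n) - a * u n)" by (simp add: algebra_simps)
    also have "\<dots> = a * u (Suc n) + b ^ Suc n" unfolding Suc by simp
    finally show ?case .
  qed (use u in simp)
  have bound: "\<bar>u (Suc n)\<bar> \<le> of_nat (Suc n) * r ^ n" for n
  proof (induction n)
    case (Suc n)
    have "\<bar>u (Suc (Suc n))\<bar> = cmod (a * u (Suc n) + b ^ Suc n)"
      using arg_cong[OF step[of "Suc n"], of cmod] by simp
    also have "\<dots> \<le> cmod a * \<bar>u (Suc n)\<bar> + cmod b ^ Suc n"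
      by (rule order_trans[OF norm_triangle_ineq]) (simp add: norm_mult norm_power)
    also have "\<dots> \<le> r * (of_nat (Suc n) * r ^ n) + r ^ Suc n"
      using r Suc by (intro add_mono mult_mono power_mono) auto
    finally show ?case by (simp add: algebra_simps)
  qed (use u in simp)
  have "summable (\<lambda>n. of_nat (Suc n) * r ^ n)"
    using geometric_deriv_sums[of r] r by (auto simp: sums_iff)
  then have "summable (\<lambda>n. \<bar>u (Suc n)\<bar>)"
    by (rule summable_comparison_test'[of _ 0]) (use bound in simp)
  then have "summable (\<lambda>n. \<bar>u n\<bar>)" by (subst summable_Suc_iff[symmetric])
  then show ?thesis by (simp only: u_def)
qed

lemma quadratic_roots: "\<exists>a b. a + b = complex_of_real P \<and> a * b = complex_of_real Q"
proof -
  define w where "w = csqrt (complex_of_real (P ^ 2 - 4 * Q))"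
  have w: "w ^ 2 = complex_of_real (P ^ 2 - 4 * Q)" by (simp add: w_def)
  have "((P + w) / 2) * ((P - w) / 2) = (P ^ 2 - w ^ 2) / 4" by (simp add: power2_eq_square field_simps)
  also have "\<dots> = complex_of_real Q" unfolding w by simp
  finally have "((P + w) / 2) * ((P - w) / 2) = complex_of_real Q" .
  moreover have "(P + w) / 2 + (P - w) / 2 = complex_of_real P" by (simp add: field_simps)
  ultimately show ?thesis by blast
qed

lemma linear_axis_expansion:
  fixes f :: "real^'n \<Rightarrow> 'b::real_vector"
  assumes "linear f"
  shows "f x = (\<Sum>k\<in>UNIV. x $ k *\<^sub>R f (axis k 1))"
proof -
  have "x = (\<Sum>k\<in>UNIV. x $ k *\<^sub>R axis k 1)"
    using basis_expansion[of x] by (simp add: scalar_mult_eq_scaleR)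
  then have "f x = f (\<Sum>k\<in>UNIV. x $ k *\<^sub>R axis k 1)" by (rule arg_cong)
  then show ?thesis using assms by (simp add: linear_sum linear_scale)
qed

lemma of_real_of_rat: "complex_of_real (of_rat q) = of_rat q"
  by (cases q) (simp add: of_rat_rat)

lemma ar_matrix_row_unused:
  assumes "k \<notin> set js"
  shows "(ar_matrix js *v u) $ k = u $ k"
  using assms
proof (induction js)
  case (Cons x js)
  then show ?case unfolding ar_matrix_Cons[of x js] by (simp add: ar_matrix_single)
qed (simp add: ar_matrix_Nil)

lemma incidence_matrix_rat:
  fixes \<sigma> :: "3 list \<Rightarrow> 3 list"
  defines "m \<equiv> incidence_matrix \<sigma> :: rat^3^3" and "r \<equiv> incidence_matrix \<sigma> :: real^3^3"
  shows "of_rat (trace m) = trace r" "of_rat (second_minors m) = second_minors r" "of_rat (det m) = det r"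
  unfolding m_def r_def trace_def second_minors_def sum_3 det_3 incidence_matrix_def
  by (simp_all add: of_rat_add of_rat_diff of_rat_mult)

text \<open>The spectral projection onto the eigenline is \<open>N / c\<close> with \<open>N = M\<^sup>2 - P M + Q\<close>. It is the limit
  of \<open>M\<^sup>n / lam\<^sup>n\<close>, hence nonnegative, and \<open>M\<close> is a positive matrix, so that a Perron-Frobenius
  argument applies.\<close>

lemma pisot_data:
  assumes irr: "pisot_irreducible (arp js)"
  defines "lam \<equiv> max_eigenvalue (ar_matrix js)"
  obtains l v kap where "ar_pisot js lam l v kap"
    "\<And>u. ar_matrix js *v u = lam *\<^sub>R u \<Longrightarrow> u \<in> range (\<lambda>s. s *\<^sub>R v)"
proof -
  let ?R = "ar_matrix js"
  let ?q = "incidence_matrix (arp js) :: rat^3^3"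
  define M where "M = (\<lambda>x. ?R *v x)"
  define tq sq where "tq = trace ?q" and "sq = second_minors ?q"
  define t s where "t = trace ?R" and "s = second_minors ?R"
  have ts: "of_rat tq = t" "of_rat sq = s"
    using incidence_matrix_rat[of "arp js"] by (simp_all add: tq_def sq_def t_def s_def)
  have "of_rat (det ?q) = (1 :: real)" using incidence_matrix_rat(3)[of "arp js"] by (simp add: det_ar_matrix)
  then have dq: "det ?q = 1" by simp
  have irr': "irreducible [:- 1, sq, - tq, 1:]"
    using irr unfolding pisot_irreducible_def charpoly_three dq tq_def sq_def by blast
  have pisot: "pisot_number lam" using irr unfolding pisot_irreducible_def lam_def by blast
  then have lam: "1 < lam" by (simp add: pisot_number_def)
  have eig: "eigenvalue ?R lam" unfolding lam_def by (rule max_eigenvalue_eigenvalue)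
  then have root: "lam ^ 3 - t * lam ^ 2 + s * lam - 1 = 0"
    unfolding eigenvalue_iff t_def s_def det_ar_matrix .
  \<comment> \<open>\<open>P\<close> and \<open>Q\<close> are the sum and the product of the other
    two eigenvalues: the characteristic polynomial is \<open>z - lam\<close> times
    \<open>z ^ 2 - P * z + Q\<close>.\<close>
  define P where "P = t - lam"
  define Q where "Q = s - lam * P"
  have lQ: "lam * Q = 1" using root unfolding Q_def P_def
    by (simp add: power2_eq_square power3_eq_cube algebra_simps)
  \<comment> \<open>The quadratic factor at \<open>lam\<close>, which is also the derivative of the
    cubic there. It is nonzero because \<open>lam\<close> is a simple root.\<close>
  define c where "c = lam ^ 2 - P * lam + Q"
  have "c = 3 * lam ^ 2 - 2 * t * lam + s"
    by (simp add: c_def P_def Q_def power2_eq_square algebra_simps)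
  then have c: "c \<noteq> 0" using irreducible_cubic_simple_root[OF irr', of lam] root by (simp add: ts)

  have conj: "cmod z < 1" if z: "z ^ 2 - complex_of_real P * z + complex_of_real Q = 0" for z
  proof -
    have "z \<noteq> complex_of_real lam"
    proof
      assume "z = complex_of_real lam"
      then have "complex_of_real c = 0" using z by (simp add: c_def)
      then show False using c by simp
    qed
    moreover have "conjugate_of lam z"
      unfolding conjugate_of_def
    proof (intro exI conjI)
      show "irreducible [:- 1, sq, - tq, 1:]" by (rule irr')
      have rt: "of_rat tq = complex_of_real t" "of_rat sq = complex_of_real s"
        using ts by (metis of_real_of_rat)+
      show "poly (map_poly of_rat [:- 1, sq, - tq, 1:]) lam = 0"
        using root by (simp add: map_poly_pCons of_rat_minus ts power2_eq_square power3_eq_cube algebra_simps)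
      have "poly (map_poly of_rat [:- 1, sq, - tq, 1:]) z = z ^ 3 - complex_of_real t * z ^ 2 + complex_of_real s * z - 1"
        by (simp add: map_poly_pCons of_rat_minus rt power2_eq_square power3_eq_cube algebra_simps)
      also have "\<dots> = (z - complex_of_real lam) * (z ^ 2 - complex_of_real P * z + complex_of_real Q) + complex_of_real (lam * Q - 1)"
        by (simp add: P_def Q_def power2_eq_square power3_eq_cube algebra_simps)
      also have "\<dots> = 0" by (simp add: z lQ)
      finally show "poly (map_poly of_rat [:- 1, sq, - tq, 1:]) z = 0" .
    qed
    ultimately show ?thesis using pisot by (simp add: pisot_number_def)
  qed
  obtain a b where ab: "a + b = complex_of_real P" "a * b = complex_of_real Q"
    using quadratic_roots by blast
  have "a ^ 2 - complex_of_real P * a + complex_of_real Q = 0" "b ^ 2 - complex_of_real P * b + complex_of_real Q = 0"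
    by (simp_all add: ab[symmetric] power2_eq_square algebra_simps)
  then have ab1: "cmod a < 1" "cmod b < 1" using conj by blast+

  have letters: "k \<in> set js" for k
  proof (rule ccontr)
    assume k: "k \<notin> set js"
    have "?R $ k $ j = (if k = j then 1 else 0)" for j
      using ar_matrix_row_unused[OF k, of "axis j 1"]
      by (simp add: matrix_vector_mul_component inner_axis) (simp add: axis_def)
    then have "row k (mat 1 - ?R) = 0" by (simp add: row_def vec_eq_iff mat_def)
    then have "det (mat 1 - ?R) = 0" by (rule det_zero_row)
    then have "1 - t + s - 1 = 0" using det_char_three[of 1 ?R] by (simp add: t_def s_def det_ar_matrix)
    then have "of_rat tq = (of_rat sq :: real)" by (simp add: ts)
    then have "tq = sq" by simp
    then show False using irreducible_cubic_no_root[OF irr', of 1] by simp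
  qed
  have M_pos: "0 < M u $ i" if nonneg: "\<And>k. 0 \<le> u $ k" and nz: "u \<noteq> 0" for u i
  proof -
    obtain m where "u $ m \<noteq> 0" using nz by (auto simp: vec_eq_iff)
    then have "0 < u $ m" using nonneg[of m] by simp
    then show ?thesis unfolding M_def using letters nonneg by (intro ar_matrix_support) auto
  qed
  have M_simps: "M (x + y) = M x + M y" "M (x - y) = M x - M y" "M (k *\<^sub>R x) = k *\<^sub>R M x" for x y k
    by (simp_all add: M_def matrix_vector_right_distrib matrix_vector_mult_diff_distrib matrix_vector_mult_scaleR)
  define w where "w = (\<lambda>x. (1 / c) *\<^sub>R (M (M x) - P *\<^sub>R M x + Q *\<^sub>R x))"
  have linw: "linear w"
    by (intro linearI) (simp_all add: w_def M_simps algebra_simps)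
  have wM: "w (M x) = M (w x)" for x by (simp add: w_def M_simps)
  have Mw: "M (w x) = lam *\<^sub>R w x" for x
  proof -
    have ch: "M (M (M x)) = t *\<^sub>R M (M x) - s *\<^sub>R M x + x"
      using cayley_hamilton_three[of ?R x] by (simp add: M_def t_def s_def det_ar_matrix)
    have "M (M (M x) - P *\<^sub>R M x + Q *\<^sub>R x) - lam *\<^sub>R (M (M x) - P *\<^sub>R M x + Q *\<^sub>R x)
      = (t - P - lam) *\<^sub>R M (M x) + (Q + lam * P - s) *\<^sub>R M x + (1 - lam * Q) *\<^sub>R x"
      by (simp add: M_simps ch algebra_simps)
    also have "\<dots> = 0" by (simp add: lQ) (simp add: P_def Q_def)
    finally have "M (M (M x) - P *\<^sub>R M x + Q *\<^sub>R x) = lam *\<^sub>R (M (M x) - P *\<^sub>R M x + Q *\<^sub>R x)" by simp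
    then show ?thesis unfolding w_def M_simps(3) by (simp only: scaleR_scaleR mult.commute)
  qed
  have w_eig: "w u = u" if "M u = lam *\<^sub>R u" for u
  proof -
    have "M (M u) - P *\<^sub>R M u + Q *\<^sub>R u = c *\<^sub>R u"
      by (simp add: that M_simps c_def power2_eq_square algebra_simps)
    then show ?thesis using c by (simp add: w_def)
  qed
  have ww: "w (x - w x) = 0" for x
    using w_eig[OF Mw[of x]] linw by (simp add: linear_diff)

  define u where "u = lin_rec P Q"
  have u: "u 0 = 0" "u 1 = 1" "u (Suc (Suc n)) = P * u (Suc n) - Q * u n" for n
    by (simp_all add: u_def)
  have usum: "summable (\<lambda>n. \<bar>u n\<bar>)" unfolding u_def by (rule lin_rec_summable[OF ab ab1])
  have iter: "(M ^^ Suc n) x = u (Suc n) *\<^sub>R M x - (Q * u n) *\<^sub>R x" if "w x = 0" for n x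
  proof (induction n)
    case 0
    then show ?case using u by simp
  next
    case (Suc n)
    have "M (M x) - P *\<^sub>R M x + Q *\<^sub>R x = 0" using that c unfolding w_def scaleR_eq_0_iff by simp
    then have "M (M x) = P *\<^sub>R M x - Q *\<^sub>R x" by (simp add: algebra_simps)
    then have "(M ^^ Suc (Suc n)) x = u (Suc n) *\<^sub>R (P *\<^sub>R M x - Q *\<^sub>R x) - (Q * u n) *\<^sub>R M x"
      using Suc by (simp add: M_simps)
    then show ?case unfolding u(3) by (simp add: algebra_simps)
  qed
  obtain K where K: "0 < K" "\<And>x. norm (M x) \<le> norm x * K"
    using bounded_linear.pos_bounded[OF matrix_vector_mul_bounded_linear[of ?R]] unfolding M_def by blast
  \<comment> \<open>The formula for the powers starts at exponent 1, so the identity gets its own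
    bound 1.\<close>
  define kap where "kap = (\<lambda>n. case n of 0 \<Rightarrow> 1 | Suc n \<Rightarrow> \<bar>u (Suc n)\<bar> * K + \<bar>Q\<bar> * \<bar>u n\<bar>)"
  have "summable (\<lambda>n. \<bar>u (Suc n)\<bar> * K + \<bar>Q\<bar> * \<bar>u n\<bar>)"
    using usum summable_Suc_iff[of "\<lambda>n. \<bar>u n\<bar>"] by (intro summable_add summable_mult summable_mult2) blast+
  then have "summable (\<lambda>n. kap (Suc n))" by (simp add: kap_def)
  then have ksum: "summable kap" by (subst summable_Suc_iff[symmetric])
  have kbound: "norm ((M ^^ n) x) \<le> kap n * norm x" if "w x = 0" for n x
  proof (cases n)
    case (Suc m)
    have "norm ((M ^^ n) x) \<le> \<bar>u (Suc m)\<bar> * norm (M x) + \<bar>Q * u m\<bar> * norm x"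
      unfolding Suc iter[OF that] by (rule order_trans[OF norm_triangle_ineq4]) simp
    also have "\<dots> \<le> \<bar>u (Suc m)\<bar> * (norm x * K) + \<bar>Q * u m\<bar> * norm x"
      by (intro add_mono mult_left_mono K) auto
    finally show ?thesis by (simp add: Suc kap_def abs_mult algebra_simps)
  qed (simp add: kap_def)

  \<comment> \<open>The powers of \<open>M\<close> keep \<open>x\<close> nonnegative and differ from
    \<open>lam ^ n *\<^sub>R w x\<close> by at most \<open>kap n * norm (x - w x)\<close>, so no
    coordinate of \<open>w x\<close> can be negative.\<close>
  have w_nonneg: "0 \<le> w x $ k" if x: "\<And>k. 0 \<le> x $ k" for x k
  proof -
    have pow_nonneg: "0 \<le> (M ^^ n) x $ k" for n k
      by (induction n arbitrary: k) (auto simp: x M_def intro: ar_matrix_nonneg)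
    have pow_w: "(M ^^ n) (y + w x) = (M ^^ n) y + lam ^ n *\<^sub>R w x" for n y
      by (induction n) (simp_all add: M_simps Mw algebra_simps)
    have "norm ((M ^^ n) x - lam ^ n *\<^sub>R w x) \<le> kap n * norm (x - w x)" for n
      using kbound[OF ww, of n x] pow_w[of n "x - w x"] by simp
    then have le: "- (kap n * norm (x - w x)) \<le> lam ^ n * (w x $ k)" for n
    proof -
      have "\<bar>((M ^^ n) x - lam ^ n *\<^sub>R w x) $ k\<bar> \<le> kap n * norm (x - w x)"
        using component_le_norm_cart order_trans \<open>\<And>n. norm ((M ^^ n) x - lam ^ n *\<^sub>R w x) \<le> kap n * norm (x - w x)\<close> by blast
      then show ?thesis using pow_nonneg[of n k] by simp
    qed
    have kge: "0 \<le> kap n" for n by (cases n) (use K in \<open>simp_all add: kap_def\<close>)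
    have "- (kap n * norm (x - w x)) \<le> w x $ k" for n
    proof (cases "0 \<le> w x $ k")
      case True
      then show ?thesis using kge[of n] by (meson mult_nonneg_nonneg neg_le_0_iff_le norm_ge_zero order_trans)
    next
      case False
      then have "lam ^ n * (w x $ k) \<le> 1 * (w x $ k)"
        using lam by (intro mult_right_mono_neg) (auto intro: one_le_power)
      then show ?thesis using le[of n] by simp
    qed
    moreover have "(\<lambda>n. - (kap n * norm (x - w x))) \<longlonglongrightarrow> - (0 * norm (x - w x))"
      by (intro tendsto_intros summable_LIMSEQ_zero[OF ksum])
    ultimately show ?thesis by (intro LIMSEQ_le_const2[of _ "- (0 * norm (x - w x))", simplified]) auto
  qed
  have w_pos: "0 < w x $ k" if "\<And>k. 0 \<le> x $ k" "w x \<noteq> 0" for x k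
  proof -
    have "0 < M (w x) $ k" by (rule M_pos[OF w_nonneg[OF that(1)] that(2)])
    then show ?thesis using lam by (simp add: Mw zero_less_mult_iff)
  qed
  obtain e where e: "e \<noteq> 0" "M e = lam *\<^sub>R e" using eig by (auto simp: eigenvalue_def M_def)
  obtain j where j: "w (axis j 1) \<noteq> 0"
  proof (rule ccontr)
    assume "\<not> thesis"
    then have z: "w (axis k 1) = 0" for k using that by blast
    have "w e = (\<Sum>k\<in>UNIV. e $ k *\<^sub>R w (axis k 1))" by (rule linear_axis_expansion[OF linw])
    then show False using z w_eig[OF e(2)] e(1) by simp
  qed
  define v where "v = w (axis j 1)"
  have v: "0 < v $ k" for k unfolding v_def by (rule w_pos[OF _ j]) (simp add: axis_def)
  have Mv: "M v = lam *\<^sub>R v" by (simp add: v_def Mw)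
  \<comment> \<open>Subtract the largest multiple of \<open>v\<close> that leaves a nonnegative
    vector. The difference is an eigenvector with a zero coordinate at \<open>m\<close>, which
    positivity of \<open>M\<close> excludes unless it is 0.\<close>
  have line: "\<exists>r. y = r *\<^sub>R v" if y: "M y = lam *\<^sub>R y" for y
  proof -
    define r where "r = Min ((\<lambda>k. y $ k / v $ k) ` UNIV)"
    have "r \<in> (\<lambda>k. y $ k / v $ k) ` UNIV" unfolding r_def by (intro Min_in) auto
    then obtain m where m: "r = y $ m / v $ m" by blast
    have ge: "0 \<le> (y - r *\<^sub>R v) $ k" for k
    proof -
      have "r \<le> y $ k / v $ k" unfolding r_def by (intro Min_le) auto
      then show ?thesis using v[of k] by (simp add: pos_le_divide_eq)
    qed
    have "y - r *\<^sub>R v = 0"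
    proof (rule ccontr)
      assume "y - r *\<^sub>R v \<noteq> 0"
      then have "0 < M (y - r *\<^sub>R v) $ m" by (rule M_pos[OF ge])
      then show False using v[of m] by (simp add: M_simps y Mv m)
    qed
    then show ?thesis by auto
  qed
  \<comment> \<open>The projection \<open>w\<close> has rank one, so comparing first coordinates
    recovers the linear form by which it multiplies \<open>v\<close>.\<close>
  define l :: "real^3" where "l = (\<chi> k. w (axis k 1) $ 1 / v $ 1)"
  have wl: "w x = (l \<bullet> x) *\<^sub>R v" for x
  proof -
    obtain r where r: "w x = r *\<^sub>R v" using line[OF Mw] by blast
    have "w x = (\<Sum>k\<in>UNIV. x $ k *\<^sub>R w (axis k 1))" by (rule linear_axis_expansion[OF linw])
    then have "w x $ 1 = (\<Sum>k\<in>UNIV. x $ k * w (axis k 1) $ 1)" by simp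
    then have "w x $ 1 / v $ 1 = l \<bullet> x"
      by (simp add: l_def inner_vec_def sum_divide_distrib mult.commute)
    then show ?thesis using r v[of 1] by simp
  qed
  have l_v: "l \<bullet> v = 1"
  proof -
    have "(l \<bullet> v) *\<^sub>R v = 1 *\<^sub>R v" using wl[of v] w_eig[OF Mv] by simp
    moreover have "v \<noteq> 0" using v[of 1] by auto
    ultimately show ?thesis unfolding scaleR_cancel_right by simp
  qed
  have l_M: "l \<bullet> M x = lam * (l \<bullet> x)" for x
  proof -
    have "(l \<bullet> M x) *\<^sub>R v = M (w x)" by (simp only: wl[symmetric] wM)
    also have "\<dots> = (lam * (l \<bullet> x)) *\<^sub>R v" by (simp only: Mw) (simp only: wl scaleR_scaleR)
    finally have "(l \<bullet> M x) *\<^sub>R v = (lam * (l \<bullet> x)) *\<^sub>R v" .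
    moreover have "v \<noteq> 0" using v[of 1] by auto
    ultimately show ?thesis unfolding scaleR_cancel_right by simp
  qed
  have l_nonneg: "0 \<le> l $ k" for k
    using w_nonneg[of "axis k 1" 1] v[of 1] by (simp add: l_def axis_def)
  have l_pos: "0 < l $ k" for k
  proof -
    have "l \<noteq> 0" using l_v by auto
    then obtain m where "l $ m \<noteq> 0" by (auto simp: vec_eq_iff)
    then have m: "0 < l $ m" using l_nonneg[of m] by simp
    have "(axis k 1 :: real^3) \<noteq> 0" by (simp add: axis_eq_0_iff)
    then have Mp: "0 < M (axis k 1) $ i" for i by (intro M_pos) (simp_all add: axis_def)
    have "0 < l \<bullet> M (axis k 1)"
      unfolding inner_vec_def using m Mp l_nonneg
      by (intro sum_pos2[of _ m]) (auto simp: less_imp_le)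
    then show ?thesis using lam by (simp add: l_M zero_less_mult_iff)
  qed
  have "ar_pisot js lam l v kap"
  proof
    show "norm (ar_matrix (list_power js n) *v x) \<le> kap n * norm x" if "l \<bullet> x = 0" for n x
      using kbound[of x n] that unfolding ar_matrix_power by (simp add: wl M_def)
  qed (use lam l_pos v Mv l_M l_v letters ksum in \<open>simp_all add: M_def\<close>)
  moreover have "y \<in> range (\<lambda>s. s *\<^sub>R v)" if "ar_matrix js *v y = lam *\<^sub>R y" for y
    using line[of y] that by (auto simp: M_def)
  ultimately show ?thesis using that by blast
qed


section \<open>Identification of the invariant subspaces and conclusion\<close>

context ar_pisot
begin

lemma stable_plane_Es: "eigenvalue (ar_matrix js) lam \<Longrightarrow> stable_plane (ar_matrix js) = Es"
proof (rule stable_plane_eqI)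
  have "l \<noteq> 0" using l_pos[of 1] by auto
  then have dim: "dim Es = 2" unfolding Es_def by (subst dim_hyperplane) auto
  have lim: "(\<lambda>n. (((*v) (ar_matrix js)) ^^ n) x) \<longlonglongrightarrow> 0" if "x \<in> Es" for x
  proof (rule Lim_null_comparison[OF always_eventually[OF allI]])
    show "norm ((((*v) (ar_matrix js)) ^^ n) x) \<le> kap n * norm x" for n
      using kap(2)[of x n] that by (simp add: ar_matrix_power mem_Es)
    show "(\<lambda>n. kap n * norm x) \<longlonglongrightarrow> 0" using kap_tendsto by (rule tendsto_mult_left_zero)
  qed
  have "subspace Es" unfolding Es_def by (rule subspace_hyperplane)
  moreover have "(*v) (ar_matrix js) ` Es \<subseteq> Es" by (auto simp: mem_Es l_M)
  ultimately show "contracting_plane (ar_matrix js) Es"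
    using dim lim by (simp add: contracting_plane_def)
qed (use lam in auto)

end

theorem theorem4p4:
  fixes js :: "3 list" and \<sigma> :: "3 list \<Rightarrow> 3 list"
  assumes "js \<noteq> []"
    and "\<sigma> = arnoux_rauzy_product js"
    and "pisot_irreducible \<sigma>"
  shows "\<exists>P :: 3 \<Rightarrow> torus set.
    markov_partition (toral_automorphism \<sigma>)
      (stable_plane (incidence_matrix \<sigma>)) (unstable_line (incidence_matrix \<sigma>)) P \<and>
    (\<forall>i. connected (P i))"
proof -
  define lam where "lam = max_eigenvalue (ar_matrix js)"
  have "pisot_irreducible (arp js)" using assms by simp
  then obtain l v kap where data: "ar_pisot js lam l v kap"
    and line: "\<And>u. ar_matrix js *v u = lam *\<^sub>R u \<Longrightarrow> u \<in> range (\<lambda>s. s *\<^sub>R v)"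
    unfolding lam_def using pisot_data by blast
  interpret ar_pisot js lam l v kap by (rule data)
  have "stable_plane (ar_matrix js) = Es"
    unfolding lam_def by (intro stable_plane_Es) (simp add: lam_def max_eigenvalue_eigenvalue)
  moreover have "unstable_line (ar_matrix js) = Eu"
    using line by (auto simp: unstable_line_def Eu_def matrix_vector_mult_scaleR M_v mult.commute
        simp flip: lam_def)
  ultimately show ?thesis
    using markov_partition_part connected_part assms(2) by auto
qed

end
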